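(* Let $n\ge2$, let $L$ be an algebraically closed field, and let $G$ be a connected semisimple linear algebraic subgroup of $\mathrm{SL}_{n,L}$. Assume that the tautological representation of $G$ on $L^n$ is irreducible and that the morphism $f$ does not vanish identically on $G$. Then $G=\mathrm{SL}_{n,L}$.
   Context: The morphism $f:\mathrm{GL}_{n,L}\to\mathbb{A}^1_L$ is defined as follows. Consider the symmetric polynomial with integer coefficients in variables $\alpha_1,\dots,\alpha_n$ $$\prod_{i_1,i_2}(\alpha_{i_1}-\alpha_{i_2})\cdot\prod_{i_1,i_2,i_3}(\alpha_{i_1}\alpha_{i_2}-\alpha_{i_3}^2)\cdot\prod_{i_1,\dots,i_4}(\alpha_{i_1}\alpha_{i_2}-\alpha_{i_3}\alpha_{i_4})\cdot\prod_{i_1,\dots,i_6}(\alpha_{i_1}\alpha_{i_2}\alpha_{i_3}-\alpha_{i_4}\alpha_{i_5}\alpha_{i_6}),$$ where each product runs over all tuples of pairwise distinct indices in $\{1,\dots,n\}$ (empty products equal 1). Write it as an integral polynomial in the coefficients $\beta_1,\dots,\beta_n$ of $\prod_i(T-\alpha_i)=T^n+\beta_1T^{n-1}+\dots+\beta_n$, and apply it to the coefficients of the characteristic polynomial of $\gamma\in\mathrm{GL}_n$. Thus $f(\gamma)$ is this expression evaluated at the eigenvalues of $\gamma$ (with multiplicities). *)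

theory Defs
  imports "Jordan_Normal_Form.Char_Poly" "HOL-Algebra.Solvable_Groups" "HOL-Library.FuncSet"
begin

definition alg_closed :: "'a::field itself \<Rightarrow> bool" where
  "alg_closed _ \<longleftrightarrow> (\<forall>p :: 'a poly. degree p > 0 \<longrightarrow> (\<exists>x. poly p x = 0))"

definition GL :: "nat \<Rightarrow> 'a::field mat monoid" where
  "GL n = \<lparr> carrier = {A \<in> carrier_mat n n. det A \<noteq> 0}, mult = (*), one = 1\<^sub>m n \<rparr>"

definition SL_set :: "nat \<Rightarrow> 'a::field mat set" where
  "SL_set n = {A \<in> carrier_mat n n. det A = 1}"

inductive_set mat_poly_fun :: "nat \<Rightarrow> ('a::field mat \<Rightarrow> 'a) set" for n where
  const: "(\<lambda>A. c) \<in> mat_poly_fun n"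
| entry: "i < n \<Longrightarrow> j < n \<Longrightarrow> (\<lambda>A. A $$ (i, j)) \<in> mat_poly_fun n"
| add: "p \<in> mat_poly_fun n \<Longrightarrow> q \<in> mat_poly_fun n \<Longrightarrow> (\<lambda>A. p A + q A) \<in> mat_poly_fun n"
| mult: "p \<in> mat_poly_fun n \<Longrightarrow> q \<in> mat_poly_fun n \<Longrightarrow> (\<lambda>A. p A * q A) \<in> mat_poly_fun n"

definition zariski_closed :: "nat \<Rightarrow> 'a::field mat set \<Rightarrow> bool" where
  "zariski_closed n Z \<longleftrightarrow> (\<exists>P \<subseteq> mat_poly_fun n.
      Z = {A \<in> carrier_mat n n. \<forall>p \<in> P. p A = 0})"

definition zariski_connected :: "nat \<Rightarrow> 'a::field mat set \<Rightarrow> bool" where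
  "zariski_connected n S \<longleftrightarrow> \<not> (\<exists>Z1 Z2. zariski_closed n Z1 \<and> zariski_closed n Z2 \<and>
      S \<subseteq> Z1 \<union> Z2 \<and> S \<inter> Z1 \<inter> Z2 = {} \<and> S \<inter> Z1 \<noteq> {} \<and> S \<inter> Z2 \<noteq> {})"

definition algebraic_subgroup :: "nat \<Rightarrow> 'a::field mat set \<Rightarrow> bool" where
  "algebraic_subgroup n G \<longleftrightarrow> subgroup G (GL n) \<and> zariski_closed n G"

text \<open>Semisimple: the radical (maximal connected solvable closed normal subgroup) is trivial,
  i.e. every connected solvable closed normal subgroup is trivial.\<close>
definition semisimple_alg :: "nat \<Rightarrow> 'a::field mat set \<Rightarrow> bool" where
  "semisimple_alg n G \<longleftrightarrow> (\<forall>H. algebraic_subgroup n H \<and> zariski_connected n H \<and>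
      H \<lhd> ((GL n) \<lparr>carrier := G\<rparr>) \<and> solvable ((GL n) \<lparr>carrier := H\<rparr>)
      \<longrightarrow> H = {1\<^sub>m n})"

definition lin_subspace :: "nat \<Rightarrow> 'a::field vec set \<Rightarrow> bool" where
  "lin_subspace n W \<longleftrightarrow> W \<subseteq> carrier_vec n \<and> 0\<^sub>v n \<in> W \<and>
     (\<forall>v\<in>W. \<forall>w\<in>W. v + w \<in> W) \<and> (\<forall>c. \<forall>v\<in>W. c \<cdot>\<^sub>v v \<in> W)"

definition taut_irreducible :: "nat \<Rightarrow> 'a::field mat set \<Rightarrow> bool" where
  "taut_irreducible n G \<longleftrightarrow> \<not> (\<exists>W. lin_subspace n W \<and> W \<noteq> {0\<^sub>v n} \<and> W \<noteq> carrier_vec n \<and>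
      (\<forall>A\<in>G. \<forall>w\<in>W. A *\<^sub>v w \<in> W))"

definition dtuples :: "nat \<Rightarrow> nat \<Rightarrow> (nat \<Rightarrow> nat) set" where
  "dtuples k n = {t \<in> {..<k} \<rightarrow>\<^sub>E {..<n}. inj_on t {..<k}}"

definition f_expr :: "nat \<Rightarrow> (nat \<Rightarrow> 'a::field) \<Rightarrow> 'a" where
  "f_expr n a =
     (\<Prod>t\<in>dtuples 2 n. a (t 0) - a (t 1)) *
     (\<Prod>t\<in>dtuples 3 n. a (t 0) * a (t 1) - a (t 2) ^ 2) *
     (\<Prod>t\<in>dtuples 4 n. a (t 0) * a (t 1) - a (t 2) * a (t 3)) *
     (\<Prod>t\<in>dtuples 6 n. a (t 0) * a (t 1) * a (t 2) - a (t 3) * a (t 4) * a (t 5))"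

definition f_mor :: "nat \<Rightarrow> 'a::field mat \<Rightarrow> 'a" where
  "f_mor n A = (SOME v. \<exists>a. char_poly A = (\<Prod>i<n. [:- a i, 1:]) \<and> v = f_expr n a)"

end

theory Submission
  imports Defs
begin

text \<open>A connected algebraic group is irreducible as a variety. Let \<open>\<gamma>\<close> be an element of \<open>G\<close> with
  \<open>f \<gamma> \<noteq> 0\<close>; after a change of basis it is diagonal. The tangent space \<open>\<gg>\<close> of \<open>G\<close> at \<open>1\<close> is stable under
  conjugation by \<open>G\<close>. It is not contained in the scalars: otherwise Nakayama's lemma shows that the
  maximal ideal at \<open>1\<close> is generated locally by the single function \<open>u = x\<^sub>0\<^sub>0 - 1\<close>, and comparing
  commutators shows that \<open>x\<close> is scalar to every order in \<open>u\<close>, against \<open>det x = 1\<close>. The relations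
  excluded by \<open>f\<close> separate the weights of \<open>\<gamma>\<close> on matrices well enough for \<open>\<gg>\<close> to contain an elementary
  matrix \<open>E\<^sub>i\<^sub>j\<close>. As every matrix entry is a nonzero function on the irreducible variety \<open>G\<close>,
  conjugation spreads it to all of the trace-zero matrices. Finally the ideal of \<open>G\<close> in coordinates of an
  open cell of \<open>SL\<close> is stable under all derivations and radical, hence zero, so \<open>G\<close> is dense in \<open>SL\<close>.\<close>

section \<open>Polynomial functions on matrices\<close>

text \<open>The characteristic is arbitrary, and this shapes the proof. Without an exponential map,
  group elements are not produced from tangent vectors; everything passes through polynomial
  functions vanishing on \<open>G\<close>, their Taylor expansions, and the fact that a product
  vanishes on \<open>G\<close> only if a factor does. If the characteristic divides
  \<open>n\<close>, scalar matrices have trace zero, so the determinant alone does not forbid a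
  scalar tangent space. What forbids it is a conflict of orders: the quadratic estimate, applied to
  commutators, lets the order of contact with the scalars grow without bound, while
  \<open>(1 + T) ^ n - 1\<close> has finite order at 0. Likewise a shift of a matrix by a scalar is
  detected by the finiteness of its spectrum and not by its trace. Derivations kill
  \<open>p\<close>-th powers, hence the radical ideal at the end. The role of \<open>f\<close>:
  conjugation by the diagonal \<gamma> scales the entry \<open>(i, j)\<close> by
  \<open>\<alpha> i / \<alpha> j\<close>, and a position whose factor occurs nowhere else can be
  isolated. One row \<open>k\<close> of such positions is enough, since brackets of matrices from
  column \<open>k\<close> and row \<open>k\<close> yield the rest.\<close>

definition polyfun :: "nat \<Rightarrow> ('a::field mat \<Rightarrow> 'a) \<Rightarrow> bool" where
  "polyfun n p \<longleftrightarrow> (\<exists>q\<in>mat_poly_fun n. \<forall>A\<in>carrier_mat n n. p A = q A)"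

text \<open>Determinants, cofactors and matrix products are given by the expected formulas in the
  entries only when the dimensions fit. Hence \<open>polyfun\<close> asks for equality on the n by n
  matrices alone.\<close>

lemma polyfun_cong: "polyfun n p \<Longrightarrow> (\<And>A. A \<in> carrier_mat n n \<Longrightarrow> q A = p A) \<Longrightarrow> polyfun n q"
  unfolding polyfun_def by auto

lemma polyfun_mat_poly_fun: "p \<in> mat_poly_fun n \<Longrightarrow> polyfun n p"
  unfolding polyfun_def by auto

lemma polyfun_const [intro, simp]: "polyfun n (\<lambda>A. c)"
  by (rule polyfun_mat_poly_fun, rule mat_poly_fun.const)

lemma polyfun_entry [intro]: "i < n \<Longrightarrow> j < n \<Longrightarrow> polyfun n (\<lambda>A. A $$ (i, j))"
  by (rule polyfun_mat_poly_fun, rule mat_poly_fun.entry)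

lemma polyfun_add [intro]: "polyfun n p \<Longrightarrow> polyfun n q \<Longrightarrow> polyfun n (\<lambda>A. p A + q A)"
  unfolding polyfun_def by (fastforce intro: mat_poly_fun.add)

lemma polyfun_mult [intro]: "polyfun n p \<Longrightarrow> polyfun n q \<Longrightarrow> polyfun n (\<lambda>A. p A * q A)"
  unfolding polyfun_def by (fastforce intro: mat_poly_fun.mult)

lemma polyfun_uminus [intro]: "polyfun n p \<Longrightarrow> polyfun n (\<lambda>A. - p A)"
  using polyfun_mult[OF polyfun_const[of n "-1"], of p] by simp

lemma polyfun_diff [intro]: "polyfun n p \<Longrightarrow> polyfun n q \<Longrightarrow> polyfun n (\<lambda>A. p A - q A)"
  using polyfun_add[OF _ polyfun_uminus, of n p q] by simp

lemma polyfun_power [intro]: "polyfun n p \<Longrightarrow> polyfun n (\<lambda>A. p A ^ k)"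
  by (induction k) auto

lemma polyfun_sum [intro]: "(\<And>i. i \<in> S \<Longrightarrow> polyfun n (p i)) \<Longrightarrow> polyfun n (\<lambda>A. \<Sum>i\<in>S. p i A)"
  by (induction S rule: infinite_finite_induct) auto

lemma polyfun_prod [intro]: "(\<And>i. i \<in> S \<Longrightarrow> polyfun n (p i)) \<Longrightarrow> polyfun n (\<lambda>A. \<Prod>i\<in>S. p i A)"
  by (induction S rule: infinite_finite_induct) auto

lemma polyfun_compose:
  assumes "polyfun n p"
    and F: "\<And>A. A \<in> carrier_mat n n \<Longrightarrow> F A \<in> carrier_mat n n"
    and e: "\<And>i j. i < n \<Longrightarrow> j < n \<Longrightarrow> polyfun n (\<lambda>A. F A $$ (i, j))"
  shows "polyfun n (\<lambda>A. p (F A))"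
proof -
  obtain q where q: "q \<in> mat_poly_fun n" "\<And>A. A \<in> carrier_mat n n \<Longrightarrow> p A = q A"
    using assms(1) unfolding polyfun_def by auto
  from q(1) have "polyfun n (\<lambda>A. q (F A))"
    by induction (use e in auto)
  then show ?thesis by (rule polyfun_cong) (use q(2) F in auto)
qed

lemma polyfun_det:
  assumes M: "\<And>A. A \<in> carrier_mat n n \<Longrightarrow> M A \<in> carrier_mat m m"
    and e: "\<And>i j. i < m \<Longrightarrow> j < m \<Longrightarrow> polyfun n (\<lambda>A. M A $$ (i, j))"
  shows "polyfun n (\<lambda>A. det (M A))"
proof (rule polyfun_cong)
  show "polyfun n (\<lambda>A. \<Sum>p \<in> {p. p permutes {0..<m}}. signof p * (\<Prod>i = 0..<m. M A $$ (i, p i)))"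
    by (intro polyfun_sum polyfun_mult polyfun_prod polyfun_const e) (auto simp: permutes_in_image)
  show "det (M A) = (\<Sum>p \<in> {p. p permutes {0..<m}}. signof p * (\<Prod>i = 0..<m. M A $$ (i, p i)))"
    if "A \<in> carrier_mat n n" for A
    by (rule det_def'[OF M[OF that]])
qed

lemma polyfun_mult_mat:
  assumes "\<And>A. A \<in> carrier_mat n n \<Longrightarrow> F A \<in> carrier_mat n n"
    and "\<And>A. A \<in> carrier_mat n n \<Longrightarrow> H A \<in> carrier_mat n n"
    and f: "\<And>i j. i < n \<Longrightarrow> j < n \<Longrightarrow> polyfun n (\<lambda>A. F A $$ (i, j))"
    and h: "\<And>i j. i < n \<Longrightarrow> j < n \<Longrightarrow> polyfun n (\<lambda>A. H A $$ (i, j))"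
    and "i < n" "j < n"
  shows "polyfun n (\<lambda>A. (F A * H A) $$ (i, j))"
proof (rule polyfun_cong)
  show "polyfun n (\<lambda>A. \<Sum>k\<in>{0..<n}. F A $$ (i, k) * H A $$ (k, j))"
    by (intro polyfun_sum polyfun_mult f h) (use assms in auto)
  show "(F A * H A) $$ (i, j) = (\<Sum>k\<in>{0..<n}. F A $$ (i, k) * H A $$ (k, j))"
    if "A \<in> carrier_mat n n" for A
    using assms(1,2)[OF that] assms(5,6) by (auto simp: scalar_prod_def)
qed

lemma polyfun_cofactor:
  assumes "i < n" "j < n"
  shows "polyfun n (\<lambda>A. cofactor A i j)"
  unfolding cofactor_def
proof (intro polyfun_mult polyfun_const)
  show "polyfun n (\<lambda>A. det (mat_delete A i j))"
  proof (rule polyfun_det[where m = "n - 1"])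
    fix i' j' assume ij: "i' < n - 1" "j' < n - 1"
    show "polyfun n (\<lambda>A. mat_delete A i j $$ (i', j'))"
    proof (rule polyfun_cong)
      show "polyfun n (\<lambda>A. A $$ (if i' < i then i' else Suc i', if j' < j then j' else Suc j'))"
        by (rule polyfun_entry) (use ij in auto)
    qed (use ij in \<open>auto simp: mat_delete_def\<close>)
  qed (auto simp: mat_delete_def)
qed

lemma polyfun_adj_mat:
  assumes "i < n" "j < n"
  shows "polyfun n (\<lambda>A. adj_mat A $$ (i, j))"
  by (rule polyfun_cong[OF polyfun_cofactor[OF assms(2,1)]]) (use assms in \<open>auto simp: adj_mat_def\<close>)

subsection \<open>Taylor expansion and directional derivatives\<close>

text \<open>A function vanishing at \<open>A\<close> lies in the ideal generated by the coordinate
  differences. No factorials are divided out, so every characteristic is covered; the quotients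
  \<open>s\<close> are not unique.\<close>

lemma polyfun_taylor:
  fixes p :: "'a::field mat \<Rightarrow> 'a" and A :: "'a mat"
  assumes "polyfun n p" and A: "A \<in> carrier_mat n n"
  shows "\<exists>s. (\<forall>ij\<in>{..<n}\<times>{..<n}. polyfun n (s ij)) \<and>
    (\<forall>x\<in>carrier_mat n n. p x = p A + (\<Sum>ij\<in>{..<n}\<times>{..<n}. (x $$ ij - A $$ ij) * s ij x))"
proof -
  let ?I = "{..<n}\<times>{..<n}"
  obtain q where q: "q \<in> mat_poly_fun n" "\<And>A. A \<in> carrier_mat n n \<Longrightarrow> p A = q A"
    using assms(1) unfolding polyfun_def by auto
  from q(1) have "\<exists>s. (\<forall>ij\<in>?I. polyfun n (s ij)) \<and>
    (\<forall>x\<in>carrier_mat n n. q x = q A + (\<Sum>ij\<in>?I. (x $$ ij - A $$ ij) * s ij x))"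
  proof induction
    case (const c)
    show ?case by (rule exI[of _ "\<lambda>_ _. 0"]) auto
  next
    case (entry i j)
    show ?case
    proof (intro exI[of _ "\<lambda>ij x. if ij = (i, j) then 1 else 0"] conjI ballI)
      fix x :: "'a mat" assume "x \<in> carrier_mat n n"
      have "(\<Sum>ij\<in>?I. (x $$ ij - A $$ ij) * (if ij = (i, j) then 1 else 0))
        = (\<Sum>ij\<in>?I. if ij = (i, j) then x $$ ij - A $$ ij else 0)"
        by (rule sum.cong) auto
      also have "\<dots> = x $$ (i, j) - A $$ (i, j)" using entry by (subst sum.delta) auto
      finally show "x $$ (i, j) = A $$ (i, j) +
        (\<Sum>ij\<in>?I. (x $$ ij - A $$ ij) * (if ij = (i, j) then 1 else 0))" by simp
    qed auto
  next
    case (add p q)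
    then obtain s1 s2 where s: "\<forall>ij\<in>?I. polyfun n (s1 ij)" "\<forall>ij\<in>?I. polyfun n (s2 ij)"
      "\<forall>x\<in>carrier_mat n n. p x = p A + (\<Sum>ij\<in>?I. (x $$ ij - A $$ ij) * s1 ij x)"
      "\<forall>x\<in>carrier_mat n n. q x = q A + (\<Sum>ij\<in>?I. (x $$ ij - A $$ ij) * s2 ij x)" by blast
    show ?case
    proof (intro exI[of _ "\<lambda>ij x. s1 ij x + s2 ij x"] conjI ballI)
      fix x :: "'a mat" assume x: "x \<in> carrier_mat n n"
      show "p x + q x = p A + q A + (\<Sum>ij\<in>?I. (x $$ ij - A $$ ij) * (s1 ij x + s2 ij x))"
        unfolding distrib_left sum.distrib using bspec[OF s(3) x] bspec[OF s(4) x] by simp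
    qed (use s(1,2) in auto)
  next
    case (mult p q)
    then obtain s1 s2 where s: "\<forall>ij\<in>?I. polyfun n (s1 ij)" "\<forall>ij\<in>?I. polyfun n (s2 ij)"
      "\<forall>x\<in>carrier_mat n n. p x = p A + (\<Sum>ij\<in>?I. (x $$ ij - A $$ ij) * s1 ij x)"
      "\<forall>x\<in>carrier_mat n n. q x = q A + (\<Sum>ij\<in>?I. (x $$ ij - A $$ ij) * s2 ij x)" by blast
    \<comment> \<open>The witness comes from
      \<open>p q - p(A) q(A) = (p - p(A)) q + p(A) (q - q(A))\<close>.\<close>
    show ?case
    proof (intro exI[of _ "\<lambda>ij x. s1 ij x * q x + p A * s2 ij x"] conjI ballI)
      fix x :: "'a mat" assume x: "x \<in> carrier_mat n n"
      let ?y = "\<lambda>ij. x $$ ij - A $$ ij"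
      have "(\<Sum>ij\<in>?I. ?y ij * (s1 ij x * q x + p A * s2 ij x))
        = (\<Sum>ij\<in>?I. ?y ij * s1 ij x) * q x + p A * (\<Sum>ij\<in>?I. ?y ij * s2 ij x)"
        unfolding sum_distrib_left sum_distrib_right sum.distrib[symmetric]
        by (rule sum.cong) (auto simp: algebra_simps)
      also have "\<dots> = (p x - p A) * q x + p A * (q x - q A)"
        using bspec[OF s(3) x] bspec[OF s(4) x] by simp
      finally show "p x * q x = p A * q A + (\<Sum>ij\<in>?I. ?y ij * (s1 ij x * q x + p A * s2 ij x))"
        by (simp add: algebra_simps)
    qed (intro polyfun_add polyfun_mult polyfun_const bspec[OF s(1)] bspec[OF s(2)]
        polyfun_mat_poly_fun[OF mult(1)] polyfun_mat_poly_fun[OF mult(2)]; assumption)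
  qed
  then obtain s where s: "\<forall>ij\<in>?I. polyfun n (s ij)"
    "\<forall>x\<in>carrier_mat n n. q x = q A + (\<Sum>ij\<in>?I. (x $$ ij - A $$ ij) * s ij x)" by blast
  show ?thesis
  proof (intro exI[of _ s] conjI ballI)
    fix x :: "'a mat" assume x: "x \<in> carrier_mat n n"
    show "p x = p A + (\<Sum>ij\<in>?I. (x $$ ij - A $$ ij) * s ij x)"
      unfolding q(2)[OF x] q(2)[OF A] by (rule bspec[OF s(2) x])
  qed (use s(1) in blast)
qed

text \<open>The linear coefficient of \<open>p\<close> along a line is a derivative that makes sense
  in every characteristic. The chosen polynomial is unique once the field is infinite.\<close>

definition dirderiv :: "('a::field mat \<Rightarrow> 'a) \<Rightarrow> 'a mat \<Rightarrow> 'a mat \<Rightarrow> 'a" where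
  "dirderiv p A X = coeff (SOME P. \<forall>t. poly P t = p (A + t \<cdot>\<^sub>m X)) 1"

lemma poly_eq_infinite:
  fixes P Q :: "'a::field poly"
  assumes "infinite (UNIV :: 'a set)" "\<And>t. poly P t = poly Q t"
  shows "P = Q"
proof (rule ccontr)
  assume "P \<noteq> Q"
  then have "finite {t. poly (P - Q) t = 0}" by (intro poly_roots_finite) auto
  moreover have "{t. poly (P - Q) t = 0} = UNIV" using assms(2) by auto
  ultimately show False using assms(1) by auto
qed

lemma dirderiv_eqI:
  fixes P :: "'a::field poly"
  assumes inf: "infinite (UNIV :: 'a set)" and P: "\<And>t. poly P t = p (A + t \<cdot>\<^sub>m X)"
  shows "dirderiv p A X = coeff P 1"
proof -
  have "(SOME P. \<forall>t. poly P t = p (A + t \<cdot>\<^sub>m X)) = P"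
    by (rule some_equality) (use P in \<open>auto intro: poly_eq_infinite[OF inf]\<close>)
  then show ?thesis by (simp add: dirderiv_def)
qed

lemma polyfun_line:
  assumes "polyfun n p" and A: "A \<in> carrier_mat n n" and X: "X \<in> carrier_mat n n"
  shows "\<exists>P. \<forall>t. poly P t = p (A + t \<cdot>\<^sub>m X)"
proof -
  obtain q where q: "q \<in> mat_poly_fun n" "\<And>A. A \<in> carrier_mat n n \<Longrightarrow> p A = q A"
    using assms(1) unfolding polyfun_def by auto
  from q(1) have "\<exists>P. \<forall>t. poly P t = q (A + t \<cdot>\<^sub>m X)"
  proof induction
    case (const c)
    show ?case by (rule exI[of _ "[:c:]"]) auto
  next
    case (entry i j)
    show ?case by (rule exI[of _ "[:A $$ (i,j), X $$ (i,j):]"]) (use A X entry in auto)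
  next
    case (add p q)
    then show ?case by (metis poly_add)
  next
    case (mult p q)
    then show ?case by (metis poly_mult)
  qed
  then show ?thesis using q(2) A X by auto
qed

text \<open>The values \<open>s ij A\<close> serve as partial derivatives, whichever quotients
  \<open>s\<close> were chosen.\<close>

lemma dirderiv_taylor:
  fixes p :: "'a::field mat \<Rightarrow> 'a"
  assumes inf: "infinite (UNIV :: 'a set)" and A: "A \<in> carrier_mat n n" and X: "X \<in> carrier_mat n n"
    and s: "\<And>ij. ij \<in> {..<n}\<times>{..<n} \<Longrightarrow> polyfun n (s ij)"
    and eq: "\<And>x. x \<in> carrier_mat n n \<Longrightarrow>
      p x = c + (\<Sum>ij\<in>{..<n}\<times>{..<n}. (x $$ ij - A $$ ij) * s ij x)"
  shows "dirderiv p A X = (\<Sum>ij\<in>{..<n}\<times>{..<n}. X $$ ij * s ij A)"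
proof -
  let ?I = "{..<n}\<times>{..<n}"
  have "\<forall>ij. \<exists>P. ij \<in> ?I \<longrightarrow> (\<forall>t. poly P t = s ij (A + t \<cdot>\<^sub>m X))"
    using polyfun_line[OF s A X] by auto
  then obtain P where P: "\<And>ij t. ij \<in> ?I \<Longrightarrow> poly (P ij) t = s ij (A + t \<cdot>\<^sub>m X)" by metis
  define R where "R = [:c:] + (\<Sum>ij\<in>?I. [:0, X $$ ij:] * P ij)"
  have "dirderiv p A X = coeff R 1"
  proof (rule dirderiv_eqI[OF inf])
    fix t
    have "p (A + t \<cdot>\<^sub>m X) = c + (\<Sum>ij\<in>?I. ((A + t \<cdot>\<^sub>m X) $$ ij - A $$ ij) * s ij (A + t \<cdot>\<^sub>m X))"
      by (rule eq) (use A X in auto)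
    also have "\<dots> = poly R t"
      unfolding R_def poly_add poly_sum poly_mult
      by (intro arg_cong2[of _ _ _ _ "(+)"] sum.cong) (use A X P in auto)
    finally show "poly R t = p (A + t \<cdot>\<^sub>m X)" by simp
  qed
  also have "\<dots> = (\<Sum>ij\<in>?I. X $$ ij * coeff (P ij) 0)"
    unfolding R_def by (simp add: coeff_sum)
  also have "\<dots> = (\<Sum>ij\<in>?I. X $$ ij * s ij A)"
  proof (rule sum.cong)
    fix ij assume "ij \<in> ?I"
    have "coeff (P ij) 0 = poly (P ij) 0" by (simp add: poly_0_coeff_0)
    also have "\<dots> = s ij (A + 0 \<cdot>\<^sub>m X)" using P \<open>ij \<in> ?I\<close> by blast
    also have "A + 0 \<cdot>\<^sub>m X = A" using A X by (intro eq_matI) auto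
    finally show "X $$ ij * coeff (P ij) 0 = X $$ ij * s ij A" by simp
  qed simp
  finally show ?thesis .
qed

lemma dirderiv_linear:
  fixes p :: "'a::field mat \<Rightarrow> 'a"
  assumes inf: "infinite (UNIV :: 'a set)" and p: "polyfun n p" and A: "A \<in> carrier_mat n n"
  shows "\<exists>g. \<forall>X\<in>carrier_mat n n. dirderiv p A X = (\<Sum>ij\<in>{..<n}\<times>{..<n}. g ij * X $$ ij)"
proof -
  obtain s where s: "\<forall>ij\<in>{..<n}\<times>{..<n}. polyfun n (s ij)"
    "\<forall>x\<in>carrier_mat n n. p x = p A + (\<Sum>ij\<in>{..<n}\<times>{..<n}. (x $$ ij - A $$ ij) * s ij x)"
    using polyfun_taylor[OF p A] by blast
  have "dirderiv p A X = (\<Sum>ij\<in>{..<n}\<times>{..<n}. s ij A * X $$ ij)" if "X \<in> carrier_mat n n" for X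
    using dirderiv_taylor[OF inf A that bspec[OF s(1)] bspec[OF s(2)]] by (simp add: mult.commute)
  then show ?thesis by (intro exI[of _ "\<lambda>ij. s ij A"] ballI)
qed

text \<open>The quotients of \<open>polyfun_taylor\<close> are expanded once more. Their values at
  \<open>A\<close> are forced to be \<open>g\<close>, as testing against matrices with a single
  nonzero entry shows.\<close>

lemma polyfun_taylor2:
  fixes p :: "'a::field mat \<Rightarrow> 'a"
  assumes inf: "infinite (UNIV :: 'a set)" and p: "polyfun n p" and A: "A \<in> carrier_mat n n"
    and d: "\<And>X. X \<in> carrier_mat n n \<Longrightarrow> dirderiv p A X = (\<Sum>ij\<in>{..<n}\<times>{..<n}. g ij * X $$ ij)"
  shows "\<exists>r. (\<forall>a\<in>{..<n}\<times>{..<n}. \<forall>b\<in>{..<n}\<times>{..<n}. polyfun n (r a b)) \<and>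
    (\<forall>x\<in>carrier_mat n n. p x = p A + (\<Sum>a\<in>{..<n}\<times>{..<n}. g a * (x $$ a - A $$ a))
      + (\<Sum>a\<in>{..<n}\<times>{..<n}. \<Sum>b\<in>{..<n}\<times>{..<n}. (x $$ a - A $$ a) * (x $$ b - A $$ b) * r a b x))"
proof -
  let ?I = "{..<n}\<times>{..<n}"
  obtain s where s: "\<forall>ij\<in>?I. polyfun n (s ij)"
    "\<forall>x\<in>carrier_mat n n. p x = p A + (\<Sum>ij\<in>?I. (x $$ ij - A $$ ij) * s ij x)"
    using polyfun_taylor[OF p A] by blast
  have "\<forall>a\<in>?I. \<exists>r. (\<forall>b\<in>?I. polyfun n (r b)) \<and>
    (\<forall>x\<in>carrier_mat n n. s a x = s a A + (\<Sum>b\<in>?I. (x $$ b - A $$ b) * r b x))"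
    using polyfun_taylor[OF _ A] s(1) by blast
  then obtain r where r: "\<forall>a\<in>?I. (\<forall>b\<in>?I. polyfun n (r a b)) \<and>
    (\<forall>x\<in>carrier_mat n n. s a x = s a A + (\<Sum>b\<in>?I. (x $$ b - A $$ b) * r a b x))"
    unfolding bchoice_iff by blast
  have sg: "s a A = g a" if a: "a \<in> ?I" for a
  proof -
    define X :: "'a mat" where "X = mat n n (\<lambda>ij. if ij = a then 1 else 0)"
    have X: "X \<in> carrier_mat n n" by (simp add: X_def)
    have *: "(\<Sum>ij\<in>?I. X $$ ij * f ij) = f a" for f
    proof -
      have "(\<Sum>ij\<in>?I. X $$ ij * f ij) = (\<Sum>ij\<in>?I. if ij = a then f ij else 0)"
        by (rule sum.cong) (auto simp: X_def)
      then show ?thesis using a by simp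
    qed
    have "dirderiv p A X = (\<Sum>ij\<in>?I. X $$ ij * s ij A)"
      by (rule dirderiv_taylor[OF inf A X _ bspec[OF s(2)]]) (use s(1) in auto)
    also have "\<dots> = s a A" by (rule *)
    finally have "s a A = (\<Sum>ij\<in>?I. X $$ ij * g ij)" using d[OF X] by (simp add: mult.commute)
    then show ?thesis using * by simp
  qed
  show ?thesis
  proof (intro exI[of _ r] conjI ballI)
    fix x :: "'a mat" assume x: "x \<in> carrier_mat n n"
    have "p x = p A + (\<Sum>a\<in>?I. (x $$ a - A $$ a) * s a x)" using s(2) x by blast
    also have "(\<Sum>a\<in>?I. (x $$ a - A $$ a) * s a x) = (\<Sum>a\<in>?I. g a * (x $$ a - A $$ a)
      + (\<Sum>b\<in>?I. (x $$ a - A $$ a) * (x $$ b - A $$ b) * r a b x))"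
    proof (rule sum.cong[OF refl])
      fix a assume a: "a \<in> ?I"
      have "s a x = g a + (\<Sum>b\<in>?I. (x $$ b - A $$ b) * r a b x)"
        using bspec[OF conjunct2[OF bspec[OF r a]] x] sg[OF a] by simp
      then show "(x $$ a - A $$ a) * s a x = g a * (x $$ a - A $$ a)
        + (\<Sum>b\<in>?I. (x $$ a - A $$ a) * (x $$ b - A $$ b) * r a b x)"
        by (simp add: algebra_simps sum_distrib_left)
    qed
    also have "p A + \<dots> = p A + (\<Sum>a\<in>?I. g a * (x $$ a - A $$ a))
      + (\<Sum>a\<in>?I. \<Sum>b\<in>?I. (x $$ a - A $$ a) * (x $$ b - A $$ b) * r a b x)"
      by (simp add: sum.distrib add.assoc)
    finally show "p x = \<dots>" .
  qed (use r in blast)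
qed

section \<open>Connectedness implies irreducibility\<close>

text \<open>A rank bound: a triangular matrix with nonzero diagonal is invertible, yet it factors
  through dimension \<open>N\<close>. If \<open>N < m\<close>, padding the first factor with zero
  columns makes it square and singular.\<close>

lemma triangular_bound:
  fixes A B :: "nat \<Rightarrow> nat \<Rightarrow> 'a::field"
  assumes d: "\<And>i. i < m \<Longrightarrow> (\<Sum>k<N. A i k * B i k) \<noteq> 0"
    and t: "\<And>i j. i < m \<Longrightarrow> j < i \<Longrightarrow> (\<Sum>k<N. A i k * B j k) = 0"
  shows "m \<le> N"
proof (rule ccontr)
  assume "\<not> m \<le> N"
  then have Nm: "N < m" by simp
  define P where "P = mat m m (\<lambda>(i, k). if k < N then A i k else 0)"
  define Q where "Q = mat m m (\<lambda>(k, j). B j k)"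
  have P: "P \<in> carrier_mat m m" and Q: "Q \<in> carrier_mat m m" by (auto simp: P_def Q_def)
  have PQ: "(P * Q) $$ (i, j) = (\<Sum>k<N. A i k * B j k)" if "i < m" "j < m" for i j
  proof -
    have "(P * Q) $$ (i, j) = (\<Sum>k\<in>{0..<m}. (if k < N then A i k else 0) * B j k)"
      using that by (simp add: P_def Q_def scalar_prod_def)
    also have "\<dots> = (\<Sum>k<N. A i k * B j k)"
      by (rule sum.mono_neutral_cong_right) (use Nm in auto)
    finally show ?thesis .
  qed
  have "upper_triangular (P * Q)"
    using PQ t by (auto simp: upper_triangular_def P_def)
  then have "det (P * Q) \<noteq> 0"
    using P Q PQ d by (auto simp: upper_triangular_imp_det_eq_0_iff[of _ m] diag_mat_def)
  moreover have "det P = 0"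
  proof -
    have "P *\<^sub>v unit_vec m N = 0\<^sub>v m"
      by (rule eq_vecI) (use Nm in \<open>auto simp: P_def mult_mat_vec_def\<close>)
    then show ?thesis
      using det_0_iff_vec_prod_zero_field[OF P] Nm unit_vec_nonzero[of N m]
        by (metis unit_vec_carrier)
  qed
  ultimately show False using det_mult[OF P Q] by simp
qed

text \<open>A homogeneous space with an invariant set of functions spanning a finite-dimensional space.
  Finite dimension gives the descending chain condition for the zero sets, so that the decomposition
  into irreducible components needs no basis theorem.\<close>

locale homogeneous_functions =
  fixes G :: "'b set" and T :: "('b \<Rightarrow> 'a::field) set" and N :: nat and e :: "nat \<Rightarrow> 'b \<Rightarrow> 'a"
  assumes G_nonempty: "G \<noteq> {}"
    and T_span: "\<And>\<tau>. \<tau> \<in> T \<Longrightarrow> \<exists>a. \<forall>x\<in>G. \<tau> x = (\<Sum>k<N. a k * e k x)"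
    and homogeneous: "\<And>x y. x \<in> G \<Longrightarrow> y \<in> G \<Longrightarrow> \<exists>\<phi> \<psi>. \<phi> x = y \<and>
      (\<forall>z\<in>G. \<phi> z \<in> G \<and> \<psi> z \<in> G \<and> \<psi> (\<phi> z) = z \<and> \<phi> (\<psi> z) = z) \<and>
      (\<forall>\<tau>\<in>T. (\<lambda>z. \<tau> (\<phi> z)) \<in> T \<and> (\<lambda>z. \<tau> (\<psi> z)) \<in> T)"
begin

definition zeros :: "('b \<Rightarrow> 'a) set \<Rightarrow> 'b set" where
  "zeros S = {x \<in> G. \<forall>\<tau>\<in>S. \<tau> x = 0}"

definition closeds :: "'b set set" where
  "closeds = zeros ` Pow T"

definition irred :: "'b set \<Rightarrow> bool" where
  "irred W \<longleftrightarrow> (\<forall>\<Z>. finite \<Z> \<longrightarrow> \<Z> \<subseteq> closeds \<longrightarrow> W \<subseteq> \<Union>\<Z> \<longrightarrow> (\<exists>Z\<in>\<Z>. W \<subseteq> Z))"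

text \<open>Points and functions with a triangular, hence nonsingular, matrix of values. Their
  greatest number, \<open>height\<close>, plays the part of a dimension: it is bounded, and smaller
  on proper closed subsets.\<close>

definition triang :: "'b set \<Rightarrow> nat \<Rightarrow> bool" where
  "triang Z m \<longleftrightarrow> (\<exists>x \<tau>. (\<forall>i<m. x i \<in> Z \<and> \<tau> i \<in> T \<and> \<tau> i (x i) \<noteq> 0) \<and>
     (\<forall>i<m. \<forall>j<i. \<tau> i (x j) = 0))"

definition height :: "'b set \<Rightarrow> nat" where
  "height Z = Max {m. triang Z m}"

lemma triang_bound:
  assumes "Z \<subseteq> G" "triang Z m"
  shows "m \<le> N"
proof -
  obtain x \<tau> where x: "\<And>i. i < m \<Longrightarrow> x i \<in> Z \<and> \<tau> i \<in> T \<and> \<tau> i (x i) \<noteq> 0"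
    and t: "\<And>i j. i < m \<Longrightarrow> j < i \<Longrightarrow> \<tau> i (x j) = 0"
    using assms(2) unfolding triang_def by blast
  have "\<forall>i. \<exists>a. i < m \<longrightarrow> (\<forall>x\<in>G. \<tau> i x = (\<Sum>k<N. a k * e k x))"
    using x T_span by metis
  then obtain A where A: "\<And>i x. i < m \<Longrightarrow> x \<in> G \<Longrightarrow> \<tau> i x = (\<Sum>k<N. A i k * e k x)"
    by metis
  have xG: "x i \<in> G" if "i < m" for i using x assms(1) that by auto
  show ?thesis
  proof (rule triangular_bound)
    show "(\<Sum>k<N. A i k * e k (x i)) \<noteq> 0" if "i < m" for i
      using A[OF that xG[OF that]] x[OF that] by auto
    show "(\<Sum>k<N. A i k * e k (x j)) = 0" if "i < m" "j < i" for i j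
      using A[OF that(1) xG[of j]] t[OF that] that by auto
  qed
qed

lemma height_finite: "Z \<subseteq> G \<Longrightarrow> finite {m. triang Z m}"
  by (rule finite_subset[of _ "{..N}"]) (use triang_bound in auto)

text \<open>A system of maximal length for \<open>Z\<close> is prolonged by a point \<open>y\<close>
  of \<open>Z'\<close> outside \<open>Z\<close> and an equation of \<open>Z\<close> that fails at
  \<open>y\<close>; this equation vanishes at all earlier points.\<close>

lemma height_less:
  assumes "Z \<in> closeds" "Z \<subset> Z'" "Z' \<subseteq> G"
  shows "height Z < height Z'"
proof -
  have "triang Z 0" by (auto simp: triang_def)
  then have "triang Z (height Z)"
    unfolding height_def using Max_in[OF height_finite[of Z]] assms by auto
  then obtain x \<tau> where x: "\<And>i. i < height Z \<Longrightarrow> x i \<in> Z \<and> \<tau> i \<in> T \<and> \<tau> i (x i) \<noteq> 0"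
    and t: "\<And>i j. i < height Z \<Longrightarrow> j < i \<Longrightarrow> \<tau> i (x j) = 0"
    unfolding triang_def by blast
  obtain S where S: "S \<subseteq> T" "Z = zeros S" using assms(1) by (auto simp: closeds_def)
  obtain y where y: "y \<in> Z'" "y \<notin> Z" using assms(2) by auto
  then obtain \<sigma> where \<sigma>: "\<sigma> \<in> S" "\<sigma> y \<noteq> 0" using S assms(3) by (auto simp: zeros_def)
  have \<sigma>0: "\<sigma> z = 0" if "z \<in> Z" for z using \<sigma> S that by (auto simp: zeros_def)
  have "triang Z' (Suc (height Z))"
    unfolding triang_def
  proof (intro exI[of _ "x(height Z := y)"] exI[of _ "\<tau>(height Z := \<sigma>)"] conjI allI impI)
    fix i assume "i < Suc (height Z)"
    then show "(x(height Z := y)) i \<in> Z'" "(\<tau>(height Z := \<sigma>)) i \<in> T"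
      "(\<tau>(height Z := \<sigma>)) i ((x(height Z := y)) i) \<noteq> 0"
      using x[of i] y \<sigma> S assms(2) by (auto simp: less_Suc_eq)
    fix j assume "j < i"
    then show "(\<tau>(height Z := \<sigma>)) i ((x(height Z := y)) j) = 0"
      using x[of j] t[of i j] \<sigma>0 \<open>i < Suc (height Z)\<close> by (auto simp: less_Suc_eq)
  qed
  then have "Suc (height Z) \<le> height Z'"
    unfolding height_def[of Z'] by (intro Max_ge height_finite assms(3)) auto
  then show ?thesis by simp
qed

lemma closeds_subset: "Z \<in> closeds \<Longrightarrow> Z \<subseteq> G"
  by (auto simp: closeds_def zeros_def)

lemma closeds_Int: "Z1 \<in> closeds \<Longrightarrow> Z2 \<in> closeds \<Longrightarrow> Z1 \<inter> Z2 \<in> closeds"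
  unfolding closeds_def
proof (elim imageE)
  fix S1 S2 assume "S1 \<in> Pow T" "S2 \<in> Pow T" "Z1 = zeros S1" "Z2 = zeros S2"
  then show "Z1 \<inter> Z2 \<in> zeros ` Pow T"
    by (intro image_eqI[of _ _ "S1 \<union> S2"]) (auto simp: zeros_def)
qed

lemma G_closed: "G \<in> closeds"
  unfolding closeds_def by (rule image_eqI[of _ _ "{}"]) (auto simp: zeros_def)

text \<open>Noetherian induction on \<open>height\<close>: a reducible set is covered by finitely
  many closed sets, each meeting it in a proper closed subset.\<close>

lemma decomposition:
  assumes "Z \<in> closeds"
  shows "\<exists>\<W>. finite \<W> \<and> \<W> \<subseteq> closeds \<and> (\<forall>W\<in>\<W>. irred W) \<and> \<Union>\<W> = Z"
  using assms
proof (induction "height Z" arbitrary: Z rule: less_induct)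
  case less
  show ?case
  proof (cases "irred Z")
    case True
    then show ?thesis by (intro exI[of _ "{Z}"]) (use less in auto)
  next
    case False
    then obtain \<Z> where Z: "finite \<Z>" "\<Z> \<subseteq> closeds" "Z \<subseteq> \<Union>\<Z>" "\<And>Y. Y \<in> \<Z> \<Longrightarrow> \<not> Z \<subseteq> Y"
      unfolding irred_def by blast
    have "\<exists>\<W>. finite \<W> \<and> \<W> \<subseteq> closeds \<and> (\<forall>W\<in>\<W>. irred W) \<and> \<Union>\<W> = Z \<inter> Y" if Y: "Y \<in> \<Z>" for Y
    proof (rule less.hyps)
      show *: "Z \<inter> Y \<in> closeds" using less.prems Z(2) Y closeds_Int by blast
      show "height (Z \<inter> Y) < height Z"
        by (rule height_less[OF *]) (use Z(4)[OF Y] closeds_subset[OF less.prems] in auto)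
    qed
    then obtain f where f: "\<And>Y. Y \<in> \<Z> \<Longrightarrow> finite (f Y) \<and> f Y \<subseteq> closeds \<and> (\<forall>W\<in>f Y. irred W) \<and> \<Union>(f Y) = Z \<inter> Y"
      by metis
    show ?thesis
    proof (intro exI[of _ "\<Union>(f ` \<Z>)"] conjI)
      show "finite (\<Union>(f ` \<Z>))" using f Z(1) by blast
      show "\<Union>(f ` \<Z>) \<subseteq> closeds" using f by blast
      show "\<forall>W\<in>\<Union>(f ` \<Z>). irred W" using f by blast
      have "\<Union>(\<Union>(f ` \<Z>)) = (\<Union>Y\<in>\<Z>. \<Union>(f Y))" by blast
      also have "\<dots> = (\<Union>Y\<in>\<Z>. Z \<inter> Y)" by (rule SUP_cong) (use f in blast)+
      also have "\<dots> = Z" using Z(3) by blast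
      finally show "\<Union>(\<Union>(f ` \<Z>)) = Z" .
    qed
  qed
qed

lemma preimage_closed:
  assumes "\<forall>\<tau>\<in>T. (\<lambda>z. \<tau> (\<phi> z)) \<in> T" "\<forall>z\<in>G. \<phi> z \<in> G" "Z \<in> closeds"
  shows "{z\<in>G. \<phi> z \<in> Z} \<in> closeds"
proof -
  obtain S where S: "S \<subseteq> T" "Z = zeros S" using assms(3) by (auto simp: closeds_def)
  have "{z\<in>G. \<phi> z \<in> Z} = zeros ((\<lambda>\<tau> z. \<tau> (\<phi> z)) ` S)"
    unfolding S(2) zeros_def using assms(2) by auto
  moreover have "(\<lambda>\<tau> z. \<tau> (\<phi> z)) ` S \<subseteq> T" using S(1) assms(1) by blast
  ultimately show ?thesis unfolding closeds_def by blast
qed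

lemma irred_translate:
  assumes T: "\<forall>\<tau>\<in>T. (\<lambda>z. \<tau> (\<phi> z)) \<in> T \<and> (\<lambda>z. \<tau> (\<psi> z)) \<in> T"
    and b: "\<forall>z\<in>G. \<phi> z \<in> G \<and> \<psi> z \<in> G \<and> \<psi> (\<phi> z) = z \<and> \<phi> (\<psi> z) = z"
    and W: "W \<subseteq> G" "irred W"
  shows "irred (\<phi> ` W)"
  unfolding irred_def
proof (intro allI impI)
  fix \<Z> assume Z: "finite \<Z>" "\<Z> \<subseteq> closeds" "\<phi> ` W \<subseteq> \<Union>\<Z>"
  let ?P = "\<lambda>Z. {z\<in>G. \<phi> z \<in> Z}"
  have 1: "?P ` \<Z> \<subseteq> closeds" using preimage_closed[of \<phi>] T b Z(2) by blast
  have 2: "W \<subseteq> \<Union>(?P ` \<Z>)" using Z(3) W(1) by blast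
  have "\<exists>Z\<in>?P ` \<Z>. W \<subseteq> Z"
    using W(2)[unfolded irred_def] finite_imageI[OF Z(1), of ?P] 1 2 by blast
  then show "\<exists>Z\<in>\<Z>. \<phi> ` W \<subseteq> Z" by blast
qed

text \<open>In a cover by the least number of irreducible sets, each member has a point lying in no
  other member. By homogeneity every point behaves like such a point, so no two members
  meet.\<close>

lemma disjoint_components:
  "\<exists>\<W>. finite \<W> \<and> \<W> \<subseteq> closeds \<and> (\<forall>W\<in>\<W>. irred W) \<and> \<Union>\<W> = G \<and> disjoint \<W>"
proof -
  let ?Q = "\<lambda>\<W>. finite \<W> \<and> \<W> \<subseteq> closeds \<and> (\<forall>W\<in>\<W>. irred W) \<and> \<Union>\<W> = G"
  obtain \<W>0 where W0: "?Q \<W>0" using decomposition[OF G_closed] by blast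
  obtain \<W> where W: "?Q \<W>" and min: "\<And>\<V>. ?Q \<V> \<Longrightarrow> card \<W> \<le> card \<V>"
    using ex_has_least_nat[of ?Q \<W>0 card, OF W0] by blast
  \<comment> \<open>If every point of \<open>W\<close> lay in another member, \<open>W\<close> could
    be dropped, against minimality.\<close>
  have only: "\<exists>x\<in>W. \<forall>V\<in>\<W>. x \<in> V \<longrightarrow> V = W" if "W \<in> \<W>" for W
  proof (rule ccontr)
    assume "\<not> ?thesis"
    then have "\<Union>(\<W> - {W}) = G" using W that by blast
    then have "card \<W> \<le> card (\<W> - {W})" using W by (intro min) auto
    then show False using W that by (metis card_Diff1_less not_le)
  qed
  have cover: "\<exists>V\<in>\<W>. Y \<subseteq> V" if "irred Y" "Y \<subseteq> G" for Y
    using that W unfolding irred_def by blast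
  have "W1 = W2" if W12: "W1 \<in> \<W>" "W2 \<in> \<W>" "W1 \<inter> W2 \<noteq> {}" for W1 W2
  proof -
    obtain y where y: "y \<in> W1" "y \<in> W2" using W12 by blast
    have sub: "W1 \<subseteq> G" "W2 \<subseteq> G" using W W12 by auto
    obtain x where x: "x \<in> W1" "\<forall>V\<in>\<W>. x \<in> V \<longrightarrow> V = W1" using only W12 by blast
    have xy: "x \<in> G" "y \<in> G" using x(1) y sub by auto
    obtain \<phi> \<psi> where \<phi>: "\<phi> y = x"
      "\<forall>z\<in>G. \<phi> z \<in> G \<and> \<psi> z \<in> G \<and> \<psi> (\<phi> z) = z \<and> \<phi> (\<psi> z) = z"
      "\<forall>\<tau>\<in>T. (\<lambda>z. \<tau> (\<phi> z)) \<in> T \<and> (\<lambda>z. \<tau> (\<psi> z)) \<in> T"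
      using homogeneous[OF xy(2,1)] by blast
    have irr: "irred W1" "irred W2" using W W12 by auto
    \<comment> \<open>The map \<phi> carries \<open>y\<close> to a point \<open>x\<close> that lies
      in \<open>W1\<close> alone, so every irreducible set through \<open>y\<close> lands in
      \<open>W1\<close>. Hence all of them lie in the one member that contains the image of
      \<open>W1\<close> under \<psi>.\<close>
    have in1: "\<phi> ` V \<subseteq> W1" if V: "irred V" "V \<subseteq> G" "y \<in> V" for V
    proof -
      obtain U where "U \<in> \<W>" "\<phi> ` V \<subseteq> U"
        using cover[OF irred_translate[OF \<phi>(3,2) V(2,1)]] \<phi>(2) V(2) by blast
      then show ?thesis using x(2) V(3) \<phi>(1) by blast
    qed
    have "irred (\<psi> ` W1)"
      by (rule irred_translate[of \<psi> \<phi>]) (use \<phi> sub irr in auto)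
    then obtain V where V: "V \<in> \<W>" "\<psi> ` W1 \<subseteq> V"
      using cover[of "\<psi> ` W1"] \<phi>(2) sub by blast
    have sV: "W' \<subseteq> V" if W': "irred W'" "W' \<subseteq> G" "y \<in> W'" for W'
    proof
      fix z assume "z \<in> W'"
      then have "\<phi> z \<in> W1" "\<psi> (\<phi> z) = z" using in1[OF W'] \<phi>(2) W'(2) by auto
      then show "z \<in> V" using V(2) by force
    qed
    have "W1 = V" using sV[OF irr(1) sub(1) y(1)] V(1) only[OF W12(1)] by blast
    moreover have "W2 = V" using sV[OF irr(2) sub(2) y(2)] V(1) only[OF W12(2)] by blast
    ultimately show ?thesis by simp
  qed
  then have "disjoint \<W>" unfolding pairwise_def disjnt_def by blast
  then show ?thesis using W by blast
qed

end

text \<open>Comultiplication: the second components of \<open>l\<close> span a space containing all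
  left translates of \<open>p\<close>. This supplies the finite dimension required by
  \<open>homogeneous_functions\<close>.\<close>

lemma polyfun_comult:
  fixes p :: "'a::field mat \<Rightarrow> 'a"
  assumes "polyfun n p"
  shows "\<exists>l. \<forall>g\<in>carrier_mat n n. \<forall>x\<in>carrier_mat n n. p (g * x) = (\<Sum>(a, b)\<leftarrow>l. a g * b x)"
proof -
  obtain q where q: "q \<in> mat_poly_fun n" "\<And>A. A \<in> carrier_mat n n \<Longrightarrow> p A = q A"
    using assms(1) unfolding polyfun_def by auto
  from q(1) have "\<exists>l. \<forall>g\<in>carrier_mat n n. \<forall>x\<in>carrier_mat n n. q (g * x) = (\<Sum>(a, b)\<leftarrow>l. a g * b x)"
  proof induction
    case (const c)
    show ?case by (rule exI[of _ "[(\<lambda>_. c, \<lambda>_. 1)]"]) auto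
  next
    case (entry i j)
    show ?case
    proof (rule exI[of _ "map (\<lambda>k. (\<lambda>g. g $$ (i, k), \<lambda>x. x $$ (k, j))) [0..<n]"], intro ballI)
      fix g x :: "'a mat" assume "g \<in> carrier_mat n n" "x \<in> carrier_mat n n"
      then show "(g * x) $$ (i, j) = (\<Sum>(a, b)\<leftarrow>map (\<lambda>k. (\<lambda>g. g $$ (i, k), \<lambda>x. x $$ (k, j))) [0..<n]. a g * b x)"
        using entry by (simp add: scalar_prod_def comp_def interv_sum_list_conv_sum_set_nat)
    qed
  next
    case (add p q)
    then obtain l1 l2 where l: "\<forall>g\<in>carrier_mat n n. \<forall>x\<in>carrier_mat n n. p (g * x) = (\<Sum>(a, b)\<leftarrow>l1. a g * b x)"
       "\<forall>g\<in>carrier_mat n n. \<forall>x\<in>carrier_mat n n. q (g * x) = (\<Sum>(a, b)\<leftarrow>l2. a g * b x)" by blast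
    show ?case by (rule exI[of _ "l1 @ l2"]) (use l in simp)
  next
    case (mult p q)
    then obtain l1 l2 where l: "\<forall>g\<in>carrier_mat n n. \<forall>x\<in>carrier_mat n n. p (g * x) = (\<Sum>(a, b)\<leftarrow>l1. a g * b x)"
       "\<forall>g\<in>carrier_mat n n. \<forall>x\<in>carrier_mat n n. q (g * x) = (\<Sum>(a, b)\<leftarrow>l2. a g * b x)" by blast
    let ?f = "\<lambda>((a, b), (a', b')). (\<lambda>g. a g * a' g, \<lambda>x. b x * b' x)"
    have one: "(\<Sum>(a, b)\<leftarrow>map (\<lambda>y. ?f ((a1, b1), y)) k2. a g * b x) = a1 g * b1 x * (\<Sum>(a, b)\<leftarrow>k2. a g * b x)"
      for k2 :: "(('a mat \<Rightarrow> 'a) \<times> ('a mat \<Rightarrow> 'a)) list" and g x and a1 b1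
      by (induction k2) (auto simp: algebra_simps)
    have *: "(\<Sum>(a, b)\<leftarrow>map ?f (List.product k1 k2). a g * b x) =
      (\<Sum>(a, b)\<leftarrow>k1. a g * b x) * (\<Sum>(a, b)\<leftarrow>k2. a g * b x)"
      for k1 k2 :: "(('a mat \<Rightarrow> 'a) \<times> ('a mat \<Rightarrow> 'a)) list" and g x
    proof (induction k1)
      case (Cons ab k1)
      obtain a1 b1 where ab: "ab = (a1, b1)" by force
      show ?case using Cons one by (simp add: ab comp_def distrib_right)
    qed simp
    show ?case
      by (rule exI[of _ "map ?f (List.product l1 l2)"]) (unfold *, use l in simp)
  qed
  then obtain l where l: "\<And>g x. g \<in> carrier_mat n n \<Longrightarrow> x \<in> carrier_mat n n \<Longrightarrow>
    q (g * x) = (\<Sum>(a, b)\<leftarrow>l. a g * b x)" by blast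
  show ?thesis by (rule exI[of _ l]) (use l q(2) in simp)
qed

section \<open>The Zariski topology and the irreducibility of connected groups\<close>

lemma polyfun_representative: "polyfun n p \<Longrightarrow> \<exists>q\<in>mat_poly_fun n. \<forall>A\<in>carrier_mat n n. p A = q A"
  by (simp add: polyfun_def)

lemma polyfun_translate:
  assumes r: "polyfun n r" and g: "g \<in> carrier_mat n n"
  shows "polyfun n (\<lambda>x. r (g * x))"
proof (rule polyfun_compose[OF r])
  show "polyfun n (\<lambda>x. (g * x) $$ (i, j))" if "i < n" "j < n" for i j
    by (rule polyfun_mult_mat[where F = "\<lambda>_. g" and H = "\<lambda>x. x"]) (use g that in auto)
qed (use g in auto)

lemma zariski_closedI:
  assumes "\<And>p. p \<in> P \<Longrightarrow> polyfun n p"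
  shows "zariski_closed n {A \<in> carrier_mat n n. \<forall>p\<in>P. p A = 0}"
proof -
  obtain r where r: "\<And>p. p \<in> P \<Longrightarrow> r p \<in> mat_poly_fun n \<and> (\<forall>A\<in>carrier_mat n n. p A = r p A)"
    using polyfun_representative[OF assms] by metis
  have "{A \<in> carrier_mat n n. \<forall>p\<in>P. p A = 0} = {A \<in> carrier_mat n n. \<forall>p\<in>r ` P. p A = 0}"
    using r by auto
  moreover have "r ` P \<subseteq> mat_poly_fun n" using r by auto
  ultimately show ?thesis unfolding zariski_closed_def by blast
qed

lemma zariski_closedE:
  assumes "zariski_closed n Z"
  obtains P where "\<And>p. p \<in> P \<Longrightarrow> polyfun n p" "Z = {A \<in> carrier_mat n n. \<forall>p\<in>P. p A = 0}"
proof -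
  obtain P where "P \<subseteq> mat_poly_fun n" "Z = {A \<in> carrier_mat n n. \<forall>p\<in>P. p A = 0}"
    using assms unfolding zariski_closed_def by blast
  then show ?thesis by (intro that[of P]) (auto intro: polyfun_mat_poly_fun)
qed

lemma zariski_closed_Un:
  fixes Z1 Z2 :: "'a::field mat set"
  assumes "zariski_closed n Z1" "zariski_closed n Z2"
  shows "zariski_closed n (Z1 \<union> Z2)"
proof -
  obtain P1 where P1: "\<And>p. p \<in> P1 \<Longrightarrow> polyfun n p" "Z1 = {A \<in> carrier_mat n n. \<forall>p\<in>P1. p A = 0}"
    using assms(1) by (elim zariski_closedE) blast
  obtain P2 where P2: "\<And>p. p \<in> P2 \<Longrightarrow> polyfun n p" "Z2 = {A \<in> carrier_mat n n. \<forall>p\<in>P2. p A = 0}"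
    using assms(2) by (elim zariski_closedE) blast
  let ?P = "(\<lambda>(p, q) A. p A * q A) ` (P1 \<times> P2)"
  have "Z1 \<union> Z2 = {A \<in> carrier_mat n n. \<forall>p\<in>?P. p A = 0}"
    unfolding P1(2) P2(2) by auto
  moreover have "zariski_closed n \<dots>"
    by (rule zariski_closedI) (use P1 P2 in auto)
  ultimately show ?thesis by simp
qed

lemma zariski_closed_empty: "zariski_closed n ({} :: 'a::field mat set)"
proof -
  have "zariski_closed n {A \<in> carrier_mat n n. \<forall>p\<in>{\<lambda>_ :: 'a mat. 1 :: 'a}. p A = 0}"
    by (rule zariski_closedI) auto
  then show ?thesis by simp
qed

lemma zariski_closed_Union:
  "finite \<Z> \<Longrightarrow> (\<And>Z. Z \<in> \<Z> \<Longrightarrow> zariski_closed n Z) \<Longrightarrow> zariski_closed n (\<Union>\<Z>)"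
  by (induction \<Z> rule: finite_induct) (auto intro: zariski_closed_Un zariski_closed_empty)

lemma adj_mat_SL:
  fixes g :: "'a::field mat"
  assumes "g \<in> SL_set n"
  shows "g * adj_mat g = 1\<^sub>m n" "adj_mat g * g = 1\<^sub>m n" "adj_mat g \<in> carrier_mat n n"
  using assms adj_mat[of g n] by (auto simp: SL_set_def)

lemma group_GL: "group (GL n :: 'a::field mat monoid)"
proof (rule groupI)
  fix x :: "'a mat" assume "x \<in> carrier (GL n)"
  then have x: "x \<in> carrier_mat n n" "det x \<noteq> 0" by (auto simp: GL_def)
  let ?y = "inverse (det x) \<cdot>\<^sub>m adj_mat x"
  have 1: "?y * x = 1\<^sub>m n"
    using adj_mat[OF x(1)] x by (auto simp: mult_smult_assoc_mat[of _ n n])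
  moreover have "?y \<in> carrier_mat n n" using adj_mat[OF x(1)] by auto
  moreover have "det ?y \<noteq> 0"
    using arg_cong[OF 1, of det] det_mult[OF \<open>?y \<in> carrier_mat n n\<close> x(1)] by auto
  ultimately show "\<exists>y\<in>carrier (GL n). y \<otimes>\<^bsub>GL n\<^esub> x = \<one>\<^bsub>GL n\<^esub>"
    by (intro bexI[of _ ?y]) (auto simp: GL_def)
qed (auto simp: GL_def det_mult)

text \<open>The left translates of \<open>p\<close> and \<open>q\<close> have a finite-dimensional
  span and are permuted by translation, so \<open>disjoint_components\<close> applies. Connectedness
  leaves a single component, and an irreducible set covered by two zero sets lies in one of
  them.\<close>

lemma connected_imp_domain:
  fixes G :: "'a::field mat set"
  assumes alg: "algebraic_subgroup n G" and con: "zariski_connected n G"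
    and p: "polyfun n p" and q: "polyfun n q" and pq: "\<And>g. g \<in> G \<Longrightarrow> p g * q g = 0"
  shows "(\<forall>g\<in>G. p g = 0) \<or> (\<forall>g\<in>G. q g = 0)"
proof -
  interpret GL: group "GL n :: 'a mat monoid" by (rule group_GL)
  have sub: "subgroup G (GL n)" and cl: "zariski_closed n G"
    using alg by (auto simp: algebraic_subgroup_def)
  have Gc: "G \<subseteq> carrier_mat n n" using subgroup.subset[OF sub] by (auto simp: GL_def)
  have one: "1\<^sub>m n \<in> G" using subgroup.one_closed[OF sub] by (simp add: GL_def)
  have mul: "g * h \<in> G" if "g \<in> G" "h \<in> G" for g h
    using subgroup.m_closed[OF sub that] by (simp add: GL_def)
  have inv: "\<exists>h\<in>G. h * g = 1\<^sub>m n \<and> g * h = 1\<^sub>m n" if "g \<in> G" for g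
  proof (intro bexI[of _ "inv\<^bsub>GL n\<^esub> g"] conjI)
    show "inv\<^bsub>GL n\<^esub> g \<in> G" by (rule subgroup.m_inv_closed[OF sub that])
    have "g \<in> carrier (GL n)" using subgroup.subset[OF sub] that by auto
    then show "inv\<^bsub>GL n\<^esub> g * g = 1\<^sub>m n" "g * inv\<^bsub>GL n\<^esub> g = 1\<^sub>m n"
      using GL.l_inv GL.r_inv by (auto simp: GL_def)
  qed
  obtain lp where lp: "\<forall>g\<in>carrier_mat n n. \<forall>x\<in>carrier_mat n n. p (g * x) = (\<Sum>(a, b)\<leftarrow>lp. a g * b x)"
    using polyfun_comult[OF p] by blast
  obtain lq where lq: "\<forall>g\<in>carrier_mat n n. \<forall>x\<in>carrier_mat n n. q (g * x) = (\<Sum>(a, b)\<leftarrow>lq. a g * b x)"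
    using polyfun_comult[OF q] by blast
  define l where "l = lp @ lq"
  \<comment> \<open>Equality is demanded on n by n matrices only, because associativity, which makes
    a translate of a translate a translate, needs the dimensions.\<close>
  define T where "T = {\<tau>. \<exists>r\<in>{p, q}. \<exists>g\<in>G. \<forall>x\<in>carrier_mat n n. \<tau> x = r (g * x)}"
  have sum_l: "(\<Sum>(a, b)\<leftarrow>k. a g * b x) = (\<Sum>i<length k. fst (k ! i) g * snd (k ! i) x)"
    for k :: "(('a mat \<Rightarrow> 'a) \<times> ('a mat \<Rightarrow> 'a)) list" and g x
    by (simp add: sum_list_sum_nth atLeast0LessThan case_prod_beta)
  interpret homogeneous_functions G T "length l" "\<lambda>k. snd (l ! k)"
  proof
    show "G \<noteq> {}" using one by blast
  next
    fix \<tau> assume "\<tau> \<in> T"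
    then obtain r g where rg: "r \<in> {p, q}" "g \<in> G"
      and \<tau>: "\<And>x. x \<in> carrier_mat n n \<Longrightarrow> \<tau> x = r (g * x)"
      unfolding T_def by blast
    have gc: "g \<in> carrier_mat n n" using rg Gc by auto
    show "\<exists>a. \<forall>x\<in>G. \<tau> x = (\<Sum>k<length l. a k * snd (l ! k) x)"
    proof (cases "r = p")
      case True
      have "\<tau> x = (\<Sum>k<length l. (if k < length lp then fst (l ! k) g else 0) * snd (l ! k) x)" if "x \<in> G" for x
      proof -
        have "\<tau> x = (\<Sum>i<length lp. fst (lp ! i) g * snd (lp ! i) x)"
          using \<tau>[of x] True bspec[OF bspec[OF lp gc], of x] Gc that unfolding sum_l by auto
        also have "\<dots> = (\<Sum>k<length l. (if k < length lp then fst (l ! k) g else 0) * snd (l ! k) x)"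
          by (rule sum.mono_neutral_cong_left) (auto simp: l_def nth_append)
        finally show ?thesis .
      qed
      then show ?thesis by (intro exI ballI)
    next
      case False
      then have rq: "r = q" using rg by auto
      have "\<tau> x = (\<Sum>k<length l. (if k < length lp then 0 else fst (l ! k) g) * snd (l ! k) x)" if "x \<in> G" for x
      proof -
        have "\<tau> x = (\<Sum>i<length lq. fst (lq ! i) g * snd (lq ! i) x)"
          using \<tau>[of x] rq bspec[OF bspec[OF lq gc], of x] Gc that unfolding sum_l by auto
        also have "\<dots> = (\<Sum>k\<in>{length lp..<length l}. fst (l ! k) g * snd (l ! k) x)"
          by (rule sum.reindex_bij_witness[of _ "\<lambda>k. k - length lp" "\<lambda>k. k + length lp"])
            (auto simp: l_def nth_append)
        also have "\<dots> = (\<Sum>k<length l. (if k < length lp then 0 else fst (l ! k) g) * snd (l ! k) x)"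
          by (rule sum.mono_neutral_cong_left) auto
        finally show ?thesis .
      qed
      then show ?thesis by (intro exI ballI)
    qed
  next
    fix x y assume xy: "x \<in> G" "y \<in> G"
    obtain x' where x': "x' \<in> G" "x' * x = 1\<^sub>m n" "x * x' = 1\<^sub>m n" using inv xy by blast
    obtain y' where y': "y' \<in> G" "y' * y = 1\<^sub>m n" "y * y' = 1\<^sub>m n" using inv xy by blast
    have c: "x \<in> carrier_mat n n" "x' \<in> carrier_mat n n" "y \<in> carrier_mat n n" "y' \<in> carrier_mat n n"
      using xy x' y' Gc by auto
    have T_tr: "(\<lambda>z. \<tau> (h * z)) \<in> T" if "\<tau> \<in> T" "h \<in> G" for \<tau> h
    proof -
      obtain r g where rg: "r \<in> {p, q}" "g \<in> G"
        and \<tau>: "\<And>x. x \<in> carrier_mat n n \<Longrightarrow> \<tau> x = r (g * x)"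
        using \<open>\<tau> \<in> T\<close> unfolding T_def by blast
      have c: "g \<in> carrier_mat n n" "h \<in> carrier_mat n n" using rg(2) \<open>h \<in> G\<close> Gc by auto
      have "\<tau> (h * z) = r (g * h * z)" if "z \<in> carrier_mat n n" for z
        using \<tau>[of "h * z"] c that by (simp add: assoc_mult_mat[of _ n n _ n _ n])
      then show ?thesis unfolding T_def using rg mul[OF rg(2) \<open>h \<in> G\<close>] by blast
    qed
    show "\<exists>\<phi> \<psi>. \<phi> x = y \<and>
      (\<forall>z\<in>G. \<phi> z \<in> G \<and> \<psi> z \<in> G \<and> \<psi> (\<phi> z) = z \<and> \<phi> (\<psi> z) = z) \<and>
      (\<forall>\<tau>\<in>T. (\<lambda>z. \<tau> (\<phi> z)) \<in> T \<and> (\<lambda>z. \<tau> (\<psi> z)) \<in> T)"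
    proof (rule exI[of _ "\<lambda>z. (y * x') * z"], rule exI[of _ "\<lambda>z. (x * y') * z"], intro conjI ballI)
      show "y * x' * x = y" using c x' by (simp add: assoc_mult_mat[of _ n n _ n _ n])
      fix z assume z: "z \<in> G"
      then have zc: "z \<in> carrier_mat n n" using Gc by auto
      show "y * x' * z \<in> G" "x * y' * z \<in> G" using mul xy x' y' z by auto
      have "x * y' * (y * x' * z) = x * (y' * y) * x' * z"
        using c zc by (simp add: assoc_mult_mat[of _ n n _ n _ n])
      then show "x * y' * (y * x' * z) = z" using c zc x' y' by simp
      have "y * x' * (x * y' * z) = y * (x' * x) * y' * z"
        using c zc by (simp add: assoc_mult_mat[of _ n n _ n _ n])
      then show "y * x' * (x * y' * z) = z" using c zc x' y' by simp
    qed (use T_tr mul xy x' y' in auto)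
  qed
  have closed_zariski: "zariski_closed n Z" if Z: "Z \<in> closeds" for Z
  proof -
    obtain S where S: "S \<subseteq> T" "Z = zeros S" using Z by (auto simp: closeds_def)
    obtain P where P: "\<And>p. p \<in> P \<Longrightarrow> polyfun n p" "G = {A \<in> carrier_mat n n. \<forall>p\<in>P. p A = 0}"
      using cl by (elim zariski_closedE) blast
    have "polyfun n \<tau>" if \<tau>: "\<tau> \<in> T" for \<tau>
    proof -
      obtain r g where rg: "r \<in> {p, q}" "g \<in> G"
        and \<tau>: "\<And>x. x \<in> carrier_mat n n \<Longrightarrow> \<tau> x = r (g * x)"
        using \<tau> unfolding T_def by blast
      have "g \<in> carrier_mat n n" using rg Gc by auto
      then have "polyfun n (\<lambda>x. r (g * x))" using rg(1) p q by (intro polyfun_translate) auto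
      then show ?thesis by (rule polyfun_cong) (use \<tau> in auto)
    qed
    then have "zariski_closed n {A \<in> carrier_mat n n. \<forall>p\<in>P \<union> S. p A = 0}"
      using P(1) S(1) by (intro zariski_closedI) auto
    also have "{A \<in> carrier_mat n n. \<forall>p\<in>P \<union> S. p A = 0} = Z"
      unfolding S(2) zeros_def unfolding P(2) by auto
    finally show ?thesis .
  qed
  obtain \<W> where W: "finite \<W>" "\<W> \<subseteq> closeds" "\<forall>W\<in>\<W>. irred W" "\<Union>\<W> = G" "disjoint \<W>"
    using disjoint_components by blast
  obtain W1 where W1: "W1 \<in> \<W>" "1\<^sub>m n \<in> W1" using W(4) one by blast
  \<comment> \<open>The remaining components have a closed union disjoint from the component
    \<open>W1\<close> of the identity, so connectedness leaves nothing for them.\<close>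
  have "G \<inter> \<Union>(\<W> - {W1}) = {}"
  proof (rule ccontr)
    assume ne: "G \<inter> \<Union>(\<W> - {W1}) \<noteq> {}"
    have "W1 \<inter> \<Union>(\<W> - {W1}) = {}"
      using W(5) W1(1) by (auto simp: pairwise_def disjnt_def)
    moreover have "G \<subseteq> W1 \<union> \<Union>(\<W> - {W1})" using W(4) by auto
    moreover have "zariski_closed n W1" "zariski_closed n (\<Union>(\<W> - {W1}))"
      using closed_zariski W(1,2) W1(1) by (auto intro!: zariski_closed_Union)
    ultimately show False
      using con ne W1(2) one unfolding zariski_connected_def by blast
  qed
  then have "W1 = G" using W(4) W1(1) by blast
  then have irr: "irred G" using W(3) W1(1) by auto
  have T1: "{\<lambda>x. r (1\<^sub>m n * x)} \<subseteq> T" if "r \<in> {p, q}" for r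
    unfolding T_def using that one by blast
  let ?Z = "\<lambda>r. zeros {\<lambda>x. r (1\<^sub>m n * x)}"
  have Z: "?Z r = {x\<in>G. r x = 0}" for r :: "'a mat \<Rightarrow> 'a"
    unfolding zeros_def using Gc by force
  have "?Z p \<in> closeds" "?Z q \<in> closeds" unfolding closeds_def using T1 by auto
  moreover have "G \<subseteq> ?Z p \<union> ?Z q" unfolding Z using pq by auto
  ultimately have "G \<subseteq> ?Z p \<or> G \<subseteq> ?Z q"
    using irr[unfolded irred_def, rule_format, of "{?Z p, ?Z q}"] by auto
  then show ?thesis unfolding Z by blast
qed

section \<open>Irreducible linear groups\<close>

text \<open>Over a finite field the product of all \<open>[:- a, 1:]\<close> vanishes everywhere, so
  adding 1 gives a polynomial without roots.\<close>

lemma alg_closed_infinite: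
  assumes "alg_closed TYPE('a::field)"
  shows "infinite (UNIV :: 'a set)"
proof
  assume fin: "finite (UNIV :: 'a set)"
  define P :: "'a poly" where "P = (\<Prod>a\<in>UNIV. [:- a, 1:])"
  have d: "degree P = card (UNIV :: 'a set)"
    unfolding P_def by (subst degree_prod_eq_sum_degree) auto
  have "card (UNIV :: 'a set) > 0" using fin by (simp add: card_gt_0_iff)
  then have "degree (P + 1) > 0" using d by (simp add: degree_add_eq_left)
  then obtain x where "poly (P + 1) x = 0" using assms unfolding alg_closed_def by blast
  moreover have "poly P x = 0" unfolding P_def poly_prod using fin by (intro prod_zero) auto
  ultimately show False by simp
qed

text \<open>The conditions are stable under a change of basis (\<open>conjugate_group\<close>), as
  is needed to make \<gamma> diagonal. Inversion is polynomial, being \<open>adj_mat\<close> in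
  determinant 1; \<open>closed\<close> recovers \<open>G\<close> from its ideal, and
  \<open>dom\<close> says that this ideal is prime.\<close>

locale irreducible_group =
  fixes n :: nat and G :: "'a::field mat set"
  assumes n2: "n \<ge> 2" and ac: "alg_closed TYPE('a)"
    and SL: "G \<subseteq> SL_set n"
    and one: "1\<^sub>m n \<in> G"
    and mul: "\<And>g h. g \<in> G \<Longrightarrow> h \<in> G \<Longrightarrow> g * h \<in> G"
    and adj: "\<And>g. g \<in> G \<Longrightarrow> adj_mat g \<in> G"
    and closed: "\<And>A. A \<in> carrier_mat n n \<Longrightarrow>
      (\<And>p. polyfun n p \<Longrightarrow> (\<And>g. g \<in> G \<Longrightarrow> p g = 0) \<Longrightarrow> p A = 0) \<Longrightarrow> A \<in> G"
    and dom: "\<And>p q. polyfun n p \<Longrightarrow> polyfun n q \<Longrightarrow> (\<And>g. g \<in> G \<Longrightarrow> p g * q g = 0) \<Longrightarrow>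
      (\<forall>g\<in>G. p g = 0) \<or> (\<forall>g\<in>G. q g = 0)"
    and irr: "\<And>W. lin_subspace n W \<Longrightarrow> (\<And>g w. g \<in> G \<Longrightarrow> w \<in> W \<Longrightarrow> g *\<^sub>v w \<in> W) \<Longrightarrow>
      W = {0\<^sub>v n} \<or> W = carrier_vec n"
begin

lemma inf: "infinite (UNIV :: 'a set)"
  by (rule alg_closed_infinite[OF ac])

lemma Gc: "g \<in> G \<Longrightarrow> g \<in> carrier_mat n n"
  using SL by (auto simp: SL_set_def)

lemma det1: "g \<in> G \<Longrightarrow> det g = 1"
  using SL by (auto simp: SL_set_def)

lemma adj_inv: "g \<in> G \<Longrightarrow> g * adj_mat g = 1\<^sub>m n" "g \<in> G \<Longrightarrow> adj_mat g * g = 1\<^sub>m n"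
    "g \<in> G \<Longrightarrow> adj_mat g \<in> carrier_mat n n"
  using adj_mat_SL[of _ n] SL by blast+

lemma mult_zero_vec: "A \<in> carrier_mat n n \<Longrightarrow> A *\<^sub>v 0\<^sub>v n = (0\<^sub>v n :: 'a vec)"
  by (rule eq_vecI) auto

lemma smult_one_mult_vec:
  assumes w: "w \<in> carrier_vec n"
  shows "(c \<cdot>\<^sub>m 1\<^sub>m n) *\<^sub>v w = c \<cdot>\<^sub>v (w :: 'a vec)"
proof (rule eq_vecI)
  fix i assume "i < dim_vec (c \<cdot>\<^sub>v w)"
  then have i: "i < n" using w by simp
  have "((c \<cdot>\<^sub>m 1\<^sub>m n) *\<^sub>v w) $ i = (\<Sum>j\<in>{0..<n}. c * (if j = i then 1 else 0) * w $ j)"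
    using i w by (auto simp: scalar_prod_def)
  also have "\<dots> = (\<Sum>j\<in>{0..<n}. if j = i then c * w $ i else 0)"
    by (rule sum.cong) auto
  finally show "((c \<cdot>\<^sub>m 1\<^sub>m n) *\<^sub>v w) $ i = (c \<cdot>\<^sub>v w) $ i" using i w by simp
qed (use w in auto)

lemma dom_prod:
  assumes "finite S" "\<And>s. s \<in> S \<Longrightarrow> polyfun n (p s)" "\<And>g. g \<in> G \<Longrightarrow> (\<Prod>s\<in>S. p s g) = 0"
  shows "\<exists>s\<in>S. \<forall>g\<in>G. p s g = 0"
  using assms
proof (induction S rule: finite_induct)
  case empty
  then show ?case using one by force
next
  case (insert s S)
  have "(\<forall>g\<in>G. p s g = 0) \<or> (\<forall>g\<in>G. (\<Prod>s\<in>S. p s g) = 0)"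
    by (rule dom) (use insert in auto)
  then show ?case using insert.IH insert.prems(1) by auto
qed

text \<open>The product of the functions \<open>p - s\<close> over all \<open>s\<close> in
  \<open>S\<close> vanishes on \<open>G\<close>, so one factor does.\<close>

lemma finite_values_const:
  assumes "polyfun n p" "finite S" "\<And>g. g \<in> G \<Longrightarrow> p g \<in> S"
  shows "\<exists>c. \<forall>g\<in>G. p g = c"
proof -
  have "\<exists>s\<in>S. \<forall>g\<in>G. p g - s = 0"
    by (rule dom_prod) (use assms in auto)
  then show ?thesis by auto
qed

text \<open>The vectors whose whole orbit has vanishing coordinate \<open>k\<close> form an
  invariant subspace; it omits \<open>unit_vec n k\<close>, so it is zero.\<close>

lemma orbit_coord_zero:
  assumes z: "z \<in> carrier_vec n" and k: "k < n" and 0: "\<And>g. g \<in> G \<Longrightarrow> (g *\<^sub>v z) $ k = 0"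
  shows "z = 0\<^sub>v n"
proof -
  define W where "W = {w \<in> carrier_vec n. \<forall>g\<in>G. (g *\<^sub>v w) $ k = 0}"
  have "W = {0\<^sub>v n} \<or> W = carrier_vec n"
  proof (rule irr)
    show "lin_subspace n W"
      unfolding lin_subspace_def W_def
      using Gc k
      by (auto simp: mult_add_distrib_mat_vec[of _ n n] mult_mat_vec[of _ n n] mult_zero_vec
          carrier_matD[OF Gc] simp del: index_mult_mat_vec)
    show "g *\<^sub>v w \<in> W" if g: "g \<in> G" and w: "w \<in> W" for g w
    proof -
      have "(h *\<^sub>v (g *\<^sub>v w)) $ k = 0" if h: "h \<in> G" for h
      proof -
        have "h *\<^sub>v (g *\<^sub>v w) = (h * g) *\<^sub>v w"
          using Gc[OF g] Gc[OF h] w by (intro assoc_mult_mat_vec[symmetric]) (auto simp: W_def)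
        then show ?thesis using mul[OF h g] w by (auto simp: W_def)
      qed
      then show ?thesis using Gc[OF g] w by (auto simp: W_def)
    qed
  qed
  moreover have "W \<noteq> carrier_vec n"
  proof
    assume "W = carrier_vec n"
    then have "unit_vec n k \<in> W" by auto
    then have "(1\<^sub>m n *\<^sub>v unit_vec n k) $ k = (0 :: 'a)" using one by (auto simp: W_def)
    then show False using k by simp
  qed
  moreover have "z \<in> W" using z 0 by (auto simp: W_def)
  ultimately show ?thesis by auto
qed

lemma entry_nonzero:
  assumes "k < n" "i < n"
  shows "\<exists>g\<in>G. g $$ (k, i) \<noteq> 0"
proof (rule ccontr)
  assume *: "\<not> ?thesis"
  have "unit_vec n i = (0\<^sub>v n :: 'a vec)"
  proof (rule orbit_coord_zero[OF _ assms(1)])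
    fix g assume g: "g \<in> G"
    have "(g *\<^sub>v unit_vec n i) $ k = g $$ (k, i)"
      using Gc[OF g] assms by (simp add: mult_mat_vec_def)
    then show "(g *\<^sub>v unit_vec n i) $ k = 0" using * g by auto
  qed auto
  then show False using assms(2) by (metis index_unit_vec(1) index_zero_vec(1) zero_neq_one)
qed

lemma eigenvalue_exists:
  assumes X: "X \<in> carrier_mat n n"
  shows "\<exists>\<mu> v. v \<in> carrier_vec n \<and> v \<noteq> 0\<^sub>v n \<and> X *\<^sub>v v = \<mu> \<cdot>\<^sub>v (v :: 'a vec)"
proof -
  have "degree (char_poly X) > 0" using degree_monic_char_poly[OF X] n2 by auto
  then obtain \<mu> where "poly (char_poly X) \<mu> = 0" using ac unfolding alg_closed_def by blast
  then have "eigenvalue X \<mu>" using eigenvalue_root_char_poly[OF X] by auto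
  then show ?thesis using X unfolding eigenvalue_def eigenvector_def by auto
qed

lemma finite_eigenvalues:
  assumes X: "(X :: 'a mat) \<in> carrier_mat n n"
  shows "finite {\<mu>. \<exists>v. v \<in> carrier_vec n \<and> v \<noteq> 0\<^sub>v n \<and> X *\<^sub>v v = \<mu> \<cdot>\<^sub>v v}"
proof (rule finite_subset)
  show "finite {\<mu>. poly (char_poly X) \<mu> = 0}"
    using degree_monic_char_poly[OF X] by (intro poly_roots_finite) auto
  show "{\<mu>. \<exists>v. v \<in> carrier_vec n \<and> v \<noteq> 0\<^sub>v n \<and> X *\<^sub>v v = \<mu> \<cdot>\<^sub>v v} \<subseteq> {\<mu>. poly (char_poly X) \<mu> = 0}"
    using eigenvalue_root_char_poly[OF X] X unfolding eigenvalue_def eigenvector_def by auto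
qed

lemma polyfun_conj:
  assumes "\<And>i j. i < n \<Longrightarrow> j < n \<Longrightarrow> polyfun n (\<lambda>x. Y x $$ (i, j))"
    "\<And>x. x \<in> carrier_mat n n \<Longrightarrow> Y x \<in> carrier_mat n n" "i < n" "j < n"
  shows "polyfun n (\<lambda>x. (x * Y x * adj_mat x) $$ (i, j))"
proof (rule polyfun_mult_mat[where F = "\<lambda>x. x * Y x" and H = adj_mat])
  show "polyfun n (\<lambda>x. (x * Y x) $$ (i, j))" if "i < n" "j < n" for i j
    by (rule polyfun_mult_mat[where F = "\<lambda>x. x" and H = Y]) (use assms that in auto)
qed (use assms adj_mat(1) in \<open>auto intro: polyfun_adj_mat\<close>)

text \<open>Conjugate matrices have the same eigenvalues, so \<open>c g\<close> is a difference of
  two eigenvalues of \<open>X\<close> and takes finitely many values; it is constant, equal to its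
  value 0 at the identity. Comparing traces would fail when the characteristic divides
  \<open>n\<close>. Then \<open>X\<close> commutes with \<open>G\<close>, and Schur's lemma
  applies.\<close>

lemma scalar_if_conj_shift:
  assumes X: "X \<in> carrier_mat n n"
    and sh: "\<And>g. g \<in> G \<Longrightarrow> \<exists>c. g * X * adj_mat g = X + c \<cdot>\<^sub>m 1\<^sub>m n"
  shows "\<exists>\<mu>. X = \<mu> \<cdot>\<^sub>m 1\<^sub>m n"
proof -
  obtain \<mu> v where v: "v \<in> carrier_vec n" "v \<noteq> 0\<^sub>v n" "X *\<^sub>v v = \<mu> \<cdot>\<^sub>v v"
    using eigenvalue_exists[OF X] by blast
  let ?E = "{\<mu>. \<exists>v. v \<in> carrier_vec n \<and> v \<noteq> 0\<^sub>v n \<and> X *\<^sub>v v = \<mu> \<cdot>\<^sub>v v}"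
  define c where "c g = (g * X * adj_mat g) $$ (0, 0) - X $$ (0, 0)" for g
  have n0: "0 < n" using n2 by simp
  have c: "g * X * adj_mat g = X + c g \<cdot>\<^sub>m 1\<^sub>m n" if g: "g \<in> G" for g
  proof -
    obtain d where d: "g * X * adj_mat g = X + d \<cdot>\<^sub>m 1\<^sub>m n" using sh[OF g] by blast
    have "c g = d" unfolding c_def d using X n0 by simp
    then show ?thesis using d by simp
  qed
  have gX: "g * X = (X + c g \<cdot>\<^sub>m 1\<^sub>m n) * g" if g: "g \<in> G" for g
  proof -
    have "g * X = g * X * (adj_mat g * g)" using adj_inv[OF g] Gc[OF g] X by simp
    also have "\<dots> = g * X * adj_mat g * g"
      using adj_inv[OF g] Gc[OF g] X by (intro assoc_mult_mat[symmetric, of _ n n _ n _ n]) auto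
    finally show ?thesis unfolding c[OF g] .
  qed
  have "\<exists>d. \<forall>g\<in>G. c g = d"
  proof (rule finite_values_const)
    show "polyfun n c" unfolding c_def
      by (intro polyfun_diff polyfun_const polyfun_conj) (use X n0 in auto)
    show "finite ((\<lambda>e. \<mu> - e) ` ?E)" using finite_eigenvalues[OF X] by auto
    show "c g \<in> (\<lambda>e. \<mu> - e) ` ?E" if g: "g \<in> G" for g
    proof -
      let ?w = "g *\<^sub>v v"
      have w: "?w \<in> carrier_vec n" using Gc[OF g] v by auto
      have "adj_mat g *\<^sub>v ?w = v"
        using adj_inv[OF g] Gc[OF g] v by (simp add: assoc_mult_mat_vec[symmetric, of _ n n _ n])
      then have w0: "?w \<noteq> 0\<^sub>v n" using v(2) mult_zero_vec[OF adj_inv(3)[OF g]] by metis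
      have "(X + c g \<cdot>\<^sub>m 1\<^sub>m n) *\<^sub>v ?w = (g * X) *\<^sub>v v"
        unfolding gX[OF g] using Gc[OF g] X v by (intro assoc_mult_mat_vec[symmetric]) auto
      also have "\<dots> = g *\<^sub>v (\<mu> \<cdot>\<^sub>v v)" using Gc[OF g] X v by (simp add: assoc_mult_mat_vec[of _ n n _ n])
      also have "\<dots> = \<mu> \<cdot>\<^sub>v ?w" using Gc[OF g] v by (simp add: mult_mat_vec)
      finally have "X *\<^sub>v ?w + c g \<cdot>\<^sub>v ?w = \<mu> \<cdot>\<^sub>v ?w"
        using X w by (simp add: add_mult_distrib_mat_vec[of _ n n] smult_one_mult_vec)
      then have "X *\<^sub>v ?w = (\<mu> - c g) \<cdot>\<^sub>v ?w"
      proof -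
        assume eq: "X *\<^sub>v ?w + c g \<cdot>\<^sub>v ?w = \<mu> \<cdot>\<^sub>v ?w"
        have "X *\<^sub>v ?w = (X *\<^sub>v ?w + c g \<cdot>\<^sub>v ?w) - c g \<cdot>\<^sub>v ?w"
          using X w Gc[OF g] by (intro eq_vecI) auto
        also have "\<dots> = (\<mu> - c g) \<cdot>\<^sub>v ?w"
          unfolding eq using w Gc[OF g] by (intro eq_vecI) (auto simp: left_diff_distrib)
        finally show ?thesis .
      qed
      then have "\<mu> - c g \<in> ?E" using w w0 by blast
      then show ?thesis by (intro image_eqI[of _ _ "\<mu> - c g"]) auto
    qed
  qed
  then obtain d where d: "\<And>g. g \<in> G \<Longrightarrow> c g = d" by blast
  have "c (1\<^sub>m n) = 0"
  proof -
    have "1\<^sub>m n = (adj_mat (1\<^sub>m n) :: 'a mat)" using adj_inv[OF one] by simp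
    then show ?thesis unfolding c_def using X by (metis diff_self left_mult_one_mat right_mult_one_mat)
  qed
  then have c0: "c g = 0" if "g \<in> G" for g using d[OF that] d[OF one] by simp
  have "X + 0 \<cdot>\<^sub>m 1\<^sub>m n = X" using X by (intro eq_matI) auto
  then have comm: "g * X = X * g" if g: "g \<in> G" for g
    unfolding gX[OF g] c0[OF g] by simp
  \<comment> \<open>An eigenspace of a matrix commuting with \<open>G\<close> is invariant.\<close>
  define W where "W = {w \<in> carrier_vec n. X *\<^sub>v w = \<mu> \<cdot>\<^sub>v w}"
  have "W = {0\<^sub>v n} \<or> W = carrier_vec n"
  proof (rule irr)
    show "lin_subspace n W"
      unfolding lin_subspace_def W_def using X
      by (auto simp: mult_add_distrib_mat_vec[of _ n n] mult_mat_vec[of _ n n] smult_add_distrib_vec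
          smult_smult_assoc mult.commute)
    show "g *\<^sub>v w \<in> W" if g: "g \<in> G" and w: "w \<in> W" for g w
    proof -
      have wc: "w \<in> carrier_vec n" using w by (simp add: W_def)
      have "X *\<^sub>v (g *\<^sub>v w) = (g * X) *\<^sub>v w"
        unfolding comm[OF g] using X Gc[OF g] wc by (intro assoc_mult_mat_vec[symmetric]) auto
      also have "\<dots> = g *\<^sub>v (\<mu> \<cdot>\<^sub>v w)" using X Gc[OF g] w by (simp add: W_def assoc_mult_mat_vec[of _ n n _ n])
      also have "\<dots> = \<mu> \<cdot>\<^sub>v (g *\<^sub>v w)" using Gc[OF g] wc by (simp add: mult_mat_vec)
      finally show ?thesis using Gc[OF g] wc by (auto simp: W_def)
    qed
  qed
  moreover have "v \<in> W" using v by (simp add: W_def)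
  ultimately have "W = carrier_vec n" using v(2) by auto
  then have Xw: "X *\<^sub>v w = \<mu> \<cdot>\<^sub>v w" if "w \<in> carrier_vec n" for w using that by (auto simp: W_def)
  have "X = \<mu> \<cdot>\<^sub>m 1\<^sub>m n"
  proof (rule eq_matI)
    fix i j assume ij: "i < dim_row (\<mu> \<cdot>\<^sub>m 1\<^sub>m n)" "j < dim_col (\<mu> \<cdot>\<^sub>m 1\<^sub>m n :: 'a mat)"
    have "(X *\<^sub>v unit_vec n j) $ i = X $$ (i, j)" using X ij by (simp add: mult_mat_vec_def)
    then show "X $$ (i, j) = (\<mu> \<cdot>\<^sub>m 1\<^sub>m n) $$ (i, j)" using Xw[of "unit_vec n j"] ij by simp
  qed (use X in auto)
  then show ?thesis ..
qed

text \<open>The hypothesis makes row \<open>k\<close> of \<open>g\<close> a left eigenvector of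
  \<open>Y\<close>; its eigenvalue \<open>c g\<close> is a constant \<open>d\<close> because the
  spectrum is finite. Every column of \<open>Y - d\<close> then has an orbit with vanishing
  coordinate \<open>k\<close>, and \<open>orbit_coord_zero\<close> kills it.\<close>

lemma scalar_if_conj_row_diagonal:
  assumes Y: "Y \<in> carrier_mat n n" and k: "k < n"
    and row: "\<And>g l. g \<in> G \<Longrightarrow> l < n \<Longrightarrow> l \<noteq> k \<Longrightarrow> (g * Y * adj_mat g) $$ (k, l) = 0"
  shows "\<exists>\<mu>. Y = \<mu> \<cdot>\<^sub>m 1\<^sub>m n"
proof -
  define c where "c g = (g * Y * adj_mat g) $$ (k, k)" for g
  let ?T = "transpose_mat Y"
  let ?E = "{\<mu>. \<exists>v. v \<in> carrier_vec n \<and> v \<noteq> 0\<^sub>v n \<and> ?T *\<^sub>v v = \<mu> \<cdot>\<^sub>v v}"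
  have gY: "(g * Y) $$ (k, l) = c g * g $$ (k, l)" if g: "g \<in> G" and l: "l < n" for g l
  proof -
    let ?Z = "g * Y * adj_mat g"
    have Z: "?Z \<in> carrier_mat n n" using Gc[OF g] Y adj_inv[OF g] by auto
    have "g * Y = g * Y * (adj_mat g * g)" using adj_inv[OF g] Gc[OF g] Y by simp
    also have "\<dots> = ?Z * g"
      using adj_inv[OF g] Gc[OF g] Y by (intro assoc_mult_mat[symmetric, of _ n n _ n _ n]) auto
    finally have "(g * Y) $$ (k, l) = (?Z * g) $$ (k, l)" by (rule arg_cong)
    also have "\<dots> = (\<Sum>i\<in>{0..<n}. ?Z $$ (k, i) * g $$ (i, l))"
      using Z Gc[OF g] k l by (auto simp: scalar_prod_def simp del: index_mult_mat(1) intro!: trans[OF index_mult_mat(1)])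
    also have "\<dots> = (\<Sum>i\<in>{0..<n}. if i = k then c g * g $$ (k, l) else 0)"
      by (rule sum.cong) (use row[OF g] in \<open>auto simp: c_def\<close>)
    finally show ?thesis using k by simp
  qed
  have "\<exists>d. \<forall>g\<in>G. c g = d"
  proof (rule finite_values_const)
    show "polyfun n c" unfolding c_def by (intro polyfun_conj) (use Y k in auto)
    show "finite ?E" using finite_eigenvalues[of ?T] Y by auto
    show "c g \<in> ?E" if g: "g \<in> G" for g
    proof -
      let ?w = "row g k"
      have w: "?w \<in> carrier_vec n" using Gc[OF g] k by auto
      have "?w \<noteq> 0\<^sub>v n"
      proof
        assume 0: "?w = 0\<^sub>v n"
        have "(g * adj_mat g) $$ (k, k) = ?w \<bullet> col (adj_mat g) k"
          using Gc[OF g] adj_inv(3)[OF g] k by auto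
        then have "1 = ?w \<bullet> col (adj_mat g) k" using adj_inv(1)[OF g] k by simp
        then show False unfolding 0 using adj_inv(3)[OF g] k by auto
      qed
      moreover have "?T *\<^sub>v ?w = c g \<cdot>\<^sub>v ?w"
      proof (rule eq_vecI)
        fix l assume "l < dim_vec (c g \<cdot>\<^sub>v ?w)"
        then have l: "l < n" using Gc[OF g] by auto
        have "(?T *\<^sub>v ?w) $ l = col Y l \<bullet> ?w" using Y l by simp
        also have "\<dots> = ?w \<bullet> col Y l" using Y w l by (intro comm_scalar_prod) auto
        also have "\<dots> = (g * Y) $$ (k, l)" using Gc[OF g] Y k l by simp
        also have "\<dots> = (c g \<cdot>\<^sub>v ?w) $ l" using gY[OF g l] Gc[OF g] k l by simp
        finally show "(?T *\<^sub>v ?w) $ l = (c g \<cdot>\<^sub>v ?w) $ l" .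
      qed (use Y Gc[OF g] in auto)
      ultimately show ?thesis using w by blast
    qed
  qed
  then obtain d where d: "\<And>g. g \<in> G \<Longrightarrow> c g = d" by blast
  have z0: "col Y l - d \<cdot>\<^sub>v unit_vec n l = 0\<^sub>v n" if l: "l < n" for l
  proof (rule orbit_coord_zero[OF _ k])
    fix g assume g: "g \<in> G"
    have "g *\<^sub>v (col Y l - d \<cdot>\<^sub>v unit_vec n l) = g *\<^sub>v col Y l - d \<cdot>\<^sub>v (g *\<^sub>v unit_vec n l)"
      using Gc[OF g] Y l by (simp add: mult_minus_distrib_mat_vec[of _ n n] mult_mat_vec[of _ n n])
    moreover have "(g *\<^sub>v col Y l) $ k = (g * Y) $$ (k, l)" using Gc[OF g] Y k l by simp
    moreover have "(g *\<^sub>v unit_vec n l) $ k = g $$ (k, l)"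
      using Gc[OF g] k l by (simp add: mult_mat_vec_def)
    ultimately show "(g *\<^sub>v (col Y l - d \<cdot>\<^sub>v unit_vec n l)) $ k = 0"
      using gY[OF g l] d[OF g] Gc[OF g] Y k l by simp
  qed (use Y l in auto)
  have "Y = d \<cdot>\<^sub>m 1\<^sub>m n"
  proof (rule eq_matI)
    fix i j assume "i < dim_row (d \<cdot>\<^sub>m 1\<^sub>m n)" "j < dim_col (d \<cdot>\<^sub>m 1\<^sub>m n :: 'a mat)"
    then have ij: "i < n" "j < n" by auto
    have "(col Y j - d \<cdot>\<^sub>v unit_vec n j) $ i = 0" using z0[OF ij(2)] ij by simp
    then show "Y $$ (i, j) = (d \<cdot>\<^sub>m 1\<^sub>m n) $$ (i, j)" using Y ij by (auto split: if_splits)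
  qed (use Y in auto)
  then show ?thesis ..
qed

end

section \<open>The tangent space at the identity\<close>

definition emat :: "nat \<Rightarrow> nat \<Rightarrow> nat \<Rightarrow> 'a::field mat" where
  "emat n i j = mat n n (\<lambda>(a, b). if a = i \<and> b = j then 1 else 0)"

lemma emat_carrier [simp]: "emat n i j \<in> carrier_mat n n"
  by (simp add: emat_def)

lemma emat_dim [simp]: "dim_row (emat n i j) = n" "dim_col (emat n i j) = n"
  by (simp_all add: emat_def)

lemma emat_index: "a < n \<Longrightarrow> b < n \<Longrightarrow> emat n i j $$ (a, b) = (if a = i \<and> b = j then 1 else 0)"
  by (simp add: emat_def)

lemma emat_mult_left:
  fixes Y :: "'a::field mat"
  assumes "Y \<in> carrier_mat n n" "a < n" "b < n" "j < n"
  shows "(emat n i j * Y) $$ (a, b) = (if a = i then Y $$ (j, b) else 0)"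
proof -
  have "(emat n i j * Y) $$ (a, b) = (\<Sum>k\<in>{0..<n}. emat n i j $$ (a, k) * Y $$ (k, b))"
    using assms by (auto simp: scalar_prod_def emat_def)
  also have "\<dots> = (\<Sum>k\<in>{0..<n}. if k = j then (if a = i then Y $$ (j, b) else 0) else 0)"
    by (rule sum.cong) (use assms in \<open>auto simp: emat_index\<close>)
  finally show ?thesis using assms by simp
qed

lemma emat_mult_right:
  fixes Y :: "'a::field mat"
  assumes "Y \<in> carrier_mat n n" "a < n" "b < n" "i < n"
  shows "(Y * emat n i j) $$ (a, b) = (if b = j then Y $$ (a, i) else 0)"
proof -
  have "(Y * emat n i j) $$ (a, b) = (\<Sum>k\<in>{0..<n}. Y $$ (a, k) * emat n i j $$ (k, b))"
    using assms by (auto simp: scalar_prod_def emat_def)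
  also have "\<dots> = (\<Sum>k\<in>{0..<n}. if k = i then (if b = j then Y $$ (a, i) else 0) else 0)"
    by (rule sum.cong) (use assms in \<open>auto simp: emat_index\<close>)
  finally show ?thesis using assms by simp
qed

lemma add_smult_index:
  "A \<in> carrier_mat n n \<Longrightarrow> B \<in> carrier_mat n n \<Longrightarrow> a < n \<Longrightarrow> b < n \<Longrightarrow>
    (A + t \<cdot>\<^sub>m B) $$ (a, b) = A $$ (a, b) + t * (B $$ (a, b) :: 'a::field)"
  by auto

lemma adj_mat_eqI:
  fixes A B :: "'a::field mat"
  assumes "A \<in> carrier_mat n n" "B \<in> carrier_mat n n" "det A = 1" "A * B = 1\<^sub>m n"
  shows "adj_mat A = B"
proof -
  have "adj_mat A = adj_mat A * (A * B)" using adj_mat[OF assms(1)] assms by simp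
  also have "\<dots> = adj_mat A * A * B"
    using adj_mat[OF assms(1)] assms by (intro assoc_mult_mat[symmetric, of _ n n _ n _ n]) auto
  also have "adj_mat A * A = 1\<^sub>m n"
    unfolding adj_mat(3)[OF assms(1)] assms(3) by (rule eq_matI) auto
  finally show ?thesis using assms by simp
qed

lemma elementary_mat:
  fixes t :: "'a::field"
  assumes "i < n" "j < n" "i \<noteq> j"
  shows "det (1\<^sub>m n + t \<cdot>\<^sub>m emat n i j) = 1"
    and "adj_mat (1\<^sub>m n + t \<cdot>\<^sub>m emat n i j) = 1\<^sub>m n + (- t) \<cdot>\<^sub>m emat n i j"
proof -
  have "1\<^sub>m n + t \<cdot>\<^sub>m emat n i j = addrow_mat n t i j"
    by (rule eq_matI) (use assms in \<open>auto simp: emat_def\<close>)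
  then show 1: "det (1\<^sub>m n + t \<cdot>\<^sub>m emat n i j) = 1"
    using det_addrow_mat[OF assms(3), of n t] assms by simp
  show "adj_mat (1\<^sub>m n + t \<cdot>\<^sub>m emat n i j) = 1\<^sub>m n + (- t) \<cdot>\<^sub>m emat n i j"
  proof (rule adj_mat_eqI[OF _ _ 1])
    show "(1\<^sub>m n + t \<cdot>\<^sub>m emat n i j) * (1\<^sub>m n + (- t) \<cdot>\<^sub>m emat n i j) = 1\<^sub>m n"
    proof (rule eq_matI)
      fix a b assume "a < dim_row (1\<^sub>m n :: 'a mat)" "b < dim_col (1\<^sub>m n :: 'a mat)"
      then have ab: "a < n" "b < n" by auto
      let ?E = "emat n i j :: 'a mat" and ?F = "1\<^sub>m n + (- t) \<cdot>\<^sub>m emat n i j :: 'a mat"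
      have F: "?F \<in> carrier_mat n n" by auto
      have "(1\<^sub>m n + t \<cdot>\<^sub>m ?E) * ?F = 1\<^sub>m n * ?F + (t \<cdot>\<^sub>m ?E) * ?F"
        by (rule add_mult_distrib_mat[OF _ _ F]) auto
      also have "(t \<cdot>\<^sub>m ?E) * ?F = t \<cdot>\<^sub>m (?E * ?F)" by (rule mult_smult_assoc_mat[OF emat_carrier F])
      finally have "((1\<^sub>m n + t \<cdot>\<^sub>m ?E) * ?F) $$ (a, b) = ?F $$ (a, b) + t * (?E * ?F) $$ (a, b)"
        using add_smult_index[OF F mult_carrier_mat[OF emat_carrier F] ab]
        by (simp add: left_mult_one_mat[OF F] del: index_mult_mat(1) index_add_mat)
      also have "\<dots> = 1\<^sub>m n $$ (a, b)"
        unfolding emat_mult_left[OF F ab assms(2)] using ab assms by (auto simp: emat_index)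
      finally show "((1\<^sub>m n + t \<cdot>\<^sub>m ?E) * ?F) $$ (a, b) = 1\<^sub>m n $$ (a, b)" .
    qed auto
  qed auto
qed

lemma dirderiv_add_scaled:
  fixes p q :: "'a::field mat \<Rightarrow> 'a"
  assumes inf: "infinite (UNIV :: 'a set)" and "polyfun n p" "polyfun n q"
    and A: "A \<in> carrier_mat n n" and X: "X \<in> carrier_mat n n"
  shows "dirderiv (\<lambda>x. p x + c * q x) A X = dirderiv p A X + c * dirderiv q A X"
proof -
  obtain P where P: "\<And>t. poly P t = p (A + t \<cdot>\<^sub>m X)" using polyfun_line[OF assms(2) A X] by blast
  obtain Q where Q: "\<And>t. poly Q t = q (A + t \<cdot>\<^sub>m X)" using polyfun_line[OF assms(3) A X] by blast
  have "dirderiv (\<lambda>x. p x + c * q x) A X = coeff (P + Polynomial.smult c Q) 1"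
    by (rule dirderiv_eqI[OF inf]) (simp add: P Q)
  then show ?thesis
    using dirderiv_eqI[OF inf, of P p, OF P] dirderiv_eqI[OF inf, of Q q, OF Q] by simp
qed

text \<open>Duality in finite dimension: a subspace \<open>Q\<close> of functions on
  \<open>S\<close> contains everything that its annihilator kills. A member \<open>r\<close> of
  \<open>Q\<close> with \<open>r s\<close> nonzero serves as a pivot for eliminating the coordinate
  \<open>s\<close>.\<close>

lemma double_annihilator:
  fixes Q :: "('s \<Rightarrow> 'a::field) set"
  assumes "finite S"
    and "Q \<noteq> {}" and "\<And>q r c. q \<in> Q \<Longrightarrow> r \<in> Q \<Longrightarrow> (\<lambda>s. q s + c * r s) \<in> Q"
    and "\<And>z. (\<And>q. q \<in> Q \<Longrightarrow> (\<Sum>s\<in>S. q s * z s) = 0) \<Longrightarrow> (\<Sum>s\<in>S. y s * z s) = 0"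
  shows "\<exists>q\<in>Q. \<forall>s\<in>S. q s = y s"
  using assms
proof (induction S arbitrary: Q y rule: finite_induct)
  case empty
  then show ?case by auto
next
  case (insert s S)
  note lin = insert.prems(2)
  have ne: "\<And>z. (\<Sum>t\<in>insert s S. z t) = z s + (\<Sum>t\<in>S. z t)" for z :: "'s \<Rightarrow> 'a"
    using insert.hyps by simp
  show ?case
  proof (cases "\<forall>q\<in>Q. q s = 0")
    case True
    have "(\<Sum>t\<in>insert s S. y t * (if t = s then 1 else 0)) = 0"
    proof (rule insert.prems(3))
      fix q assume "q \<in> Q"
      then show "(\<Sum>t\<in>insert s S. q t * (if t = s then 1 else 0)) = 0"
        unfolding ne using True insert.hyps by (simp add: sum.neutral)
    qed
    moreover have "(\<Sum>t\<in>S. y t * (if t = s then 1 else 0)) = 0"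
      using insert.hyps by (intro sum.neutral) auto
    ultimately have ys: "y s = 0" unfolding ne by simp
    have "\<exists>q\<in>Q. \<forall>s\<in>S. q s = y s"
    proof (rule insert.IH)
      fix z assume z: "\<And>q. q \<in> Q \<Longrightarrow> (\<Sum>t\<in>S. q t * z t) = 0"
      have "(\<Sum>t\<in>insert s S. y t * z t) = 0"
        by (rule insert.prems(3)) (unfold ne, use z True in auto)
      then show "(\<Sum>t\<in>S. y t * z t) = 0" unfolding ne ys by simp
    qed (use insert.prems in auto)
    then show ?thesis using True ys by auto
  next
    case False
    then obtain r where r: "r \<in> Q" "r s \<noteq> 0" by blast
    let ?Q = "{q \<in> Q. q s = 0}"
    \<comment> \<open>The multiple of the pivot is chosen so that \<open>y' s = 0\<close>.\<close>
    define y' where "y' t = y t - y s / r s * r t" for t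
    have "(\<lambda>t. r t + (-1) * r t) \<in> Q" by (rule lin) (use r in auto)
    then have zero: "(\<lambda>t. 0) \<in> Q" by simp
    have "\<exists>q\<in>?Q. \<forall>s\<in>S. q s = y' s"
    proof (rule insert.IH)
      show "?Q \<noteq> {}" using zero by auto
      show "(\<lambda>s. q s + c * r s) \<in> ?Q" if "q \<in> ?Q" "r \<in> ?Q" for q r c
        using that lin by auto
      fix z assume z: "\<And>q. q \<in> ?Q \<Longrightarrow> (\<Sum>t\<in>S. q t * z t) = 0"
      \<comment> \<open>The value at \<open>s\<close> makes \<open>z'\<close> orthogonal to the
        pivot; then all of \<open>Q\<close> annihilates \<open>z'\<close>.\<close>
      define z' where "z' = z(s := - (\<Sum>t\<in>S. r t * z t) / r s)"
      have S': "(\<Sum>t\<in>S. f t * z' t) = (\<Sum>t\<in>S. f t * z t)" for f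
        by (rule sum.cong) (use insert.hyps in \<open>auto simp: z'_def\<close>)
      have z's: "z' s = - (\<Sum>t\<in>S. r t * z t) / r s" by (simp add: z'_def)
      have red: "(\<Sum>t\<in>S. q t * z t) = q s / r s * (\<Sum>t\<in>S. r t * z t)" if q: "q \<in> Q" for q
      proof -
        have "(\<lambda>t. q t + (- q s / r s) * r t) \<in> ?Q" using lin[OF q r(1), of "- q s / r s"] r(2) by simp
        then have "0 = (\<Sum>t\<in>S. (q t + (- q s / r s) * r t) * z t)" by (rule z[symmetric])
        also have "(\<Sum>t\<in>S. (q t + (- q s / r s) * r t) * z t) =
            (\<Sum>t\<in>S. q t * z t) + (- q s / r s) * (\<Sum>t\<in>S. r t * z t)"
          unfolding distrib_right sum.distrib sum_distrib_left mult.assoc ..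
        finally show ?thesis by simp
      qed
      have "(\<Sum>t\<in>insert s S. y t * z' t) = 0"
      proof (rule insert.prems(3))
        fix q assume q: "q \<in> Q"
        show "(\<Sum>t\<in>insert s S. q t * z' t) = 0"
          unfolding ne S' red[OF q] z's by simp
      qed
      then have "(\<Sum>t\<in>S. y t * z t) = y s / r s * (\<Sum>t\<in>S. r t * z t)"
        unfolding ne S' z's by (simp add: field_simps)
      then show "(\<Sum>t\<in>S. y' t * z t) = 0"
        by (simp add: y'_def left_diff_distrib sum_subtractf sum_distrib_left mult.assoc)
    qed
    then obtain q where q: "q \<in> Q" "q s = 0" "\<forall>t\<in>S. q t = y' t" by blast
    show ?thesis
    proof (rule bexI)
      show "\<forall>t\<in>insert s S. (\<lambda>t. q t + y s / r s * r t) t = y t"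
        using q r by (auto simp: y'_def)
      show "(\<lambda>t. q t + y s / r s * r t) \<in> Q" by (rule lin[OF q(1) r(1)])
    qed
  qed
qed

lemma conj_line:
  fixes g g' X :: "'a::field mat"
  assumes g: "g \<in> carrier_mat n n" "g' \<in> carrier_mat n n" "g * g' = 1\<^sub>m n"
    and X: "X \<in> carrier_mat n n"
  shows "g * (1\<^sub>m n + t \<cdot>\<^sub>m X) * g' = 1\<^sub>m n + t \<cdot>\<^sub>m (g * X * g')"
proof -
  have "g * (1\<^sub>m n + t \<cdot>\<^sub>m X) = g * 1\<^sub>m n + g * (t \<cdot>\<^sub>m X)"
    using g X by (intro mult_add_distrib_mat) auto
  also have "\<dots> = g + t \<cdot>\<^sub>m (g * X)" using g X by (simp add: mult_smult_distrib)
  finally have "g * (1\<^sub>m n + t \<cdot>\<^sub>m X) * g' = (g + t \<cdot>\<^sub>m (g * X)) * g'" by simp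
  also have "\<dots> = g * g' + t \<cdot>\<^sub>m (g * X) * g'" using g X by (intro add_mult_distrib_mat) auto
  also have "t \<cdot>\<^sub>m (g * X) * g' = t \<cdot>\<^sub>m (g * X * g')" using g X by (intro mult_smult_assoc_mat) auto
  finally show ?thesis using g by simp
qed

section \<open>Tangent vectors under translation, conjugation and brackets\<close>

context irreducible_group
begin

definition vanishing :: "('a mat \<Rightarrow> 'a) \<Rightarrow> bool" where
  "vanishing p \<longleftrightarrow> polyfun n p \<and> (\<forall>g\<in>G. p g = 0)"

text \<open>The Zariski tangent space of \<open>G\<close> at the identity.\<close>

definition lie :: "'a mat set" where
  "lie = {X \<in> carrier_mat n n. \<forall>p. vanishing p \<longrightarrow> dirderiv p (1\<^sub>m n) X = 0}"

lemma lie_carrier: "X \<in> lie \<Longrightarrow> X \<in> carrier_mat n n"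
  by (simp add: lie_def)

lemma lie_add_scaled:
  assumes "X \<in> lie" "Y \<in> lie"
  shows "X + c \<cdot>\<^sub>m Y \<in> lie"
  unfolding lie_def
proof (intro CollectI conjI allI impI)
  show "X + c \<cdot>\<^sub>m Y \<in> carrier_mat n n" using assms by (auto simp: lie_def)
  fix p assume p: "vanishing p"
  obtain g where g: "\<forall>X\<in>carrier_mat n n. dirderiv p (1\<^sub>m n) X = (\<Sum>ij\<in>{..<n}\<times>{..<n}. g ij * X $$ ij)"
    using dirderiv_linear[OF inf, of n p "1\<^sub>m n"] p by (auto simp: vanishing_def)
  have c: "X \<in> carrier_mat n n" "Y \<in> carrier_mat n n" "X + c \<cdot>\<^sub>m Y \<in> carrier_mat n n"
    using assms by (auto simp: lie_def)
  have "dirderiv p (1\<^sub>m n) (X + c \<cdot>\<^sub>m Y) = (\<Sum>ij\<in>{..<n}\<times>{..<n}. g ij * X $$ ij + c * (g ij * Y $$ ij))"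
    unfolding bspec[OF g c(3)] by (rule sum.cong) (use c in \<open>auto simp: algebra_simps\<close>)
  also have "\<dots> = dirderiv p (1\<^sub>m n) X + c * dirderiv p (1\<^sub>m n) Y"
    unfolding bspec[OF g c(1)] bspec[OF g c(2)] by (simp add: sum.distrib sum_distrib_left)
  finally show "dirderiv p (1\<^sub>m n) (X + c \<cdot>\<^sub>m Y) = 0"
    using assms p by (simp add: lie_def)
qed

text \<open>Left translation by \<open>g\<close> maps \<open>G\<close> to itself and the identity to
  \<open>g\<close>, hence tangent vectors at the identity to tangent vectors at
  \<open>g\<close>.\<close>

lemma lie_tangent:
  assumes X: "X \<in> lie" and p: "vanishing p" and g: "g \<in> G"
  shows "dirderiv p g (g * X) = 0"
proof -
  have c: "g \<in> carrier_mat n n" "X \<in> carrier_mat n n" "g * X \<in> carrier_mat n n"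
    using Gc[OF g] lie_carrier[OF X] by auto
  obtain P where P: "\<And>t. poly P t = p (g + t \<cdot>\<^sub>m (g * X))"
    using polyfun_line[of n p g "g * X"] p c by (auto simp: vanishing_def)
  have "g * (1\<^sub>m n + t \<cdot>\<^sub>m X) = g + t \<cdot>\<^sub>m (g * X)" for t
    using c by (subst mult_add_distrib_mat[of _ n n _ n]) (auto simp: mult_smult_distrib)
  then have "dirderiv (\<lambda>x. p (g * x)) (1\<^sub>m n) X = coeff P 1"
    by (intro dirderiv_eqI[OF inf]) (simp add: P)
  moreover have "dirderiv p g (g * X) = coeff P 1" by (rule dirderiv_eqI[OF inf P])
  moreover have "vanishing (\<lambda>x. p (g * x))"
    using p mul[OF g] polyfun_translate[OF _ c(1)] by (auto simp: vanishing_def)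
  ultimately show ?thesis using X by (simp add: lie_def)
qed

text \<open>Conjugation by \<open>g\<close> is linear, preserves \<open>G\<close> and fixes the
  identity, so its derivative there is conjugation itself.\<close>

lemma lie_conj:
  assumes X: "X \<in> lie" and g: "g \<in> G"
  shows "g * X * adj_mat g \<in> lie"
  unfolding lie_def
proof (intro CollectI conjI allI impI)
  note c = Gc[OF g] adj_inv[OF g] lie_carrier[OF X]
  show Y: "g * X * adj_mat g \<in> carrier_mat n n" using c by auto
  fix p assume p: "vanishing p"
  obtain P where P: "\<And>t. poly P t = p (1\<^sub>m n + t \<cdot>\<^sub>m (g * X * adj_mat g))"
    using polyfun_line[of n p "1\<^sub>m n" "g * X * adj_mat g"] p Y by (auto simp: vanishing_def)
  have "dirderiv (\<lambda>x. p (g * x * adj_mat g)) (1\<^sub>m n) X = coeff P 1"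
    by (rule dirderiv_eqI[OF inf]) (simp only: P conj_line[OF c(1,4,2,5)])
  moreover have "dirderiv p (1\<^sub>m n) (g * X * adj_mat g) = coeff P 1" by (rule dirderiv_eqI[OF inf P])
  moreover have "vanishing (\<lambda>x. p (g * x * adj_mat g))"
    unfolding vanishing_def
  proof (intro conjI ballI)
    show "polyfun n (\<lambda>x. p (g * x * adj_mat g))"
    proof (rule polyfun_compose)
      show "polyfun n (\<lambda>x. (g * x * adj_mat g) $$ (i, j))" if "i < n" "j < n" for i j
        by (rule polyfun_mult_mat[where F = "\<lambda>x. g * x" and H = "\<lambda>_. adj_mat g"],
            use c in simp, use c in simp, rule polyfun_mult_mat[where F = "\<lambda>_. g" and H = "\<lambda>x. x"])
          (use c that in auto)
    qed (use p c in \<open>auto simp: vanishing_def\<close>)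
    show "p (g * x * adj_mat g) = 0" if "x \<in> G" for x
      using p mul[OF mul[OF g that] adj[OF g]] by (simp add: vanishing_def)
  qed
  ultimately show "dirderiv p (1\<^sub>m n) (g * X * adj_mat g) = 0" using X by (simp add: lie_def)
qed

text \<open>The differential of a vanishing function, applied to the conjugates
  \<open>x Y x^-1\<close>, gives a function \<open>?F\<close> vanishing on \<open>G\<close>; its
  derivative at the identity along \<open>?E\<close> is that differential at the bracket. For an
  elementary matrix the inverse of \<open>1 + t ?E\<close> is exactly \<open>1 - t ?E\<close>, which
  makes the computation explicit.\<close>

lemma lie_bracket:
  assumes E: "emat n i j \<in> lie" and ij: "i < n" "j < n" "i \<noteq> j" and Y: "Y \<in> lie"
  shows "emat n i j * Y - Y * emat n i j \<in> lie"
  unfolding lie_def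
proof (intro CollectI conjI allI impI)
  let ?I = "{..<n}\<times>{..<n}" and ?E = "emat n i j :: 'a mat"
  have c: "Y \<in> carrier_mat n n" "?E \<in> carrier_mat n n" using lie_carrier[OF Y] by auto
  show B: "?E * Y - Y * ?E \<in> carrier_mat n n" using c by (intro minus_carrier_mat mult_carrier_mat)
  fix p assume p: "vanishing p"
  obtain g where g: "\<forall>X\<in>carrier_mat n n. dirderiv p (1\<^sub>m n) X = (\<Sum>ij\<in>?I. g ij * X $$ ij)"
    using dirderiv_linear[OF inf, of n p "1\<^sub>m n"] p by (auto simp: vanishing_def)
  let ?F = "\<lambda>x. \<Sum>ij\<in>?I. g ij * (x * Y * adj_mat x) $$ ij"
  have "vanishing ?F"
    unfolding vanishing_def
  proof (intro conjI ballI)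
    show "polyfun n ?F"
    proof (intro polyfun_sum polyfun_mult polyfun_const)
      fix ij assume ij: "ij \<in> ?I"
      obtain a b where ab: "ij = (a, b)" by force
      show "polyfun n (\<lambda>x. (x * Y * adj_mat x) $$ ij)"
        unfolding ab by (rule polyfun_conj) (use c ij ab in auto)
    qed
    fix x assume x: "x \<in> G"
    have "x * Y * adj_mat x \<in> carrier_mat n n" using c Gc[OF x] adj_inv[OF x] by auto
    then have "?F x = dirderiv p (1\<^sub>m n) (x * Y * adj_mat x)" using g by simp
    then show "?F x = 0" using lie_conj[OF Y x] p by (simp add: lie_def)
  qed
  then have F0: "dirderiv ?F (1\<^sub>m n) ?E = 0" using E by (simp add: lie_def)
  \<comment> \<open>The coefficients of \<open>(1 + t ?E) Y (1 - t ?E)\<close> as a polynomial in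
    \<open>t\<close>. The matrices \<open>1 + t ?E\<close> themselves need not lie in
    \<open>G\<close>.\<close>
  let ?P = "\<Sum>ij\<in>?I. Polynomial.smult (g ij) [:Y $$ ij, (?E * Y - Y * ?E) $$ ij, - (?E * Y * ?E) $$ ij:]"
  have "dirderiv ?F (1\<^sub>m n) ?E = coeff ?P 1"
  proof (rule dirderiv_eqI[OF inf])
    fix t
    let ?A = "1\<^sub>m n + t \<cdot>\<^sub>m ?E"
    have "?A * Y = 1\<^sub>m n * Y + (t \<cdot>\<^sub>m ?E) * Y" using c by (intro add_mult_distrib_mat) auto
    also have "\<dots> = Y + t \<cdot>\<^sub>m (?E * Y)" using c by (simp add: mult_smult_assoc_mat[of _ n n])
    finally have AY: "?A * Y = Y + t \<cdot>\<^sub>m (?E * Y)" .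
    have adjA: "adj_mat ?A = 1\<^sub>m n + (- t) \<cdot>\<^sub>m ?E" by (rule elementary_mat(2)[OF ij])
    let ?Z = "Y + t \<cdot>\<^sub>m (?E * Y)"
    have Z: "?Z \<in> carrier_mat n n"
      using c by (intro add_carrier_mat smult_carrier_mat mult_carrier_mat)
    have "?Z * (1\<^sub>m n + (- t) \<cdot>\<^sub>m ?E) = ?Z * 1\<^sub>m n + ?Z * ((- t) \<cdot>\<^sub>m ?E)"
      using Z by (intro mult_add_distrib_mat) auto
    also have "\<dots> = ?Z + (- t) \<cdot>\<^sub>m (?Z * ?E)" by (simp only: right_mult_one_mat[OF Z] mult_smult_distrib[OF Z emat_carrier])
    also have "?Z * ?E = Y * ?E + (t \<cdot>\<^sub>m (?E * Y)) * ?E" using c by (intro add_mult_distrib_mat) auto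
    also have "(t \<cdot>\<^sub>m (?E * Y)) * ?E = t \<cdot>\<^sub>m (?E * Y * ?E)" using c by (intro mult_smult_assoc_mat) auto
    finally have eq: "?A * Y * adj_mat ?A = ?Z + (- t) \<cdot>\<^sub>m (Y * ?E + t \<cdot>\<^sub>m (?E * Y * ?E))"
      unfolding AY adjA .
    show "poly ?P t = ?F ?A"
      unfolding poly_sum eq
    proof (rule sum.cong[OF refl])
      fix s assume s: "s \<in> ?I"
      obtain a b where ab: "s = (a, b)" "a < n" "b < n" using s by auto
      have "c1 \<in> carrier_mat n n \<Longrightarrow> c2 \<in> carrier_mat n n \<Longrightarrow> c3 \<in> carrier_mat n n \<Longrightarrow>
        (Y + t \<cdot>\<^sub>m c1 + (- t) \<cdot>\<^sub>m (c2 + t \<cdot>\<^sub>m c3)) $$ (a, b) =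
        Y $$ (a, b) + t * ((c1 - c2) $$ (a, b) + t * (- c3 $$ (a, b)))" for c1 c2 c3
        using c ab by (simp add: algebra_simps)
      note key = this[of "?E * Y" "Y * ?E" "?E * Y * ?E", OF mult_carrier_mat[OF c(2,1)]
          mult_carrier_mat[OF c] mult_carrier_mat[OF mult_carrier_mat[OF c(2,1)] c(2)]]
      show "poly (Polynomial.smult (g s) [:Y $$ s, (?E * Y - Y * ?E) $$ s, - (?E * Y * ?E) $$ s:]) t =
         g s * (?Z + (- t) \<cdot>\<^sub>m (Y * ?E + t \<cdot>\<^sub>m (?E * Y * ?E))) $$ s"
        unfolding ab(1) key by (simp only: poly_smult poly_pCons poly_0 mult_zero_right add_0_right)
    qed
  qed
  also have "\<dots> = (\<Sum>ij\<in>?I. g ij * (?E * Y - Y * ?E) $$ ij)" by (simp add: coeff_sum)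
  also have "\<dots> = dirderiv p (1\<^sub>m n) (?E * Y - Y * ?E)" using g B by simp
  finally show "dirderiv p (1\<^sub>m n) (?E * Y - Y * ?E) = 0" using F0 by simp
qed

end

section \<open>The tangent space is not scalar\<close>

context irreducible_group
begin

text \<open>Gaussian elimination over the local ring at the identity: a system whose matrix is the
  identity modulo the maximal ideal can be solved after multiplying by a unit.\<close>

lemma local_elimination:
  assumes "finite S" and w: "polyfun n w"
    and "\<And>s. s \<in> S \<Longrightarrow> polyfun n (e s) \<and> e s (1\<^sub>m n) \<noteq> 0 \<and> polyfun n (d s)"
    and "\<And>s t. s \<in> S \<Longrightarrow> t \<in> S \<Longrightarrow> polyfun n (b s t) \<and> b s t (1\<^sub>m n) = 0"
    and "\<And>x s. x \<in> G \<Longrightarrow> s \<in> S \<Longrightarrow> e s x * c s x = (\<Sum>t\<in>S. b s t x * c t x) + w x * d s x"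
  shows "\<exists>h D. polyfun n h \<and> h (1\<^sub>m n) \<noteq> 0 \<and> (\<forall>s\<in>S. polyfun n (D s)) \<and>
    (\<forall>x\<in>G. \<forall>s\<in>S. h x * c s x = w x * D s x)"
  using assms(1,3-)
proof (induction S arbitrary: e d b rule: finite_induct)
  case empty
  show ?case by (rule exI[of _ "\<lambda>_. 1"]) auto
next
  case (insert s S)
  note ed = insert.prems(1) and bb = insert.prems(2) and eq = insert.prems(3)
  \<comment> \<open>The pivot is a unit at the identity, since \<open>b s s\<close> vanishes
    there.\<close>
  define f where "f x = e s x - b s s x" for x
  have f: "polyfun n f" "f (1\<^sub>m n) \<noteq> 0" unfolding f_def using ed[of s] bb[of s s] by auto
  have sum_ins: "(\<Sum>t\<in>insert s S. g t) = g s + (\<Sum>t\<in>S. g t)" for g :: "_ \<Rightarrow> 'a"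
    using insert.hyps by simp
  have fs: "f x * c s x = (\<Sum>t\<in>S. b s t x * c t x) + w x * d s x" if "x \<in> G" for x
    using eq[OF that, of s] unfolding sum_ins f_def by (simp add: algebra_simps)
  define e' where "e' t x = f x * e t x" for t x
  define b' where "b' t r x = f x * b t r x + b t s x * b s r x" for t r x
  define d' where "d' t x = b t s x * d s x + f x * d t x" for t x
  have "\<exists>h D. polyfun n h \<and> h (1\<^sub>m n) \<noteq> 0 \<and> (\<forall>s\<in>S. polyfun n (D s)) \<and>
    (\<forall>x\<in>G. \<forall>s\<in>S. h x * c s x = w x * D s x)"
  proof (rule insert.IH[of e' d' b'])
    show "polyfun n (e' t) \<and> e' t (1\<^sub>m n) \<noteq> 0 \<and> polyfun n (d' t)" if "t \<in> S" for t
      unfolding e'_def d'_def using that ed[of t] ed[of s] bb[of t s] f by auto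
    show "polyfun n (b' t r) \<and> b' t r (1\<^sub>m n) = 0" if "t \<in> S" "r \<in> S" for t r
      unfolding b'_def using that bb[of t r] bb[of t s] bb[of s r] f by auto
    fix x t assume x: "x \<in> G" and t: "t \<in> S"
    have "e' t x * c t x = f x * (e t x * c t x)" by (simp add: e'_def)
    also have "\<dots> = f x * (b t s x * c s x + (\<Sum>r\<in>S. b t r x * c r x) + w x * d t x)"
      using eq[OF x, of t] t unfolding sum_ins by simp
    also have "\<dots> = b t s x * (f x * c s x) + f x * (\<Sum>r\<in>S. b t r x * c r x) + w x * (f x * d t x)"
      by (simp add: algebra_simps)
    also have "\<dots> = (\<Sum>r\<in>S. b' t r x * c r x) + w x * d' t x"
      unfolding fs[OF x] b'_def d'_def by (simp add: sum_distrib_left sum.distrib algebra_simps)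
    finally show "e' t x * c t x = (\<Sum>r\<in>S. b' t r x * c r x) + w x * d' t x" .
  qed
  then obtain h D where h: "polyfun n h" "h (1\<^sub>m n) \<noteq> 0" "\<forall>s\<in>S. polyfun n (D s)"
    "\<And>x s. x \<in> G \<Longrightarrow> s \<in> S \<Longrightarrow> h x * c s x = w x * D s x" by blast
  define D' where "D' t x = (if t = s then (\<Sum>r\<in>S. b s r x * D r x) + h x * d s x else f x * D t x)" for t x
  show ?case
  proof (intro exI[of _ "\<lambda>x. h x * f x"] exI[of _ D'] conjI ballI)
    show "polyfun n (\<lambda>x. h x * f x)" "h (1\<^sub>m n) * f (1\<^sub>m n) \<noteq> 0" using h f by auto
    show "polyfun n (D' t)" if "t \<in> insert s S" for t
    proof (cases "t = s")
      case True
      have "polyfun n (\<lambda>x. (\<Sum>r\<in>S. b s r x * D r x) + h x * d s x)"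
        using bb[of s] h ed[of s] by (intro polyfun_add polyfun_mult polyfun_sum) auto
      then show ?thesis unfolding D'_def True by simp
    next
      case False
      then show ?thesis unfolding D'_def using that f h by auto
    qed
    fix x t assume x: "x \<in> G" and t: "t \<in> insert s S"
    show "h x * f x * c t x = w x * D' t x"
    proof (cases "t = s")
      case True
      have "h x * f x * c t x = h x * (f x * c s x)" using True by simp
      also have "\<dots> = (\<Sum>r\<in>S. b s r x * (h x * c r x)) + w x * (h x * d s x)"
        unfolding fs[OF x] by (simp add: algebra_simps sum_distrib_left)
      also have "(\<Sum>r\<in>S. b s r x * (h x * c r x)) = (\<Sum>r\<in>S. b s r x * (w x * D r x))"
        by (rule sum.cong) (use h(4)[OF x] in auto)
      finally show ?thesis using True by (simp add: D'_def algebra_simps sum_distrib_left)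
    next
      case False
      then have "h x * c t x = w x * D t x" using h(4)[OF x] t by auto
      then show ?thesis using False by (simp add: D'_def algebra_simps)
    qed
  qed
qed

definition ix :: "(nat \<times> nat) set" where "ix = {..<n}\<times>{..<n}"

definition dg :: "nat \<times> nat \<Rightarrow> 'a" where "dg s = (if fst s = snd s then 1 else 0)"

text \<open>The \<open>C s\<close> vanish together exactly on the scalar matrices; with \<open>u\<close> they generate the maximal
  ideal at the identity.\<close>

definition C :: "nat \<times> nat \<Rightarrow> 'a mat \<Rightarrow> 'a" where "C s x = x $$ s - dg s * x $$ (0, 0)"

definition u :: "'a mat \<Rightarrow> 'a" where "u x = x $$ (0, 0) - 1"

definition near_scalar :: "nat \<Rightarrow> bool" where
  "near_scalar k \<longleftrightarrow> (\<exists>h X. polyfun n h \<and> h (1\<^sub>m n) \<noteq> 0 \<and> (\<forall>s\<in>ix. polyfun n (X s)) \<and>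
    (\<forall>x\<in>G. \<forall>s\<in>ix. h x * C s x = u x ^ k * X s x))"

lemma n_pos: "0 < n" using n2 by simp

lemma zero_ix: "(0, 0) \<in> ix" using n2 by (auto simp: ix_def)

lemma one_ix: "s \<in> ix \<Longrightarrow> 1\<^sub>m n $$ s = dg s"
  by (auto simp: ix_def dg_def)

lemma polyfun_ix: "s \<in> ix \<Longrightarrow> polyfun n (\<lambda>x. x $$ s)"
  by (auto simp: ix_def)

lemma polyfun_C: "s \<in> ix \<Longrightarrow> polyfun n (C s)"
  unfolding C_def by (intro polyfun_diff polyfun_mult polyfun_const polyfun_ix zero_ix)

lemma polyfun_u: "polyfun n u"
  unfolding u_def by (intro polyfun_diff polyfun_const polyfun_ix zero_ix)

lemma coord_eq: "s \<in> ix \<Longrightarrow> x $$ s - 1\<^sub>m n $$ s = C s x + dg s * u x"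
  by (simp add: one_ix C_def u_def algebra_simps)

lemma u_one: "u (1\<^sub>m n) = 0" using n2 by (simp add: u_def)

lemma C_one: "s \<in> ix \<Longrightarrow> C s (1\<^sub>m n) = 0"
  using n2 one_ix zero_ix by (simp add: C_def dg_def)

lemma finite_ix: "finite ix" by (simp add: ix_def)

lemma near_scalar_2:
  assumes sc: "\<And>X. X \<in> lie \<Longrightarrow> \<exists>\<mu>. X = \<mu> \<cdot>\<^sub>m 1\<^sub>m n"
  shows "near_scalar 2"
proof -
  define Q where "Q = {g. \<exists>p. vanishing p \<and>
    (\<forall>X\<in>carrier_mat n n. dirderiv p (1\<^sub>m n) X = (\<Sum>t\<in>ix. g t * X $$ t))}"
  have linear: "\<exists>g\<in>Q. \<forall>X\<in>carrier_mat n n. dirderiv p (1\<^sub>m n) X = (\<Sum>t\<in>ix. g t * X $$ t)"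
    if "vanishing p" for p
    using dirderiv_linear[OF inf, of n p "1\<^sub>m n"] that unfolding vanishing_def Q_def ix_def
    by fastforce
  have C_lin: "(\<Sum>t\<in>ix. ((if t = s then 1 else 0) - dg s * (if t = (0, 0) then 1 else 0)) * z t)
      = z s - dg s * z (0, 0)" if s: "s \<in> ix" for s z
  proof -
    have "(\<Sum>t\<in>ix. ((if t = s then 1 else 0) - dg s * (if t = (0, 0) then 1 else 0)) * z t)
      = (\<Sum>t\<in>ix. (if t = s then z t else 0) - (if t = (0, 0) then dg s * z t else 0))"
      by (rule sum.cong) (auto simp: left_diff_distrib)
    also have "\<dots> = z s - dg s * z (0, 0)"
      unfolding sum_subtractf using s zero_ix finite_ix by (simp add: sum.delta)
    finally show ?thesis .
  qed
  have "\<exists>q\<in>Q. \<forall>t\<in>ix. q t = (if t = s then 1 else 0) - dg s * (if t = (0, 0) then 1 else 0)"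
    if s: "s \<in> ix" for s
  proof (rule double_annihilator[OF finite_ix])
    have "vanishing (\<lambda>_. 0)" by (simp add: vanishing_def)
    then show "Q \<noteq> {}" using linear by blast
    fix q r c assume "q \<in> Q" "r \<in> Q"
    then obtain p p' where p: "vanishing p" "vanishing p'"
      and d: "\<And>X. X \<in> carrier_mat n n \<Longrightarrow> dirderiv p (1\<^sub>m n) X = (\<Sum>t\<in>ix. q t * X $$ t)"
        "\<And>X. X \<in> carrier_mat n n \<Longrightarrow> dirderiv p' (1\<^sub>m n) X = (\<Sum>t\<in>ix. r t * X $$ t)"
      unfolding Q_def by blast
    have "vanishing (\<lambda>x. p x + c * p' x)" using p by (auto simp: vanishing_def intro!: polyfun_add polyfun_mult polyfun_const)
    moreover have "dirderiv (\<lambda>x. p x + c * p' x) (1\<^sub>m n) X = (\<Sum>t\<in>ix. (q t + c * r t) * X $$ t)"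
      if X: "X \<in> carrier_mat n n" for X
      using dirderiv_add_scaled[OF inf, of n p p' "1\<^sub>m n" X c] p X d[OF X]
      by (simp add: vanishing_def distrib_right sum.distrib sum_distrib_left mult.assoc)
    ultimately show "(\<lambda>s. q s + c * r s) \<in> Q" unfolding Q_def by blast
  next
    fix z assume z: "\<And>q. q \<in> Q \<Longrightarrow> (\<Sum>t\<in>ix. q t * z t) = 0"
    define Z where "Z = mat n n z"
    have Zc: "Z \<in> carrier_mat n n" by (simp add: Z_def)
    have Zt: "Z $$ t = z t" if "t \<in> ix" for t using that by (auto simp: Z_def ix_def)
    have "Z \<in> lie"
      unfolding lie_def
    proof (intro CollectI conjI allI impI Zc)
      fix p assume "vanishing p"
      then obtain g where g: "g \<in> Q" "dirderiv p (1\<^sub>m n) Z = (\<Sum>t\<in>ix. g t * Z $$ t)"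
        using linear Zc by blast
      have "(\<Sum>t\<in>ix. g t * Z $$ t) = (\<Sum>t\<in>ix. g t * z t)" by (rule sum.cong) (auto simp: Zt)
      then show "dirderiv p (1\<^sub>m n) Z = 0" using g z by simp
    qed
    then obtain \<mu> where \<mu>: "Z = \<mu> \<cdot>\<^sub>m 1\<^sub>m n" using sc by blast
    have zt: "z t = \<mu> * dg t" if "t \<in> ix" for t
      using Zt[OF that] that unfolding \<mu> by (auto simp: ix_def dg_def)
    show "(\<Sum>t\<in>ix. ((if t = s then 1 else 0) - dg s * (if t = (0, 0) then 1 else 0)) * z t) = 0"
      unfolding C_lin[OF s] zt[OF s] zt[OF zero_ix] by (simp add: dg_def)
  qed
  then have "\<forall>s. \<exists>q. s \<in> ix \<longrightarrow> vanishing q \<and> (\<forall>X\<in>carrier_mat n n. dirderiv q (1\<^sub>m n) X =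
      (\<Sum>t\<in>ix. ((if t = s then 1 else 0) - dg s * (if t = (0, 0) then 1 else 0)) * X $$ t))"
    unfolding Q_def by fastforce
  from choice[OF this] obtain q where q: "\<And>s. s \<in> ix \<Longrightarrow> vanishing (q s)"
    and dq: "\<And>s X. s \<in> ix \<Longrightarrow> X \<in> carrier_mat n n \<Longrightarrow> dirderiv (q s) (1\<^sub>m n) X =
      (\<Sum>t\<in>ix. ((if t = s then 1 else 0) - dg s * (if t = (0, 0) then 1 else 0)) * X $$ t)"
    by auto
  have "\<exists>r. (\<forall>a\<in>ix. \<forall>b\<in>ix. polyfun n (r a b)) \<and> (\<forall>x\<in>G. 0 = C s x +
      (\<Sum>a\<in>ix. \<Sum>b\<in>ix. (C a x + dg a * u x) * (C b x + dg b * u x) * r a b x))" if s: "s \<in> ix" for s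
  proof -
    have "\<exists>r. (\<forall>a\<in>ix. \<forall>b\<in>ix. polyfun n (r a b)) \<and> (\<forall>x\<in>carrier_mat n n. q s x = q s (1\<^sub>m n) +
      (\<Sum>a\<in>ix. ((if a = s then 1 else 0) - dg s * (if a = (0, 0) then 1 else 0)) * (x $$ a - 1\<^sub>m n $$ a)) +
      (\<Sum>a\<in>ix. \<Sum>b\<in>ix. (x $$ a - 1\<^sub>m n $$ a) * (x $$ b - 1\<^sub>m n $$ b) * r a b x))"
      unfolding ix_def
    proof (rule polyfun_taylor2[OF inf _ one_carrier_mat])
      show "polyfun n (q s)" using q[OF s] by (simp add: vanishing_def)
    qed (rule dq[OF s, unfolded ix_def])
    then obtain r where r: "\<forall>a\<in>ix. \<forall>b\<in>ix. polyfun n (r a b)"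
      and eq: "\<forall>x\<in>carrier_mat n n. q s x = q s (1\<^sub>m n) +
      (\<Sum>a\<in>ix. ((if a = s then 1 else 0) - dg s * (if a = (0, 0) then 1 else 0)) * (x $$ a - 1\<^sub>m n $$ a)) +
      (\<Sum>a\<in>ix. \<Sum>b\<in>ix. (x $$ a - 1\<^sub>m n $$ a) * (x $$ b - 1\<^sub>m n $$ b) * r a b x)" by blast
    have "0 = C s x + (\<Sum>a\<in>ix. \<Sum>b\<in>ix. (C a x + dg a * u x) * (C b x + dg b * u x) * r a b x)"
      if x: "x \<in> G" for x
    proof -
      have "0 = (\<Sum>a\<in>ix. ((if a = s then 1 else 0) - dg s * (if a = (0, 0) then 1 else 0)) * (x $$ a - 1\<^sub>m n $$ a)) +
        (\<Sum>a\<in>ix. \<Sum>b\<in>ix. (x $$ a - 1\<^sub>m n $$ a) * (x $$ b - 1\<^sub>m n $$ b) * r a b x)"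
        using bspec[OF eq Gc[OF x]] q[OF s] x one unfolding vanishing_def by simp
      also have "(\<Sum>a\<in>ix. ((if a = s then 1 else 0) - dg s * (if a = (0, 0) then 1 else 0)) * (x $$ a - 1\<^sub>m n $$ a)) = C s x"
        unfolding C_lin[OF s] coord_eq[OF s] coord_eq[OF zero_ix] by (simp add: C_def dg_def)
      also have "(\<Sum>a\<in>ix. \<Sum>b\<in>ix. (x $$ a - 1\<^sub>m n $$ a) * (x $$ b - 1\<^sub>m n $$ b) * r a b x) =
        (\<Sum>a\<in>ix. \<Sum>b\<in>ix. (C a x + dg a * u x) * (C b x + dg b * u x) * r a b x)"
        by (intro sum.cong refl) (simp only: coord_eq)
      finally show ?thesis .
    qed
    then show ?thesis using r by (intro exI[of _ r] conjI ballI) auto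
  qed
  then have "\<forall>s. \<exists>r. s \<in> ix \<longrightarrow> (\<forall>a\<in>ix. \<forall>b\<in>ix. polyfun n (r a b)) \<and> (\<forall>x\<in>G. 0 = C s x +
      (\<Sum>a\<in>ix. \<Sum>b\<in>ix. (C a x + dg a * u x) * (C b x + dg b * u x) * r a b x))" by blast
  from choice[OF this] obtain r where r: "\<And>s a b. s \<in> ix \<Longrightarrow> a \<in> ix \<Longrightarrow> b \<in> ix \<Longrightarrow> polyfun n (r s a b)"
    and req: "\<And>s x. s \<in> ix \<Longrightarrow> x \<in> G \<Longrightarrow> 0 = C s x +
      (\<Sum>a\<in>ix. \<Sum>b\<in>ix. (C a x + dg a * u x) * (C b x + dg b * u x) * r s a b x)" by blast
  define e where "e s a x = - (\<Sum>b\<in>ix. (C b x + dg b * u x) * r s a b x + dg b * u x * r s b a x)" for s a x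
  define d where "d s x = - (\<Sum>a\<in>ix. \<Sum>b\<in>ix. dg a * dg b * r s a b x)" for s x
  have "\<exists>h D. polyfun n h \<and> h (1\<^sub>m n) \<noteq> 0 \<and> (\<forall>s\<in>ix. polyfun n (D s)) \<and>
    (\<forall>x\<in>G. \<forall>s\<in>ix. h x * C s x = u x ^ 2 * D s x)"
  proof (rule local_elimination[OF finite_ix, where e = "\<lambda>_ _. 1" and b = e and d = d])
    show "polyfun n (\<lambda>x. u x ^ 2)" by (intro polyfun_power polyfun_u)
    show "polyfun n (\<lambda>_. 1) \<and> (1::'a) \<noteq> 0 \<and> polyfun n (d s)" if "s \<in> ix" for s
      unfolding d_def using that by (intro conjI polyfun_uminus polyfun_sum polyfun_mult polyfun_const r) auto
    show "polyfun n (e s t) \<and> e s t (1\<^sub>m n) = 0" if "s \<in> ix" "t \<in> ix" for s t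
      unfolding e_def using that
      by (intro conjI polyfun_uminus polyfun_sum polyfun_add polyfun_mult polyfun_const r polyfun_C polyfun_u) (auto simp: C_one u_one)
    fix x s assume x: "x \<in> G" and s: "s \<in> ix"
    have "(\<Sum>a\<in>ix. \<Sum>b\<in>ix. (C a x + dg a * u x) * (C b x + dg b * u x) * r s a b x)
      = (\<Sum>a\<in>ix. \<Sum>b\<in>ix. C a x * (C b x + dg b * u x) * r s a b x)
      + (\<Sum>a\<in>ix. \<Sum>b\<in>ix. dg a * u x * r s a b x * C b x)
      + (\<Sum>a\<in>ix. \<Sum>b\<in>ix. u x ^ 2 * (dg a * dg b * r s a b x))"
      by (simp only: sum.distrib[symmetric]) (simp add: algebra_simps power2_eq_square)
    also have "(\<Sum>a\<in>ix. \<Sum>b\<in>ix. dg a * u x * r s a b x * C b x) = (\<Sum>a\<in>ix. \<Sum>b\<in>ix. dg b * u x * r s b a x * C a x)"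
      by (rule sum.swap)
    finally have split: "(\<Sum>a\<in>ix. \<Sum>b\<in>ix. (C a x + dg a * u x) * (C b x + dg b * u x) * r s a b x)
      = (\<Sum>a\<in>ix. \<Sum>b\<in>ix. C a x * (C b x + dg b * u x) * r s a b x)
      + (\<Sum>a\<in>ix. \<Sum>b\<in>ix. dg b * u x * r s b a x * C a x)
      + (\<Sum>a\<in>ix. \<Sum>b\<in>ix. u x ^ 2 * (dg a * dg b * r s a b x))" .
    have e1: "e s a x * C a x = - (\<Sum>b\<in>ix. C a x * (C b x + dg b * u x) * r s a b x)
      - (\<Sum>b\<in>ix. dg b * u x * r s b a x * C a x)" for a
      unfolding e_def
      by (simp only: sum_negf[symmetric] sum_distrib_right sum_subtractf[symmetric])
        (rule sum.cong[OF refl], simp add: algebra_simps)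
    have d1: "u x ^ 2 * d s x = - (\<Sum>a\<in>ix. \<Sum>b\<in>ix. u x ^ 2 * (dg a * dg b * r s a b x))"
      unfolding d_def by (simp add: sum_distrib_left)
    have "C s x = - (\<Sum>a\<in>ix. \<Sum>b\<in>ix. (C a x + dg a * u x) * (C b x + dg b * u x) * r s a b x)"
      unfolding eq_neg_iff_add_eq_0 by (rule req[OF s x, symmetric])
    also have "\<dots> = (\<Sum>t\<in>ix. e s t x * C t x) + u x ^ 2 * d s x"
      unfolding split e1 d1 by (simp add: sum_subtractf sum_negf)
    finally show "1 * C s x = (\<Sum>t\<in>ix. e s t x * C t x) + u x ^ 2 * d s x" by simp
  qed
  then show ?thesis unfolding near_scalar_def .
qed

lemma polyfun_poly: "polyfun n p \<Longrightarrow> polyfun n (\<lambda>x. poly V (p x))"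
  by (induction V) (auto intro!: polyfun_add polyfun_mult)

definition modulo :: "('a mat \<Rightarrow> 'a) \<Rightarrow> ('a mat \<Rightarrow> 'a) \<Rightarrow> ('a mat \<Rightarrow> 'a) \<Rightarrow> bool" where
  "modulo w f g \<longleftrightarrow> (\<exists>W. polyfun n W \<and> (\<forall>x\<in>carrier_mat n n. f x = g x + w x * W x))"

lemma modulo_refl: "modulo w f f"
  unfolding modulo_def by (rule exI[of _ "\<lambda>_. 0"]) auto

lemma modulo_add:
  assumes "modulo w f g" "modulo w f' g'"
  shows "modulo w (\<lambda>x. f x + f' x) (\<lambda>x. g x + g' x)"
proof -
  obtain W W' where "polyfun n W" "\<forall>x\<in>carrier_mat n n. f x = g x + w x * W x"
    "polyfun n W'" "\<forall>x\<in>carrier_mat n n. f' x = g' x + w x * W' x"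
    using assms unfolding modulo_def by blast
  then show ?thesis
    unfolding modulo_def by (intro exI[of _ "\<lambda>x. W x + W' x"]) (auto simp: algebra_simps)
qed

lemma modulo_mult:
  assumes "modulo w f g" "modulo w f' g'" "polyfun n g" "polyfun n f'"
  shows "modulo w (\<lambda>x. f x * f' x) (\<lambda>x. g x * g' x)"
proof -
  obtain W W' where "polyfun n W" "\<forall>x\<in>carrier_mat n n. f x = g x + w x * W x"
    "polyfun n W'" "\<forall>x\<in>carrier_mat n n. f' x = g' x + w x * W' x"
    using assms unfolding modulo_def by blast
  then show ?thesis
    unfolding modulo_def using assms(3,4)
    by (intro exI[of _ "\<lambda>x. W x * f' x + g x * W' x"]) (auto simp: algebra_simps)
qed

lemma modulo_sum:
  "(\<And>i. i \<in> S \<Longrightarrow> modulo w (f i) (g i)) \<Longrightarrow> modulo w (\<lambda>x. \<Sum>i\<in>S. f i x) (\<lambda>x. \<Sum>i\<in>S. g i x)"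
  by (induction S rule: infinite_finite_induct) (auto intro: modulo_refl modulo_add)

lemma modulo_prod:
  "(\<And>i. i \<in> S \<Longrightarrow> modulo w (f i) (g i)) \<Longrightarrow> (\<And>i. i \<in> S \<Longrightarrow> polyfun n (f i)) \<Longrightarrow>
    (\<And>i. i \<in> S \<Longrightarrow> polyfun n (g i)) \<Longrightarrow> modulo w (\<lambda>x. \<Prod>i\<in>S. f i x) (\<lambda>x. \<Prod>i\<in>S. g i x)"
proof (induction S rule: infinite_finite_induct)
  case (insert s S)
  have "modulo w (\<lambda>x. f s x * (\<Prod>i\<in>S. f i x)) (\<lambda>x. g s x * (\<Prod>i\<in>S. g i x))"
    using insert by (intro modulo_mult polyfun_prod) auto
  then show ?case using insert by simp
qed (auto intro: modulo_refl)

lemma modulo_det: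
  assumes M: "\<And>A. A \<in> carrier_mat n n \<Longrightarrow> M A \<in> carrier_mat m m"
    and N: "\<And>A. A \<in> carrier_mat n n \<Longrightarrow> N A \<in> carrier_mat m m"
    and pM: "\<And>i j. i < m \<Longrightarrow> j < m \<Longrightarrow> polyfun n (\<lambda>A. M A $$ (i, j))"
    and pN: "\<And>i j. i < m \<Longrightarrow> j < m \<Longrightarrow> polyfun n (\<lambda>A. N A $$ (i, j))"
    and mod: "\<And>i j. i < m \<Longrightarrow> j < m \<Longrightarrow> modulo w (\<lambda>A. M A $$ (i, j)) (\<lambda>A. N A $$ (i, j))"
  shows "modulo w (\<lambda>A. det (M A)) (\<lambda>A. det (N A))"
proof -
  have "modulo w (\<lambda>A. \<Sum>p \<in> {p. p permutes {0..<m}}. signof p * (\<Prod>i = 0..<m. M A $$ (i, p i)))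
    (\<lambda>A. \<Sum>p \<in> {p. p permutes {0..<m}}. signof p * (\<Prod>i = 0..<m. N A $$ (i, p i)))"
  proof (intro modulo_sum)
    fix p assume p: "p \<in> {p. p permutes {0..<m}}"
    have pi: "p i < m" if "i \<in> {0..<m}" for i using p that by (auto simp: permutes_in_image)
    show "modulo w (\<lambda>A. signof p * (\<Prod>i = 0..<m. M A $$ (i, p i))) (\<lambda>A. signof p * (\<Prod>i = 0..<m. N A $$ (i, p i)))"
      by (intro modulo_mult modulo_refl modulo_prod polyfun_prod polyfun_const) (use pi mod pM pN in auto)
  qed
  then show ?thesis
    unfolding modulo_def using det_def'[OF M] det_def'[OF N] by simp
qed

lemma dom_power:
  assumes "polyfun n p" "polyfun n q" "\<And>g. g \<in> G \<Longrightarrow> p g ^ k * q g = 0" "\<exists>g\<in>G. p g \<noteq> 0" "g \<in> G"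
  shows "q g = 0"
proof -
  have "(\<forall>g\<in>G. p g ^ k = 0) \<or> (\<forall>g\<in>G. q g = 0)"
    by (rule dom) (use assms in auto)
  then show ?thesis using assms(4,5) by auto
qed

lemma u_nonzero:
  assumes "near_scalar 2"
  shows "\<exists>g\<in>G. u g \<noteq> 0"
proof (rule ccontr)
  assume "\<not> ?thesis"
  then have u0: "u g = 0" if "g \<in> G" for g using that by blast
  obtain h X where h: "polyfun n h" "h (1\<^sub>m n) \<noteq> 0"
    "\<And>x s. x \<in> G \<Longrightarrow> s \<in> ix \<Longrightarrow> h x * C s x = u x ^ 2 * X s x"
    using assms unfolding near_scalar_def by blast
  have s: "(0, 1) \<in> ix" using n2 by (auto simp: ix_def)
  have C0: "C (0, 1) g = 0" if "g \<in> G" for g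
    by (rule dom_power[OF h(1) polyfun_C[OF s], of 1]) (use h(2,3) s u0 one that in auto)
  obtain g where "g \<in> G" "g $$ (0, 1) \<noteq> 0" using entry_nonzero[of 0 1] n2 by auto
  then show False using C0[of g] by (simp add: C_def dg_def)
qed

text \<open>The determinant bounds the order: \<open>x \<equiv> x\<^sub>0\<^sub>0 1\<close> modulo \<open>u\<^sup>k\<close> gives \<open>(1 + u)\<^sup>n \<equiv> 1\<close> modulo \<open>u\<^sup>k\<close>, and the
  polynomial \<open>(1 + T)\<^sup>n - 1\<close> vanishes at \<open>0\<close> to order at most \<open>n\<close>.\<close>

lemma near_scalar_bound:
  assumes near2: "near_scalar 2" and near: "near_scalar (Suc n)"
  shows False
proof -
  obtain h X where h: "polyfun n h" "h (1\<^sub>m n) \<noteq> 0" and X: "\<And>s. s \<in> ix \<Longrightarrow> polyfun n (X s)"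
    and eq: "\<And>x s. x \<in> G \<Longrightarrow> s \<in> ix \<Longrightarrow> h x * C s x = u x ^ Suc n * X s x"
    using near unfolding near_scalar_def by blast
  define N where "N x = mat n n (\<lambda>s. dg s * (h x * x $$ (0, 0)))" for x
  define M where "M x = mat n n (\<lambda>s. dg s * (h x * x $$ (0, 0)) + u x ^ Suc n * X s x)" for x
  have p1: "polyfun n (\<lambda>x. dg s * (h x * x $$ (0, 0)))" for s
    by (intro polyfun_mult polyfun_const h polyfun_ix zero_ix)
  have p2: "polyfun n (\<lambda>x. u x ^ Suc n * X s x)" if "s \<in> ix" for s
    by (intro polyfun_mult polyfun_power polyfun_u X that)
  have "modulo (\<lambda>x. u x ^ Suc n) (\<lambda>x. det (M x)) (\<lambda>x. det (N x))"
  proof (rule modulo_det)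
    fix i j assume ij: "i < n" "j < n"
    then have s: "(i, j) \<in> ix" by (simp add: ix_def)
    have NM: "(\<lambda>x. N x $$ (i, j)) = (\<lambda>x. dg (i, j) * (h x * x $$ (0, 0)))"
      "(\<lambda>x. M x $$ (i, j)) = (\<lambda>x. dg (i, j) * (h x * x $$ (0, 0)) + u x ^ Suc n * X (i, j) x)"
      using ij by (auto simp: N_def M_def)
    show "polyfun n (\<lambda>x. N x $$ (i, j))" unfolding NM by (rule p1)
    show "polyfun n (\<lambda>x. M x $$ (i, j))" unfolding NM by (rule polyfun_add[OF p1 p2[OF s]])
    show "modulo (\<lambda>x. u x ^ Suc n) (\<lambda>x. M x $$ (i, j)) (\<lambda>x. N x $$ (i, j))"
      unfolding NM modulo_def using X[OF s] by (intro exI[of _ "X (i, j)"]) auto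
  qed (auto simp: N_def M_def)
  then obtain W where W: "polyfun n W"
    and detM: "\<And>x. x \<in> carrier_mat n n \<Longrightarrow> det (M x) = det (N x) + u x ^ Suc n * W x"
    unfolding modulo_def by blast
  have "N x = (h x * x $$ (0, 0)) \<cdot>\<^sub>m 1\<^sub>m n" for x
    by (rule eq_matI) (auto simp: N_def dg_def)
  then have detN: "det (N x) = (h x * x $$ (0, 0)) ^ n" for x by simp
  have detMx: "det (M x) = h x ^ n" if x: "x \<in> G" for x
  proof -
    have "M x = h x \<cdot>\<^sub>m x"
    proof (rule eq_matI)
      fix i j assume "i < dim_row (h x \<cdot>\<^sub>m x)" "j < dim_col (h x \<cdot>\<^sub>m x)"
      then have ij: "i < n" "j < n" using Gc[OF x] by auto
      then have s: "(i, j) \<in> ix" by (simp add: ix_def)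
      show "M x $$ (i, j) = (h x \<cdot>\<^sub>m x) $$ (i, j)"
        using ij Gc[OF x] eq[OF x s] by (simp add: M_def C_def algebra_simps)
    qed (use Gc[OF x] in \<open>auto simp: M_def\<close>)
    then show ?thesis using det1[OF x] Gc[OF x] by simp
  qed
  define V :: "'a poly" where "V = [:1, 1:] ^ n - 1"
  have degV: "degree V = n" "V \<noteq> 0"
  proof -
    have d: "degree ([:1, 1:] ^ n :: 'a poly) = n" by (simp add: degree_power_eq)
    then show "degree V = n" unfolding V_def diff_conv_add_uminus using n2
      by (subst degree_add_eq_left) auto
    then show "V \<noteq> 0" using n2 by auto
  qed
  define e where "e = Polynomial.order 0 V"
  obtain V' where V': "V = [:- 0, 1:] ^ e * V'" "\<not> [:- 0, 1:] dvd V'"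
    using order_decomp[OF degV(2), of 0] unfolding e_def by blast
  have V'0: "poly V' 0 \<noteq> 0" using V'(2) by (simp add: poly_eq_0_iff_dvd)
  have e: "e \<le> n" using order_degree[OF degV(2), of 0] degV(1) unfolding e_def by simp
  define F where "F x = h x ^ n * poly V' (u x) + u x ^ (Suc n - e) * W x" for x
  have "F (1\<^sub>m n) = 0"
  proof (rule dom_power[OF polyfun_u, of _ e])
    show "polyfun n F" unfolding F_def by (intro polyfun_add polyfun_mult polyfun_power polyfun_poly polyfun_u h W)
    fix x assume x: "x \<in> G"
    have "h x ^ n = h x ^ n * (1 + u x) ^ n + u x ^ Suc n * W x"
      using detM[OF Gc[OF x]] detMx[OF x] detN[of x] by (simp add: u_def power_mult_distrib)
    then have "h x ^ n * (1 + u x) ^ n = h x ^ n - u x ^ Suc n * W x" by (simp only: eq_diff_eq)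
    moreover have "poly V (u x) = (1 + u x) ^ n - 1" by (simp add: V_def)
    ultimately have "h x ^ n * poly V (u x) + u x ^ Suc n * W x = 0"
      by (simp only: right_diff_distrib) simp
    moreover have "poly V (u x) = u x ^ e * poly V' (u x)" unfolding V'(1) by simp
    moreover have "u x ^ Suc n = u x ^ e * u x ^ (Suc n - e)" using e by (simp add: power_add[symmetric] del: power_Suc)
    moreover have "u x ^ e * F x = h x ^ n * (u x ^ e * poly V' (u x)) + u x ^ e * u x ^ (Suc n - e) * W x"
      unfolding F_def by (simp add: algebra_simps)
    ultimately show "u x ^ e * F x = 0" by (simp only:)
  qed (use u_nonzero[OF near2] one in auto)
  moreover have "Suc n - e > 0" using e by simp
  ultimately show False using V'0 h(2) by (simp add: F_def u_one power_0_left)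
qed

end

context irreducible_group
begin

lemma commutator_expansion:
  fixes g x M :: "'a mat"
  assumes g: "g \<in> G" and x: "x \<in> G" and M: "M \<in> carrier_mat n n"
    and hx: "h \<cdot>\<^sub>m x = a \<cdot>\<^sub>m 1\<^sub>m n + w \<cdot>\<^sub>m M" and s: "s \<in> ix"
  shows "h * ((g * x * adj_mat g * adj_mat x) $$ s - dg s) =
    w * ((g * M * adj_mat g - M) * adj_mat x) $$ s"
proof -
  let ?g = "adj_mat g" and ?x = "adj_mat x"
  note cg = Gc[OF g] adj_inv[OF g] and cx = Gc[OF x] adj_inv[OF x]
  have A: "w \<cdot>\<^sub>m M = h \<cdot>\<^sub>m x + (- a) \<cdot>\<^sub>m 1\<^sub>m n"
    unfolding hx using M by (intro eq_matI) auto
  have "w \<cdot>\<^sub>m (g * M * ?g) = g * (w \<cdot>\<^sub>m M) * ?g"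
    using cg M by (simp add: mult_smult_distrib[of _ n n] mult_smult_assoc_mat[of _ n n])
  also have "g * (w \<cdot>\<^sub>m M) = h \<cdot>\<^sub>m (g * x) + (- a) \<cdot>\<^sub>m g"
    unfolding A using cg cx by (simp add: mult_add_distrib_mat[of _ n n _ n] mult_smult_distrib[of _ n n]
        mult_smult_distrib[of g n n "1\<^sub>m n" n])
  also have "\<dots> * ?g = h \<cdot>\<^sub>m (g * x * ?g) + (- a) \<cdot>\<^sub>m 1\<^sub>m n"
    using cg cx by (simp add: add_mult_distrib_mat[of _ n n _ _ n] mult_smult_assoc_mat[of _ n n])
  finally have B: "w \<cdot>\<^sub>m (g * M * ?g) = h \<cdot>\<^sub>m (g * x * ?g) + (- a) \<cdot>\<^sub>m 1\<^sub>m n" .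
  have gMg: "g * M * ?g \<in> carrier_mat n n" "g * x * ?g \<in> carrier_mat n n"
    using cg cx M by auto
  have dist: "c \<cdot>\<^sub>m (P - Q) = c \<cdot>\<^sub>m P - c \<cdot>\<^sub>m Q" and canc: "P + R - (Q + R) = P - Q"
    if "P \<in> carrier_mat n n" "Q \<in> carrier_mat n n" "R \<in> carrier_mat n n" for c and P Q R :: "'a mat"
    using that by (auto intro!: eq_matI simp: algebra_simps)
  have "w \<cdot>\<^sub>m (g * M * ?g - M) = w \<cdot>\<^sub>m (g * M * ?g) - w \<cdot>\<^sub>m M"
    by (rule dist[OF gMg(1) M M])
  also have "\<dots> = h \<cdot>\<^sub>m (g * x * ?g) - h \<cdot>\<^sub>m x"
    unfolding B unfolding A using gMg(2) cx(1) by (intro canc) auto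
  finally have D: "w \<cdot>\<^sub>m (g * M * ?g - M) = h \<cdot>\<^sub>m (g * x * ?g) - h \<cdot>\<^sub>m x" .
  have "w \<cdot>\<^sub>m ((g * M * ?g - M) * ?x) = (w \<cdot>\<^sub>m (g * M * ?g - M)) * ?x"
    using gMg M cx by (intro mult_smult_assoc_mat[symmetric]) auto
  also have "\<dots> = h \<cdot>\<^sub>m (g * x * ?g) * ?x - h \<cdot>\<^sub>m x * ?x"
    unfolding D using gMg cx by (intro minus_mult_distrib_mat) auto
  also have "h \<cdot>\<^sub>m (g * x * ?g) * ?x = h \<cdot>\<^sub>m (g * x * ?g * ?x)"
    using gMg cx by (intro mult_smult_assoc_mat) auto
  also have "h \<cdot>\<^sub>m x * ?x = h \<cdot>\<^sub>m 1\<^sub>m n"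
    using cx by (simp add: mult_smult_assoc_mat[of _ n n])
  finally have E: "w \<cdot>\<^sub>m ((g * M * ?g - M) * ?x) = h \<cdot>\<^sub>m (g * x * ?g * ?x) - h \<cdot>\<^sub>m 1\<^sub>m n" .
  have c: "(g * M * ?g - M) * ?x \<in> carrier_mat n n" "g * x * ?g * ?x \<in> carrier_mat n n"
    using gMg M cx by auto
  obtain i j where ij: "s = (i, j)" "i < n" "j < n" using s by (auto simp: ix_def)
  have idx: "(w \<cdot>\<^sub>m P) $$ s = w * P $$ s" "(h \<cdot>\<^sub>m P - h \<cdot>\<^sub>m 1\<^sub>m n) $$ s = h * (P $$ s - dg s)"
    if "P \<in> carrier_mat n n" for P :: "'a mat"
    using that ij by (auto simp: dg_def algebra_simps)
  show ?thesis using idx(1)[OF c(1)] idx(2)[OF c(2)] unfolding E by simp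
qed

text \<open>If \<open>x\<close> is scalar modulo \<open>u\<^sup>k\<close>, then a commutator \<open>g x g\<inverse> x\<inverse>\<close> is the identity modulo \<open>u\<^sup>k\<close>, so by the
  quadratic case it is scalar modulo \<open>u\<^sup>2\<^sup>k\<close>. Hence conjugation by \<open>g\<close> moves the leading coefficient
  of \<open>x\<close> by a scalar, and Schur's lemma makes that coefficient vanish.\<close>

lemma near_scalar_Suc:
  assumes near2: "near_scalar 2" and near: "near_scalar k" and k: "k \<ge> 1"
  shows "near_scalar (Suc k)"
proof -
  obtain h2 X2 where h2: "polyfun n h2" "h2 (1\<^sub>m n) \<noteq> 0" and X2: "\<And>s. s \<in> ix \<Longrightarrow> polyfun n (X2 s)"
    and eq2: "\<And>x s. x \<in> G \<Longrightarrow> s \<in> ix \<Longrightarrow> h2 x * C s x = u x ^ 2 * X2 s x"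
    using near2 unfolding near_scalar_def by blast
  obtain h X where h: "polyfun n h" "h (1\<^sub>m n) \<noteq> 0" and X: "\<And>s. s \<in> ix \<Longrightarrow> polyfun n (X s)"
    and eq: "\<And>x s. x \<in> G \<Longrightarrow> s \<in> ix \<Longrightarrow> h x * C s x = u x ^ k * X s x"
    using near unfolding near_scalar_def by blast
  note une = u_nonzero[OF near2]
  define M where "M x = mat n n (\<lambda>s. X s x)" for x
  have Mc: "M x \<in> carrier_mat n n" for x by (simp add: M_def)
  have Ms: "M x $$ s = X s x" if "s \<in> ix" for s x using that by (auto simp: M_def ix_def)
  have pM: "polyfun n (\<lambda>x. M x $$ (i, j))" if "i < n" "j < n" for i j
    using X[of "(i, j)"] that by (simp add: M_def ix_def)
  have hx: "h x \<cdot>\<^sub>m x = (h x * x $$ (0, 0)) \<cdot>\<^sub>m 1\<^sub>m n + u x ^ k \<cdot>\<^sub>m M x" if x: "x \<in> G" for x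
  proof (rule eq_matI)
    fix i j assume "i < dim_row ((h x * x $$ (0, 0)) \<cdot>\<^sub>m 1\<^sub>m n + u x ^ k \<cdot>\<^sub>m M x)"
      "j < dim_col ((h x * x $$ (0, 0)) \<cdot>\<^sub>m 1\<^sub>m n + u x ^ k \<cdot>\<^sub>m M x)"
    then have ij: "i < n" "j < n" by (auto simp: M_def)
    then have s: "(i, j) \<in> ix" by (simp add: ix_def)
    show "(h x \<cdot>\<^sub>m x) $$ (i, j) = ((h x * x $$ (0, 0)) \<cdot>\<^sub>m 1\<^sub>m n + u x ^ k \<cdot>\<^sub>m M x) $$ (i, j)"
      using ij Gc[OF x] eq[OF x s] by (simp add: M_def C_def dg_def algebra_simps split: if_splits)
  qed (use Gc[OF x] in \<open>auto simp: M_def\<close>)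
  have adj1: "adj_mat (1\<^sub>m n) = (1\<^sub>m n :: 'a mat)" using adj_inv[OF one] by simp
  have "\<exists>c. g * M (1\<^sub>m n) * adj_mat g = M (1\<^sub>m n) + c \<cdot>\<^sub>m 1\<^sub>m n" if g: "g \<in> G" for g
  proof -
    note cg = Gc[OF g] adj_inv[OF g]
    define y where "y x = g * x * adj_mat g * adj_mat x" for x
    define Z where "Z x = (g * M x * adj_mat g - M x) * adj_mat x" for x
    have yG: "y x \<in> G" if "x \<in> G" for x
      unfolding y_def by (intro mul adj that g)
    have yc: "y x \<in> carrier_mat n n" if "x \<in> carrier_mat n n" for x
      unfolding y_def using that cg adj_mat(1)[OF that] by auto
    have py: "polyfun n (\<lambda>x. y x $$ (i, j))" if "i < n" "j < n" for i j
      unfolding y_def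
    proof (rule polyfun_mult_mat[where F = "\<lambda>x. g * x * adj_mat g" and H = adj_mat])
      show "polyfun n (\<lambda>x. (g * x * adj_mat g) $$ (i, j))" if "i < n" "j < n" for i j
      proof (rule polyfun_mult_mat[where F = "\<lambda>x. g * x" and H = "\<lambda>_. adj_mat g"])
        show "polyfun n (\<lambda>x. (g * x) $$ (i, j))" if "i < n" "j < n" for i j
          by (rule polyfun_mult_mat[where F = "\<lambda>_. g" and H = "\<lambda>x. x"]) (use cg that in auto)
      qed (use cg that in auto)
    qed (use cg that in \<open>auto intro: polyfun_adj_mat adj_mat(1)\<close>)
    have pZ: "polyfun n (\<lambda>x. Z x $$ s)" if s: "s \<in> ix" for s
    proof -
      obtain i j where ij: "s = (i, j)" "i < n" "j < n" using s by (auto simp: ix_def)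
      have 1: "polyfun n (\<lambda>x. (g * M x * adj_mat g) $$ (i, j))" if "i < n" "j < n" for i j
      proof (rule polyfun_mult_mat[where F = "\<lambda>x. g * M x" and H = "\<lambda>_. adj_mat g"])
        show "polyfun n (\<lambda>x. (g * M x) $$ (i, j))" if "i < n" "j < n" for i j
          by (rule polyfun_mult_mat[where F = "\<lambda>_. g" and H = M]) (use cg that Mc pM in auto)
      qed (use cg that Mc in auto)
      have 2: "polyfun n (\<lambda>x. (g * M x * adj_mat g - M x) $$ (i, j))" if "i < n" "j < n" for i j
        by (rule polyfun_cong[OF polyfun_diff[OF 1[OF that] pM[OF that]]])
          (use Mc cg that in \<open>simp add: M_def del: index_mult_mat(1)\<close>)
      show ?thesis unfolding ij(1) Z_def
        by (rule polyfun_mult_mat[where F = "\<lambda>x. g * M x * adj_mat g - M x" and H = adj_mat])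
          (use 2 cg Mc ij in \<open>auto intro: polyfun_adj_mat adj_mat(1) minus_carrier_mat\<close>)
    qed
    have hy: "h x * (y x $$ s - dg s) = u x ^ k * Z x $$ s" if "x \<in> G" "s \<in> ix" for x s
      unfolding y_def Z_def by (rule commutator_expansion[OF g that(1) Mc hx[OF that(1)] that(2)])
    define F where "F s x = h2 (y x) * h x * (Z x $$ s - dg s * Z x $$ (0, 0))
      - u x ^ k * (Z x $$ (0, 0))\<^sup>2 * X2 s (y x)" for s x
    have "F s (1\<^sub>m n) = 0" if s: "s \<in> ix" for s
    proof (rule dom_power[OF polyfun_u, of _ k])
      show "polyfun n (F s)"
        unfolding F_def
        by (intro polyfun_diff polyfun_mult polyfun_const polyfun_power polyfun_u pZ zero_ix s h
            polyfun_compose[OF h2(1) yc py] polyfun_compose[OF X2[OF s] yc py])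
      fix x assume x: "x \<in> G"
      have y0: "h x * u (y x) = u x ^ k * Z x $$ (0, 0)"
        using hy[OF x zero_ix] by (simp add: u_def dg_def)
      have "h x * C s (y x) = h x * (y x $$ s - dg s) - dg s * (h x * u (y x))"
        by (simp add: C_def u_def algebra_simps)
      also have "\<dots> = u x ^ k * (Z x $$ s - dg s * Z x $$ (0, 0))"
        unfolding hy[OF x s] y0 by (simp add: algebra_simps)
      finally have C1: "h x * C s (y x) = u x ^ k * (Z x $$ s - dg s * Z x $$ (0, 0))" .
      have "u x ^ k * (h2 (y x) * h x * (Z x $$ s - dg s * Z x $$ (0, 0)))
        = h2 (y x) * h x * (h x * C s (y x))" unfolding C1 by (simp add: algebra_simps)
      also have "\<dots> = h x ^ 2 * (h2 (y x) * C s (y x))" by (simp add: algebra_simps power2_eq_square)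
      also have "\<dots> = (h x * u (y x)) ^ 2 * X2 s (y x)"
        unfolding eq2[OF yG[OF x] s] by (simp add: algebra_simps power_mult_distrib)
      also have "\<dots> = u x ^ k * (u x ^ k * (Z x $$ (0, 0))\<^sup>2 * X2 s (y x))"
        unfolding y0 by (simp add: algebra_simps power2_eq_square)
      finally show "u x ^ k * F s x = 0" by (simp add: F_def algebra_simps)
    qed (use une one in auto)
    moreover have y1: "y (1\<^sub>m n) = 1\<^sub>m n" unfolding y_def using cg adj1 by simp
    ultimately have Z1: "Z (1\<^sub>m n) $$ s = dg s * Z (1\<^sub>m n) $$ (0, 0)" if "s \<in> ix" for s
      using that h2(2) h(2) k by (simp add: F_def u_one power_0_left)
    let ?M = "M (1\<^sub>m n)"
    have gM: "g * ?M * adj_mat g \<in> carrier_mat n n" using cg Mc by auto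
    have Z1': "Z (1\<^sub>m n) = g * ?M * adj_mat g - ?M"
      unfolding Z_def adj1 using gM Mc by (intro right_mult_one_mat minus_carrier_mat)
    have "g * ?M * adj_mat g = ?M + Z (1\<^sub>m n) $$ (0, 0) \<cdot>\<^sub>m 1\<^sub>m n"
    proof (rule eq_matI)
      fix i j assume "i < dim_row (?M + Z (1\<^sub>m n) $$ (0, 0) \<cdot>\<^sub>m 1\<^sub>m n)"
        "j < dim_col (?M + Z (1\<^sub>m n) $$ (0, 0) \<cdot>\<^sub>m 1\<^sub>m n)"
      then have ij: "i < n" "j < n" by auto
      then have "Z (1\<^sub>m n) $$ (i, j) = (g * ?M * adj_mat g) $$ (i, j) - ?M $$ (i, j)"
        unfolding Z1' using Mc[of "1\<^sub>m n"] by simp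
      moreover have "(1\<^sub>m n :: 'a mat) $$ (i, j) = dg (i, j)" using ij by (simp add: dg_def)
      ultimately show "(g * ?M * adj_mat g) $$ (i, j) = (?M + Z (1\<^sub>m n) $$ (0, 0) \<cdot>\<^sub>m 1\<^sub>m n) $$ (i, j)"
        using Z1[of "(i, j)"] ij Mc[of "1\<^sub>m n"] by (simp add: ix_def algebra_simps del: index_mult_mat(1) index_one_mat(1))
    qed (use gM Mc[of "1\<^sub>m n"] in auto)
    then show ?thesis by blast
  qed
  then obtain \<mu> where \<mu>: "M (1\<^sub>m n) = \<mu> \<cdot>\<^sub>m 1\<^sub>m n" using scalar_if_conj_shift[OF Mc] by blast
  have "X (0, 0) (1\<^sub>m n) = 0"
  proof (rule dom_power[OF polyfun_u X[OF zero_ix], of k])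
    show "u x ^ k * X (0, 0) x = 0" if "x \<in> G" for x
      using eq[OF that zero_ix] by (simp add: C_def dg_def)
  qed (use une one in auto)
  then have "\<mu> = 0" using Ms[OF zero_ix, of "1\<^sub>m n"] n_pos unfolding \<mu> by simp
  then have X1: "X s (1\<^sub>m n) = 0" if "s \<in> ix" for s
    using Ms[OF that, of "1\<^sub>m n"] that unfolding \<mu> by (auto simp: ix_def)
  have "\<exists>r. (\<forall>a\<in>ix. polyfun n (r a)) \<and> (\<forall>x\<in>carrier_mat n n. X s x = X s (1\<^sub>m n) +
      (\<Sum>a\<in>ix. (x $$ a - 1\<^sub>m n $$ a) * r a x))" if "s \<in> ix" for s
    using polyfun_taylor[OF X[OF that] one_carrier_mat] unfolding ix_def .
  then have "\<forall>s. \<exists>r. s \<in> ix \<longrightarrow> (\<forall>a\<in>ix. polyfun n (r a)) \<and> (\<forall>x\<in>carrier_mat n n. X s x = X s (1\<^sub>m n) +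
      (\<Sum>a\<in>ix. (x $$ a - 1\<^sub>m n $$ a) * r a x))" by blast
  from choice[OF this] obtain r where r: "\<And>s a. s \<in> ix \<Longrightarrow> a \<in> ix \<Longrightarrow> polyfun n (r s a)"
    and Xr: "\<And>s x. s \<in> ix \<Longrightarrow> x \<in> carrier_mat n n \<Longrightarrow> X s x = X s (1\<^sub>m n) +
      (\<Sum>a\<in>ix. (x $$ a - 1\<^sub>m n $$ a) * r s a x)" by blast
  define Y where "Y s x = (\<Sum>a\<in>ix. (u x ^ (k - 1) * X a x + dg a * h x) * r s a x)" for s x
  have hX: "h x * X s x = u x * Y s x" if x: "x \<in> G" and s: "s \<in> ix" for x s
  proof -
    have "h x * X s x = (\<Sum>a\<in>ix. h x * ((x $$ a - 1\<^sub>m n $$ a) * r s a x))"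
      unfolding Xr[OF s Gc[OF x]] X1[OF s] by (simp add: sum_distrib_left)
    also have "\<dots> = (\<Sum>a\<in>ix. u x * ((u x ^ (k - 1) * X a x + dg a * h x) * r s a x))"
    proof (rule sum.cong[OF refl])
      fix a assume a: "a \<in> ix"
      have "h x * (x $$ a - 1\<^sub>m n $$ a) = h x * C a x + dg a * h x * u x"
        unfolding coord_eq[OF a] by (simp add: algebra_simps)
      also have "\<dots> = u x * (u x ^ (k - 1) * X a x + dg a * h x)"
        unfolding eq[OF x a] using k by (cases k) (auto simp: algebra_simps)
      finally show "h x * ((x $$ a - 1\<^sub>m n $$ a) * r s a x) =
        u x * ((u x ^ (k - 1) * X a x + dg a * h x) * r s a x)" by (simp add: mult.assoc[symmetric])
    qed
    finally show ?thesis by (simp add: Y_def sum_distrib_left)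
  qed
  show ?thesis
    unfolding near_scalar_def
  proof (intro exI[of _ "\<lambda>x. h x ^ 2"] exI[of _ Y] conjI ballI)
    show "polyfun n (\<lambda>x. h x ^ 2)" "h (1\<^sub>m n) ^ 2 \<noteq> 0" using h by auto
    show "polyfun n (Y s)" if "s \<in> ix" for s
      unfolding Y_def using that by (intro polyfun_sum polyfun_mult polyfun_add polyfun_power polyfun_const polyfun_u X h r) auto
    fix x s assume x: "x \<in> G" and s: "s \<in> ix"
    have "h x ^ 2 * C s x = h x * (h x * C s x)" by (simp add: power2_eq_square)
    also have "\<dots> = u x ^ k * (h x * X s x)" unfolding eq[OF x s] by simp
    finally show "h x ^ 2 * C s x = u x ^ Suc k * Y s x" unfolding hX[OF x s] by simp
  qed
qed

lemma lie_not_scalar: "\<exists>X\<in>lie. \<forall>\<mu>. X \<noteq> \<mu> \<cdot>\<^sub>m 1\<^sub>m n"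
proof (rule ccontr)
  assume "\<not> ?thesis"
  then have near2: "near_scalar 2" by (intro near_scalar_2) blast
  have "near_scalar (Suc (Suc k))" for k
    by (induction k) (use near2 near_scalar_Suc[OF near2] in \<open>auto simp: numeral_2_eq_2\<close>)
  then have "near_scalar (Suc n)" using n2 by (metis Suc_pred n_pos)
  then show False using near_scalar_bound[OF near2] by blast
qed

end

section \<open>The tangent space contains all trace-zero matrices\<close>

context irreducible_group
begin

lemma lie_zero: "X \<in> lie \<Longrightarrow> 0\<^sub>m n n \<in> lie"
proof -
  assume X: "X \<in> lie"
  have "X + (-1) \<cdot>\<^sub>m X = 0\<^sub>m n n" using lie_carrier[OF X] by (intro eq_matI) auto
  then show ?thesis using lie_add_scaled[OF X X, of "-1"] by simp
qed

lemma lie_scale: "X \<in> lie \<Longrightarrow> c \<cdot>\<^sub>m X \<in> lie"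
proof -
  assume X: "X \<in> lie"
  have "0\<^sub>m n n + c \<cdot>\<^sub>m X = c \<cdot>\<^sub>m X" using lie_carrier[OF X] by (intro eq_matI) auto
  then show ?thesis using lie_add_scaled[OF lie_zero[OF X] X, of c] by simp
qed

end

locale diagonal_element = irreducible_group +
  fixes \<gamma> :: "'a mat" and \<alpha> :: "nat \<Rightarrow> 'a" and k :: nat
  assumes \<gamma>: "\<gamma> \<in> G" and diag: "\<And>i j. i < n \<Longrightarrow> j < n \<Longrightarrow> \<gamma> $$ (i, j) = (if i = j then \<alpha> i else 0)"
    and k: "k < n"
    and good: "\<And>i j l. i < n \<Longrightarrow> j < n \<Longrightarrow> l < n \<Longrightarrow> l \<noteq> k \<Longrightarrow> \<alpha> i * \<alpha> l = \<alpha> k * \<alpha> j \<Longrightarrow> i = k \<and> j = l"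
begin

lemma mult_diag_left: "Y \<in> carrier_mat n n \<Longrightarrow> i < n \<Longrightarrow> j < n \<Longrightarrow> (\<gamma> * Y) $$ (i, j) = \<alpha> i * Y $$ (i, j)"
proof -
  assume Y: "Y \<in> carrier_mat n n" and ij: "i < n" "j < n"
  have "(\<gamma> * Y) $$ (i, j) = (\<Sum>t\<in>{0..<n}. \<gamma> $$ (i, t) * Y $$ (t, j))"
    using Y ij Gc[OF \<gamma>] by (simp add: scalar_prod_def)
  also have "\<dots> = (\<Sum>t\<in>{0..<n}. if t = i then \<alpha> i * Y $$ (i, j) else 0)"
    by (rule sum.cong) (use ij diag in auto)
  finally show ?thesis using ij by simp
qed

lemma mult_diag_right: "Y \<in> carrier_mat n n \<Longrightarrow> i < n \<Longrightarrow> j < n \<Longrightarrow> (Y * \<gamma>) $$ (i, j) = Y $$ (i, j) * \<alpha> j"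
proof -
  assume Y: "Y \<in> carrier_mat n n" and ij: "i < n" "j < n"
  have "(Y * \<gamma>) $$ (i, j) = (\<Sum>t\<in>{0..<n}. Y $$ (i, t) * \<gamma> $$ (t, j))"
    using Y ij Gc[OF \<gamma>] by (simp add: scalar_prod_def)
  also have "\<dots> = (\<Sum>t\<in>{0..<n}. if t = j then Y $$ (i, j) * \<alpha> j else 0)"
    by (rule sum.cong) (use ij diag in auto)
  finally show ?thesis using ij by simp
qed

lemma \<alpha>_nonzero: "i < n \<Longrightarrow> \<alpha> i \<noteq> 0"
proof
  assume i: "i < n" and 0: "\<alpha> i = 0"
  have "(\<gamma> * adj_mat \<gamma>) $$ (i, i) = 0"
    using mult_diag_left[OF adj_inv(3)[OF \<gamma>] i i] 0 by simp
  then show False unfolding adj_inv(1)[OF \<gamma>] using i by simp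
qed

lemma conj_diag:
  assumes Y: "Y \<in> carrier_mat n n" and ij: "i < n" "j < n"
  shows "(\<gamma> * Y * adj_mat \<gamma>) $$ (i, j) = \<alpha> i / \<alpha> j * Y $$ (i, j)"
proof -
  note c = Gc[OF \<gamma>] adj_inv[OF \<gamma>]
  have "\<gamma> * Y * adj_mat \<gamma> * \<gamma> = \<gamma> * Y * (adj_mat \<gamma> * \<gamma>)"
    using c Y by (intro assoc_mult_mat[of _ n n _ n _ n]) auto
  also have "\<dots> = \<gamma> * Y" using c Y by simp
  finally have "(\<gamma> * Y * adj_mat \<gamma> * \<gamma>) $$ (i, j) = \<alpha> i * Y $$ (i, j)"
    using mult_diag_left[OF Y ij] by simp
  moreover have "\<gamma> * Y * adj_mat \<gamma> \<in> carrier_mat n n" using c Y by auto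
  ultimately show ?thesis
    using mult_diag_right[of "\<gamma> * Y * adj_mat \<gamma>", OF _ ij] \<alpha>_nonzero[OF ij(2)]
    by (simp add: field_simps)
qed

lemma lie_projection:
  assumes Y: "Y \<in> lie" and ab: "a < n" "b < n" "Y $$ (a, b) \<noteq> 0"
    and sep: "\<And>i j. i < n \<Longrightarrow> j < n \<Longrightarrow> \<alpha> i * \<alpha> b = \<alpha> a * \<alpha> j \<Longrightarrow> i = a \<and> j = b"
  shows "emat n a b \<in> lie"
proof -
  have "\<exists>Z\<in>lie. Z $$ (a, b) \<noteq> 0 \<and> (\<forall>s\<in>S. Z $$ s = 0)" if "finite S" "S \<subseteq> ix - {(a, b)}" for S
    using that
  proof (induction S rule: finite_induct)
    case empty
    then show ?case using Y ab by blast
  next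
    case (insert s S)
    then obtain Z where Z: "Z \<in> lie" "Z $$ (a, b) \<noteq> 0" "\<And>s. s \<in> S \<Longrightarrow> Z $$ s = 0" by auto
    obtain i j where ij: "s = (i, j)" "i < n" "j < n" "(i, j) \<noteq> (a, b)"
      using insert.prems by (auto simp: ix_def)
    let ?Z = "\<gamma> * Z * adj_mat \<gamma> + (- (\<alpha> i / \<alpha> j)) \<cdot>\<^sub>m Z"
    have entry: "?Z $$ (i', j') = (\<alpha> i' / \<alpha> j' - \<alpha> i / \<alpha> j) * Z $$ (i', j')"
      if "i' < n" "j' < n" for i' j'
    proof -
      have "?Z $$ (i', j') = (\<gamma> * Z * adj_mat \<gamma>) $$ (i', j') + (- (\<alpha> i / \<alpha> j)) * Z $$ (i', j')"
        by (rule add_smult_index) (use lie_conj[OF Z(1) \<gamma>] lie_carrier Z(1) that in auto)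
      then show ?thesis using conj_diag[OF lie_carrier[OF Z(1)] that] by (simp add: algebra_simps)
    qed
    show ?case
    proof (intro bexI[of _ ?Z] conjI ballI)
      show "?Z \<in> lie" by (rule lie_add_scaled[OF lie_conj[OF Z(1) \<gamma>] Z(1)])
      have "\<alpha> i * \<alpha> b \<noteq> \<alpha> a * \<alpha> j" using sep[OF ij(2,3)] ij(4) by auto
      then have "\<alpha> a / \<alpha> b \<noteq> \<alpha> i / \<alpha> j"
        using \<alpha>_nonzero[OF ab(2)] \<alpha>_nonzero[OF ij(3)] by (simp add: field_simps)
      then show "?Z $$ (a, b) \<noteq> 0" unfolding entry[OF ab(1,2)] using Z(2) by simp
      fix t assume t: "t \<in> insert s S"
      obtain i' j' where t': "t = (i', j')" "i' < n" "j' < n"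
        using t insert.prems by (auto simp: ix_def)
      show "?Z $$ t = 0" unfolding t'(1) entry[OF t'(2,3)] using t t' ij(1) Z(3)[of t] by auto
    qed
  qed
  from this[of "ix - {(a, b)}"] finite_ix
  obtain Z where Z: "Z \<in> lie" "Z $$ (a, b) \<noteq> 0" "\<And>s. s \<in> ix \<Longrightarrow> s \<noteq> (a, b) \<Longrightarrow> Z $$ s = 0" by auto
  have "emat n a b = inverse (Z $$ (a, b)) \<cdot>\<^sub>m Z"
    by (rule eq_matI) (use Z lie_carrier[OF Z(1)] in \<open>auto simp: emat_index ix_def\<close>)
  then show ?thesis using lie_scale[OF Z(1)] by metis
qed

lemma adj_adj: "g \<in> G \<Longrightarrow> adj_mat (adj_mat g) = g"
  by (rule adj_mat_eqI[OF _ Gc det1[OF adj] adj_inv(2)]) (auto intro: adj_inv(3))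

lemma lie_transport:
  assumes E: "emat n i j \<in> lie" and ij: "i < n" "j < n" and ab: "a < n" "b < n"
    and sep: "\<And>i j. i < n \<Longrightarrow> j < n \<Longrightarrow> \<alpha> i * \<alpha> b = \<alpha> a * \<alpha> j \<Longrightarrow> i = a \<and> j = b"
  shows "emat n a b \<in> lie"
proof -
  obtain g1 where g1: "g1 \<in> G" "g1 $$ (a, i) \<noteq> 0" using entry_nonzero ab ij by blast
  obtain g2 where g2: "g2 \<in> G" "g2 $$ (j, b) \<noteq> 0" using entry_nonzero ab ij by blast
  have "\<exists>g\<in>G. g $$ (a, i) * adj_mat g $$ (j, b) \<noteq> 0"
  proof (rule ccontr)
    assume "\<not> ?thesis"
    then have "(\<forall>g\<in>G. g $$ (a, i) = 0) \<or> (\<forall>g\<in>G. adj_mat g $$ (j, b) = 0)"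
      by (intro dom polyfun_entry polyfun_adj_mat ab ij) auto
    then show False using g1 adj[OF g2(1)] g2 adj_adj[OF g2(1)] by metis
  qed
  then obtain g where g: "g \<in> G" "g $$ (a, i) * adj_mat g $$ (j, b) \<noteq> 0" by blast
  note c = Gc[OF g(1)] adj_inv(3)[OF g(1)]
  let ?Y = "g * emat n i j * adj_mat g"
  have "?Y $$ (a, b) = (\<Sum>t\<in>{0..<n}. (g * emat n i j) $$ (a, t) * adj_mat g $$ (t, b))"
    using c ab by (simp add: scalar_prod_def)
  also have "\<dots> = (\<Sum>t\<in>{0..<n}. if t = j then g $$ (a, i) * adj_mat g $$ (j, b) else 0)"
    by (rule sum.cong) (use emat_mult_right[OF c(1) ab(1) _ ij(1)] in auto)
  finally have "?Y $$ (a, b) \<noteq> 0" using g(2) ij by simp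
  then show ?thesis by (rule lie_projection[OF lie_conj[OF E g(1)] ab _ sep])
qed

lemma emat_bracket:
  assumes "i < n" "l < n" "j < n"
  shows "emat n i l * emat n l j - emat n l j * emat n i l =
    emat n i j - (if i = j then emat n l l else 0\<^sub>m n n :: 'a mat)"
proof (rule eq_matI)
  fix a b assume "a < dim_row (emat n i j - (if i = j then emat n l l else 0\<^sub>m n n :: 'a mat))"
    "b < dim_col (emat n i j - (if i = j then emat n l l else 0\<^sub>m n n :: 'a mat))"
  then have ab: "a < n" "b < n" by (auto split: if_splits)
  have "(emat n i l * emat n l j - emat n l j * emat n i l :: 'a mat) $$ (a, b)
    = (emat n i l * emat n l j) $$ (a, b) - (emat n l j * emat n i l) $$ (a, b)"
    using ab by (simp del: index_mult_mat(1))
  then show "(emat n i l * emat n l j - emat n l j * emat n i l) $$ (a, b) =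
    (emat n i j - (if i = j then emat n l l else 0\<^sub>m n n :: 'a mat)) $$ (a, b)"
    unfolding emat_mult_left[OF emat_carrier ab assms(2)] emat_mult_left[OF emat_carrier ab assms(3)]
    using ab assms by (auto simp: emat_index)
qed auto

lemma lie_contains_sl:
  assumes X: "X \<in> carrier_mat n n" and tr: "(\<Sum>i<n. X $$ (i, i)) = 0"
  shows "X \<in> lie"
proof -
  have sep1: "\<And>i j. i < n \<Longrightarrow> j < n \<Longrightarrow> \<alpha> i * \<alpha> l = \<alpha> k * \<alpha> j \<Longrightarrow> i = k \<and> j = l"
    if "l < n" "l \<noteq> k" for l using good that by blast
  have sep2: "\<And>i j. i < n \<Longrightarrow> j < n \<Longrightarrow> \<alpha> i * \<alpha> k = \<alpha> l * \<alpha> j \<Longrightarrow> i = l \<and> j = k"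
    if "l < n" "l \<noteq> k" for l
  proof -
    fix i j assume ij: "i < n" "j < n" "\<alpha> i * \<alpha> k = \<alpha> l * \<alpha> j"
    then have "\<alpha> j * \<alpha> l = \<alpha> k * \<alpha> i" by (simp add: mult.commute)
    then show "i = l \<and> j = k" using good[OF ij(2,1) that] by auto
  qed
  obtain Y where Y: "Y \<in> lie" "\<And>\<mu>. Y \<noteq> \<mu> \<cdot>\<^sub>m 1\<^sub>m n" using lie_not_scalar by blast
  obtain g l where gl: "g \<in> G" "l < n" "l \<noteq> k" "(g * Y * adj_mat g) $$ (k, l) \<noteq> 0"
    using scalar_if_conj_row_diagonal[OF lie_carrier[OF Y(1)] k] Y(2) by blast
  have E: "emat n k l \<in> lie"
    by (rule lie_projection[OF lie_conj[OF Y(1) gl(1)] k gl(2,4) sep1[OF gl(2,3)]])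
  have Ekl: "emat n k m \<in> lie" if m: "m < n" "m \<noteq> k" for m
    by (rule lie_transport[OF E k gl(2) k m(1) sep1[OF m]])
  have Elk: "emat n m k \<in> lie" if m: "m < n" "m \<noteq> k" for m
    by (rule lie_transport[OF E k gl(2) m(1) k sep2[OF m]])
  have br: "emat n i j - (if i = j then emat n k k else 0\<^sub>m n n) \<in> lie"
    if "i < n" "i \<noteq> k" "j < n" "j \<noteq> k" for i j
    using lie_bracket[OF Elk[OF that(1,2)] that(1) k that(2) Ekl[OF that(3,4)]]
    unfolding emat_bracket[OF that(1) k that(3)] .
  show ?thesis
    unfolding lie_def
  proof (intro CollectI conjI allI impI X)
    fix p assume p: "vanishing p"
    obtain f where f: "\<And>X. X \<in> carrier_mat n n \<Longrightarrow> dirderiv p (1\<^sub>m n) X = (\<Sum>s\<in>ix. f s * X $$ s)"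
      using dirderiv_linear[OF inf, of n p "1\<^sub>m n"] p by (auto simp: vanishing_def ix_def)
    have fE: "(\<Sum>s\<in>ix. f s * emat n i j $$ s) = f (i, j)" if "i < n" "j < n" for i j
    proof -
      have "(\<Sum>s\<in>ix. f s * emat n i j $$ s) = (\<Sum>s\<in>ix. if s = (i, j) then f s else 0)"
        by (rule sum.cong) (auto simp: ix_def emat_index split: if_splits)
      then show ?thesis using that finite_ix by (simp add: ix_def)
    qed
    have lie0: "(\<Sum>s\<in>ix. f s * Z $$ s) = 0" if "Z \<in> lie" for Z
      using f[OF lie_carrier[OF that]] that p by (simp add: lie_def)
    have off: "f (i, j) = 0" if ij: "i < n" "j < n" "i \<noteq> j" for i j
    proof -
      consider "i = k" | "j = k" | "i \<noteq> k" "j \<noteq> k" by blast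
      then have "emat n i j \<in> lie"
      proof cases
        case 3
        have "emat n i j - 0\<^sub>m n n = (emat n i j :: 'a mat)" by (rule eq_matI) auto
        then show ?thesis using br[of i j] 3 ij by simp
      qed (use Ekl Elk ij in auto)
      then show ?thesis using lie0 fE[OF ij(1,2)] by force
    qed
    have dia: "f (i, i) = f (k, k)" if i: "i < n" for i
    proof (cases "i = k")
      case False
      have "emat n i i - emat n k k \<in> lie" using br[of i i] i False by simp
      from lie0[OF this] have "0 = (\<Sum>s\<in>ix. f s * (emat n i i - emat n k k) $$ s)" by simp
      also have "\<dots> = (\<Sum>s\<in>ix. f s * emat n i i $$ s - f s * emat n k k $$ s)"
        by (rule sum.cong) (auto simp: ix_def right_diff_distrib)
      also have "\<dots> = f (i, i) - f (k, k)" unfolding sum_subtractf fE[OF i i] fE[OF k k] ..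
      finally show ?thesis by simp
    qed simp
    have "dirderiv p (1\<^sub>m n) X = (\<Sum>i<n. \<Sum>j<n. f (i, j) * X $$ (i, j))"
      unfolding f[OF X] ix_def by (simp add: sum.cartesian_product)
    also have "\<dots> = (\<Sum>i<n. \<Sum>j<n. if j = i then f (k, k) * X $$ (i, i) else 0)"
      by (intro sum.cong refl) (use off dia in auto)
    also have "\<dots> = f (k, k) * (\<Sum>i<n. X $$ (i, i))" by (simp add: sum_distrib_left)
    finally show "dirderiv p (1\<^sub>m n) X = 0" using tr by simp
  qed
qed

end

section \<open>From the tangent space to the group\<close>

lemma add_power_char:
  fixes x y :: "'a::field"
  assumes p: "prime p" "CHAR('a) = p"
  shows "(x + y) ^ p = x ^ p + y ^ p"
proof -
  have p2: "p \<ge> 2" using p prime_ge_2_nat by blast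
  have 0: "of_nat (p choose k) * x ^ k * y ^ (p - k) = 0" if k: "k \<in> {..p} - {0, p}" for k
  proof -
    have "p dvd (p choose k)" by (rule dvd_choose_prime) (use k p in auto)
    then have "of_nat (p choose k) = (0 :: 'a)" using p by (simp add: of_nat_eq_0_iff_char_dvd)
    then show ?thesis by simp
  qed
  have "(x + y) ^ p = (\<Sum>k\<le>p. of_nat (p choose k) * x ^ k * y ^ (p - k))" by (rule binomial_ring)
  also have "\<dots> = (\<Sum>k\<in>{0, p}. of_nat (p choose k) * x ^ k * y ^ (p - k))"
    by (rule sum.mono_neutral_right) (use 0 in auto)
  finally show ?thesis using p2 by simp
qed

lemma sum_power_char:
  fixes f :: "'b \<Rightarrow> 'a::field"
  assumes p: "prime p" "CHAR('a) = p"
  shows "(\<Sum>i\<in>S. f i) ^ p = (\<Sum>i\<in>S. f i ^ p)"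
  using prime_gt_0_nat[OF p(1)]
  by (induction S rule: infinite_finite_induct) (auto simp: add_power_char[OF p])

lemma coeff_one_eq_poly_pderiv: "coeff P 1 = poly (pderiv P) 0"
  by (simp add: poly_0_coeff_0 coeff_pderiv)

lemma coeff_one_linear_power:
  "coeff ([:a, 1:] ^ m) 1 = of_nat m * (a :: 'a::field) ^ (m - 1)"
proof (cases m)
  case (Suc k)
  then show ?thesis unfolding coeff_one_eq_poly_pderiv by (simp add: pderiv_power_Suc pderiv_pCons del: power_Suc)
qed simp

text \<open>Where the cofactor of the upper left entry does not vanish, the other entries are coordinates
  on the special linear group. Polynomials in these coordinates are given by coefficient functions
  on exponent vectors.\<close>

definition yix :: "nat \<Rightarrow> (nat \<times> nat) set" where
  "yix n = {..<n}\<times>{..<n} - {(0, 0)}"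

definition exponents :: "nat \<Rightarrow> nat \<Rightarrow> (nat \<times> nat \<Rightarrow> nat) set" where
  "exponents n d = {\<alpha>. (\<forall>s. s \<notin> yix n \<longrightarrow> \<alpha> s = 0) \<and> (\<Sum>s\<in>yix n. \<alpha> s) \<le> d}"

definition ymono :: "nat \<Rightarrow> (nat \<times> nat \<Rightarrow> nat) \<Rightarrow> 'a::field mat \<Rightarrow> 'a" where
  "ymono n \<alpha> x = (\<Prod>s\<in>yix n. x $$ s ^ \<alpha> s)"

definition yeval :: "nat \<Rightarrow> nat \<Rightarrow> ((nat \<times> nat \<Rightarrow> nat) \<Rightarrow> 'a::field) \<Rightarrow> 'a mat \<Rightarrow> 'a" where
  "yeval n d c x = (\<Sum>\<alpha>\<in>exponents n d. c \<alpha> * ymono n \<alpha> x)"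

lemma finite_yix: "finite (yix n)"
  by (simp add: yix_def)

lemma exponents_off: "\<alpha> \<in> exponents n d \<Longrightarrow> s \<notin> yix n \<Longrightarrow> \<alpha> s = 0"
  by (cases s) (simp add: exponents_def)

lemma exponents_le: "\<alpha> \<in> exponents n d \<Longrightarrow> \<alpha> s \<le> d"
proof (cases "s \<in> yix n")
  case True
  assume "\<alpha> \<in> exponents n d"
  then have "(\<Sum>s\<in>yix n. \<alpha> s) \<le> d" by (simp add: exponents_def)
  moreover have "\<alpha> s \<le> (\<Sum>s\<in>yix n. \<alpha> s)" using True finite_yix by (intro member_le_sum) auto
  ultimately show ?thesis by simp
next
  case False
  assume "\<alpha> \<in> exponents n d"
  then have "\<alpha> s = 0" using False by (rule exponents_off)
  then show ?thesis by simp
qed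

lemma finite_exponents: "finite (exponents n d)"
proof (rule finite_subset)
  show "finite {\<alpha>. \<forall>s. (s \<in> yix n \<longrightarrow> \<alpha> s \<in> {..d}) \<and> (s \<notin> yix n \<longrightarrow> \<alpha> s = (0::nat))}"
    by (rule finite_set_of_finite_funs) (auto simp: finite_yix)
  show "exponents n d \<subseteq> {\<alpha>. \<forall>s. (s \<in> yix n \<longrightarrow> \<alpha> s \<in> {..d}) \<and> (s \<notin> yix n \<longrightarrow> \<alpha> s = (0::nat))}"
    using exponents_le by (auto simp: exponents_def)
qed

lemma exponents_zero: "exponents n 0 = {\<lambda>_. 0}"
proof (intro equalityI subsetI)
  fix \<alpha> assume "\<alpha> \<in> exponents n 0"
  from exponents_le[OF this] have "\<alpha> = (\<lambda>_. 0)" by (intro ext) simp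
  then show "\<alpha> \<in> {\<lambda>_. 0}" by simp
qed (simp add: exponents_def)

lemma ymono_split:
  assumes "s \<in> yix n"
  shows "ymono n \<alpha> x = x $$ s ^ \<alpha> s * (\<Prod>r\<in>yix n - {s}. x $$ r ^ \<alpha> r)"
  unfolding ymono_def using assms finite_yix by (simp add: prod.remove)

lemma ev_derivative:
  fixes c :: "(nat \<times> nat \<Rightarrow> nat) \<Rightarrow> 'a::field"
  assumes s: "s \<in> yix n"
  shows "(\<Sum>\<alpha>\<in>exponents n (Suc d). c \<alpha> * (of_nat (\<alpha> s) * x $$ s ^ (\<alpha> s - 1) * (\<Prod>r\<in>yix n - {s}. x $$ r ^ \<alpha> r)))
    = yeval n d (\<lambda>\<beta>. of_nat (Suc (\<beta> s)) * c (\<beta>(s := Suc (\<beta> s)))) x"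
proof -
  have "(\<Sum>\<alpha>\<in>exponents n (Suc d). c \<alpha> * (of_nat (\<alpha> s) * x $$ s ^ (\<alpha> s - 1) * (\<Prod>r\<in>yix n - {s}. x $$ r ^ \<alpha> r)))
    = (\<Sum>\<alpha>\<in>{\<alpha>\<in>exponents n (Suc d). \<alpha> s > 0}. c \<alpha> * (of_nat (\<alpha> s) * x $$ s ^ (\<alpha> s - 1) * (\<Prod>r\<in>yix n - {s}. x $$ r ^ \<alpha> r)))"
    by (rule sum.mono_neutral_right) (auto simp: finite_exponents)
  also have "\<dots> = (\<Sum>\<beta>\<in>exponents n d. of_nat (Suc (\<beta> s)) * c (\<beta>(s := Suc (\<beta> s))) * ymono n \<beta> x)"
  proof (rule sum.reindex_bij_witness[of _ "\<lambda>\<beta>. \<beta>(s := Suc (\<beta> s))" "\<lambda>\<alpha>. \<alpha>(s := \<alpha> s - 1)"])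
    have upd: "(\<Sum>r\<in>yix n. (\<beta>(s := b)) r) = b + (\<Sum>r\<in>yix n - {s}. \<beta> r)" for \<beta> :: "nat \<times> nat \<Rightarrow> nat" and b
      using s finite_yix by (subst sum.remove[of _ s]) (auto intro!: sum.cong)
    have orig: "(\<Sum>r\<in>yix n. \<beta> r) = \<beta> s + (\<Sum>r\<in>yix n - {s}. \<beta> r)" for \<beta> :: "nat \<times> nat \<Rightarrow> nat"
      using s finite_yix by (subst sum.remove[of _ s]) auto
    fix \<alpha> assume a: "\<alpha> \<in> {\<alpha>\<in>exponents n (Suc d). \<alpha> s > 0}"
    show "(\<alpha>(s := \<alpha> s - 1))(s := Suc ((\<alpha>(s := \<alpha> s - 1)) s)) = \<alpha>" using a by auto
    show "\<alpha>(s := \<alpha> s - 1) \<in> exponents n d" using a orig[of \<alpha>] s unfolding exponents_def mem_Collect_eq upd by auto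
    show "of_nat (Suc ((\<alpha>(s := \<alpha> s - 1)) s)) * c ((\<alpha>(s := \<alpha> s - 1))(s := Suc ((\<alpha>(s := \<alpha> s - 1)) s)))
        * ymono n (\<alpha>(s := \<alpha> s - 1)) x
      = c \<alpha> * (of_nat (\<alpha> s) * x $$ s ^ (\<alpha> s - 1) * (\<Prod>r\<in>yix n - {s}. x $$ r ^ \<alpha> r))"
    proof -
      have "(\<Prod>r\<in>yix n - {s}. x $$ r ^ (\<alpha>(s := \<alpha> s - 1)) r) = (\<Prod>r\<in>yix n - {s}. x $$ r ^ \<alpha> r)"
        by (rule prod.cong) auto
      moreover have "(\<alpha>(s := \<alpha> s - 1))(s := Suc ((\<alpha>(s := \<alpha> s - 1)) s)) = \<alpha>" using a by auto
      moreover have "Suc (\<alpha> s - 1) = \<alpha> s" using a by auto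
      ultimately show ?thesis unfolding ymono_split[OF s] by (simp add: mult_ac)
    qed
  next
    fix \<beta> assume b: "\<beta> \<in> exponents n d"
    have upd: "(\<Sum>r\<in>yix n. (\<beta>(s := b)) r) = b + (\<Sum>r\<in>yix n - {s}. \<beta> r)" for b
      using s finite_yix by (subst sum.remove[of _ s]) (auto intro!: sum.cong)
    have orig: "(\<Sum>r\<in>yix n. \<beta> r) = \<beta> s + (\<Sum>r\<in>yix n - {s}. \<beta> r)"
      using s finite_yix by (subst sum.remove[of _ s]) auto
    show "(\<beta>(s := Suc (\<beta> s)))(s := (\<beta>(s := Suc (\<beta> s))) s - 1) = \<beta>" by auto
    show "\<beta>(s := Suc (\<beta> s)) \<in> {\<alpha>\<in>exponents n (Suc d). \<alpha> s > 0}"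
      using b orig s unfolding exponents_def mem_Collect_eq upd by auto
  qed
  finally show ?thesis unfolding yeval_def .
qed

definition ypoly :: "nat \<Rightarrow> ('a::field mat \<Rightarrow> 'a) \<Rightarrow> bool" where
  "ypoly n f \<longleftrightarrow> (\<exists>l. (\<forall>(a, \<alpha>)\<in>set l. \<forall>s. s \<notin> yix n \<longrightarrow> \<alpha> s = 0) \<and>
     (\<forall>x\<in>carrier_mat n n. f x = (\<Sum>(a, \<alpha>)\<leftarrow>l. a * ymono n \<alpha> x)))"

lemma ypoly_cong: "ypoly n f \<Longrightarrow> (\<And>x. x \<in> carrier_mat n n \<Longrightarrow> g x = f x) \<Longrightarrow> ypoly n g"
  unfolding ypoly_def by auto

lemma ypoly_const: "ypoly n (\<lambda>_. c)"
  unfolding ypoly_def by (rule exI[of _ "[(c, \<lambda>_. 0)]"]) (auto simp: ymono_def)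

lemma ypoly_entry:
  assumes s: "s \<in> yix n"
  shows "ypoly n (\<lambda>x. x $$ s)"
proof -
  have "ymono n (\<lambda>r. if r = s then 1 else 0) x = x $$ s" for x :: "'a mat"
    unfolding ymono_split[OF s] by (simp add: prod.neutral)
  then show ?thesis
    unfolding ypoly_def using s by (intro exI[of _ "[(1, \<lambda>r. if r = s then 1 else 0)]"]) auto
qed

lemma ypoly_add: "ypoly n f \<Longrightarrow> ypoly n g \<Longrightarrow> ypoly n (\<lambda>x. f x + g x)"
  unfolding ypoly_def
proof (elim exE conjE)
  fix l l' assume "\<forall>(a, \<alpha>)\<in>set l. \<forall>s. s \<notin> yix n \<longrightarrow> \<alpha> s = 0" "\<forall>(a, \<alpha>)\<in>set l'. \<forall>s. s \<notin> yix n \<longrightarrow> \<alpha> s = 0"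
    "\<forall>x\<in>carrier_mat n n. f x = (\<Sum>(a, \<alpha>)\<leftarrow>l. a * ymono n \<alpha> x)"
    "\<forall>x\<in>carrier_mat n n. g x = (\<Sum>(a, \<alpha>)\<leftarrow>l'. a * ymono n \<alpha> x)"
  then show "\<exists>l. (\<forall>(a, \<alpha>)\<in>set l. \<forall>s. s \<notin> yix n \<longrightarrow> \<alpha> s = 0) \<and>
     (\<forall>x\<in>carrier_mat n n. f x + g x = (\<Sum>(a, \<alpha>)\<leftarrow>l. a * ymono n \<alpha> x))"
    by (intro exI[of _ "l @ l'"]) auto
qed

lemma ymono_add: "ymono n (\<lambda>s. \<alpha> s + \<beta> s) x = ymono n \<alpha> x * ymono n \<beta> x"
  by (simp add: ymono_def power_add prod.distrib)

lemma ypoly_mult: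
  fixes f g :: "'a::field mat \<Rightarrow> 'a"
  assumes "ypoly n f" "ypoly n g"
  shows "ypoly n (\<lambda>x. f x * g x)"
proof -
  obtain l where l: "\<forall>(a, \<alpha>)\<in>set l. \<forall>s. s \<notin> yix n \<longrightarrow> \<alpha> s = 0"
    "\<And>x. x \<in> carrier_mat n n \<Longrightarrow> f x = (\<Sum>(a, \<alpha>)\<leftarrow>l. a * ymono n \<alpha> x)"
    using assms(1) unfolding ypoly_def by blast
  obtain l' where l': "\<forall>(a, \<alpha>)\<in>set l'. \<forall>s. s \<notin> yix n \<longrightarrow> \<alpha> s = 0"
    "\<And>x. x \<in> carrier_mat n n \<Longrightarrow> g x = (\<Sum>(a, \<alpha>)\<leftarrow>l'. a * ymono n \<alpha> x)"
    using assms(2) unfolding ypoly_def by blast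
  let ?f = "\<lambda>((a, \<alpha>), (b, \<beta>)). (a * b :: 'a, \<lambda>s. \<alpha> s + \<beta> s :: nat)"
  have one: "(\<Sum>(a, \<alpha>)\<leftarrow>map (\<lambda>y. ?f ((a1, \<alpha>1), y)) k2. a * ymono n \<alpha> x) = a1 * ymono n \<alpha>1 x * (\<Sum>(a, \<alpha>)\<leftarrow>k2. a * ymono n \<alpha> x)"
    for k2 and x :: "'a mat" and a1 :: 'a and \<alpha>1
    by (induction k2) (auto simp: algebra_simps ymono_add)
  have *: "(\<Sum>(a, \<alpha>)\<leftarrow>map ?f (List.product k1 k2). a * ymono n \<alpha> x) =
    (\<Sum>(a, \<alpha>)\<leftarrow>k1. a * ymono n \<alpha> x) * (\<Sum>(a, \<alpha>)\<leftarrow>k2. a * ymono n \<alpha> x)" for k1 k2 and x :: "'a mat"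
  proof (induction k1)
    case (Cons ab k1)
    obtain a1 \<alpha>1 where ab: "ab = (a1, \<alpha>1)" by force
    show ?case using Cons one by (simp add: ab comp_def distrib_right)
  qed simp
  show ?thesis
    unfolding ypoly_def
  proof (intro exI[of _ "map ?f (List.product l l')"] conjI ballI)
    show "case z of (a, \<alpha>) \<Rightarrow> \<forall>s. s \<notin> yix n \<longrightarrow> \<alpha> s = 0" if "z \<in> set (map ?f (List.product l l'))" for z
      using that l(1) l'(1) by fastforce
    show "f x * g x = (\<Sum>(a, \<alpha>)\<leftarrow>map ?f (List.product l l'). a * ymono n \<alpha> x)" if "x \<in> carrier_mat n n" for x
      unfolding * l(2)[OF that] l'(2)[OF that] ..
  qed
qed

lemma ypoly_sum: "(\<And>i. i \<in> S \<Longrightarrow> ypoly n (f i)) \<Longrightarrow> ypoly n (\<lambda>x. \<Sum>i\<in>S. f i x)"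
  by (induction S rule: infinite_finite_induct) (auto intro: ypoly_const ypoly_add)

lemma ypoly_prod: "(\<And>i. i \<in> S \<Longrightarrow> ypoly n (f i)) \<Longrightarrow> ypoly n (\<lambda>x. \<Prod>i\<in>S. f i x)"
  by (induction S rule: infinite_finite_induct) (auto intro: ypoly_const ypoly_mult)

lemma ypoly_power: "ypoly n f \<Longrightarrow> ypoly n (\<lambda>x. f x ^ k)"
  by (induction k) (auto intro: ypoly_const ypoly_mult)

lemma ypoly_uminus: "ypoly n f \<Longrightarrow> ypoly n (\<lambda>x. - f x)"
  using ypoly_mult[OF ypoly_const[of n "-1"], of f] by simp

lemma ypoly_cofactor:
  assumes j: "j < n" and n: "0 < n"
  shows "ypoly n (\<lambda>x. cofactor x 0 j)"
proof (rule ypoly_cong)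
  let ?d = "\<lambda>x i' j'. x $$ (Suc i', if j' < j then j' else Suc j')"
  show "ypoly n (\<lambda>x. (- 1) ^ (0 + j) * (\<Sum>p \<in> {p. p permutes {0..<n - 1}}. signof p * (\<Prod>i = 0..<n - 1. ?d x i (p i))))"
  proof (intro ypoly_mult ypoly_sum ypoly_prod ypoly_const ypoly_entry)
    fix p i assume "p \<in> {p. p permutes {0..<n - 1}}" "i \<in> {0..<n - 1}"
    then have "p i < n - 1" "i < n - 1" by (auto simp: permutes_in_image)
    then show "(Suc i, if p i < j then p i else Suc (p i)) \<in> yix n" by (auto simp: yix_def)
  qed
  fix x :: "'a mat" assume x: "x \<in> carrier_mat n n"
  have "mat_delete x 0 j \<in> carrier_mat (n - 1) (n - 1)" using mat_delete_carrier[OF x] .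
  then have "det (mat_delete x 0 j) = (\<Sum>p \<in> {p. p permutes {0..<n - 1}}. signof p * (\<Prod>i = 0..<n - 1. mat_delete x 0 j $$ (i, p i)))"
    by (rule det_def')
  also have "\<dots> = (\<Sum>p \<in> {p. p permutes {0..<n - 1}}. signof p * (\<Prod>i = 0..<n - 1. ?d x i (p i)))"
  proof (intro sum.cong prod.cong refl arg_cong2[of _ _ _ _ "(*)"])
    fix p i assume "p \<in> {p. p permutes {0..<n - 1}}" "i \<in> {0..<n - 1}"
    then have "p i < n - 1" "i < n - 1" by (auto simp: permutes_in_image)
    then show "mat_delete x 0 j $$ (i, p i) = ?d x i (p i)" using x by (auto simp: mat_delete_def)
  qed
  finally show "cofactor x 0 j = (- 1) ^ (0 + j) * (\<Sum>p \<in> {p. p permutes {0..<n - 1}}. signof p * (\<Prod>i = 0..<n - 1. ?d x i (p i)))"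
    by (simp add: cofactor_def)
qed

lemma ypoly_ev:
  assumes "ypoly n f"
  shows "\<exists>d c. \<forall>x\<in>carrier_mat n n. f x = yeval n d c x"
proof -
  obtain l where l: "\<forall>(a, \<alpha>)\<in>set l. \<forall>s. s \<notin> yix n \<longrightarrow> \<alpha> s = 0"
    and f: "\<And>x. x \<in> carrier_mat n n \<Longrightarrow> f x = (\<Sum>(a, \<alpha>)\<leftarrow>l. a * ymono n \<alpha> x)"
    using assms unfolding ypoly_def by blast
  from l have "\<exists>d0. \<forall>d\<ge>d0. \<exists>c. \<forall>x. (\<Sum>(a, \<alpha>)\<leftarrow>l. a * ymono n \<alpha> x) = yeval n d c (x :: 'a mat)"
  proof (induction l)
    case Nil
    show ?case by (intro exI[of _ 0] allI impI exI[of _ "\<lambda>_. 0"]) (simp add: yeval_def)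
  next
    case (Cons z l)
    obtain a \<alpha> where z: "z = (a, \<alpha>)" by force
    obtain d0 where d0: "\<And>d. d \<ge> d0 \<Longrightarrow> \<exists>c. \<forall>x. (\<Sum>(a, \<alpha>)\<leftarrow>l. a * ymono n \<alpha> x) = yeval n d c (x :: 'a mat)"
      using Cons by auto
    show ?case
    proof (intro exI[of _ "max d0 (\<Sum>s\<in>yix n. \<alpha> s)"] allI impI)
      fix d assume d: "max d0 (\<Sum>s\<in>yix n. \<alpha> s) \<le> d"
      then obtain c where c: "\<And>x. (\<Sum>(a, \<alpha>)\<leftarrow>l. a * ymono n \<alpha> x) = yeval n d c (x :: 'a mat)"
        using d0[of d] by auto
      have \<alpha>: "\<alpha> \<in> exponents n d" using Cons.prems z d by (auto simp: exponents_def)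
      have "(\<Sum>(a, \<alpha>)\<leftarrow>z # l. a * ymono n \<alpha> x) = yeval n d (\<lambda>\<beta>. c \<beta> + (if \<beta> = \<alpha> then a else 0)) x" for x :: "'a mat"
      proof -
        have "yeval n d (\<lambda>\<beta>. c \<beta> + (if \<beta> = \<alpha> then a else 0)) x
          = yeval n d c x + (\<Sum>\<beta>\<in>exponents n d. if \<beta> = \<alpha> then a * ymono n \<alpha> x else 0)"
          unfolding yeval_def sum.distrib[symmetric] by (rule sum.cong) (auto simp: distrib_right)
        also have "\<dots> = yeval n d c x + a * ymono n \<alpha> x" using \<alpha> finite_exponents by simp
        finally show ?thesis unfolding z using c[of x] by simp
      qed
      then show "\<exists>c. \<forall>x. (\<Sum>(a, \<alpha>)\<leftarrow>z # l. a * ymono n \<alpha> x) = yeval n d c (x :: 'a mat)" by blast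
    qed
  qed
  then obtain d c where "\<forall>x. (\<Sum>(a, \<alpha>)\<leftarrow>l. a * ymono n \<alpha> x) = yeval n d c (x :: 'a mat)" by blast
  then show ?thesis using f by auto
qed

context irreducible_group
begin

lemma yix_ix: "s \<in> yix n \<Longrightarrow> s \<in> ix"
  by (auto simp: yix_def ix_def)

lemma tangent_vector_derivative:
  assumes sl: "\<And>X. X \<in> carrier_mat n n \<Longrightarrow> (\<Sum>i<n. X $$ (i, i)) = 0 \<Longrightarrow> X \<in> lie"
    and p: "vanishing p" and g: "g \<in> G" and N: "cofactor g 0 0 \<noteq> 0"
    and ab: "(a, b) \<in> yix n"
  shows "dirderiv p g (mat n n (\<lambda>s. if s = (a, b) then 1
    else if s = (0, 0) then - cofactor g a b / cofactor g 0 0 else 0)) = 0"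
proof -
  define v where "v = mat n n (\<lambda>s. if s = (a, b) then 1
    else if s = (0, 0) then - cofactor g a b / cofactor g 0 0 else 0 :: 'a)"
  have v: "v \<in> carrier_mat n n" by (simp add: v_def)
  note c = Gc[OF g] adj_inv[OF g]
  let ?X = "adj_mat g * v"
  have X: "?X \<in> carrier_mat n n" using c v by auto
  have ab': "a < n" "b < n" "(a, b) \<noteq> (0, 0)" using ab by (auto simp: yix_def)
  have "(\<Sum>i<n. ?X $$ (i, i)) = (\<Sum>i<n. \<Sum>j<n. adj_mat g $$ (i, j) * v $$ (j, i))"
    by (rule sum.cong) (use c v in \<open>auto simp: scalar_prod_def atLeast0LessThan\<close>)
  also have "\<dots> = (\<Sum>i<n. \<Sum>j<n. (if (j, i) = (a, b) then cofactor g a b else 0)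
      + (if (j, i) = (0, 0) then - cofactor g a b else 0))"
    by (intro sum.cong refl) (use c N ab' in \<open>auto simp: v_def adj_mat_def\<close>)
  also have "\<dots> = (\<Sum>i<n. (if i = b then cofactor g a b else 0) + (if i = 0 then - cofactor g a b else 0))"
  proof (rule sum.cong[OF refl])
    fix i assume "i \<in> {..<n}"
    have "(\<Sum>j<n. if (j, i) = (a', b') then z else 0) = (if i = b' then z else 0)" if "a' < n" for a' b' and z :: 'a
      using that by (cases "i = b'") (auto simp: sum.delta)
    from this[OF ab'(1)] this[OF n_pos] show "(\<Sum>j<n. (if (j, i) = (a, b) then cofactor g a b else 0)
      + (if (j, i) = (0, 0) then - cofactor g a b else 0))
      = (if i = b then cofactor g a b else 0) + (if i = 0 then - cofactor g a b else 0)"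
      unfolding sum.distrib by presburger
  qed
  also have "\<dots> = 0" unfolding sum.distrib using ab'(2) n_pos by (simp add: sum.delta)
  finally have "?X \<in> lie" by (intro sl X)
  from lie_tangent[OF this p g] have "dirderiv p g (g * ?X) = 0" .
  also have "g * ?X = g * adj_mat g * v" using c v by (intro assoc_mult_mat[symmetric]) auto
  also have "\<dots> = v" using c v by simp
  finally show ?thesis unfolding v_def .
qed

lemma polyfun_ev: "polyfun n (yeval n d c)"
  unfolding yeval_def ymono_def
  by (intro polyfun_sum polyfun_mult polyfun_const polyfun_prod polyfun_power polyfun_ix yix_ix)

lemma cofactor_one: "cofactor (1\<^sub>m n) 0 0 = (1 :: 'a)"
proof -
  have "adj_mat (1\<^sub>m n) $$ (0, 0) = cofactor (1\<^sub>m n :: 'a mat) 0 0" using n_pos by (simp add: adj_mat_def)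
  moreover have "adj_mat (1\<^sub>m n) = (1\<^sub>m n :: 'a mat)" using adj_inv[OF one] by simp
  ultimately show ?thesis using n_pos by simp
qed

lemma ev_derivative_vanishes:
  assumes sl: "\<And>X. X \<in> carrier_mat n n \<Longrightarrow> (\<Sum>i<n. X $$ (i, i)) = 0 \<Longrightarrow> X \<in> lie"
    and ev0: "\<And>g. g \<in> G \<Longrightarrow> cofactor g 0 0 \<noteq> 0 \<Longrightarrow> yeval n (Suc d) c g = 0"
    and g: "g \<in> G" and N: "cofactor g 0 0 \<noteq> 0" and s: "s \<in> yix n"
  shows "yeval n d (\<lambda>\<beta>. of_nat (Suc (\<beta> s)) * c (\<beta>(s := Suc (\<beta> s)))) g = 0"
proof -
  obtain a b where ab: "s = (a, b)" by force
  let ?p = "\<lambda>x. cofactor x 0 0 * yeval n (Suc d) c x"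
  have p: "vanishing ?p"
    unfolding vanishing_def using ev0 n_pos by (intro conjI polyfun_mult polyfun_cofactor polyfun_ev) auto
  define v where "v = mat n n (\<lambda>s. if s = (a, b) then 1
    else if s = (0, 0) then - cofactor g a b / cofactor g 0 0 else 0 :: 'a)"
  have v: "v \<in> carrier_mat n n" by (simp add: v_def)
  have D0: "dirderiv ?p g v = 0"
    unfolding v_def by (rule tangent_vector_derivative[OF sl p g N]) (use s ab in auto)
  obtain Q where Q: "\<And>t. poly Q t = cofactor (g + t \<cdot>\<^sub>m v) 0 0"
    using polyfun_line[OF polyfun_cofactor[of 0 n 0] Gc[OF g] v] n_pos by blast
  define R where "R = (\<lambda>\<alpha>. \<Prod>r\<in>yix n - {s}. g $$ r ^ \<alpha> r)"
  define E where "E = (\<Sum>\<alpha>\<in>exponents n (Suc d). Polynomial.smult (c \<alpha> * R \<alpha>) ([:g $$ s, 1:] ^ \<alpha> s))"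
  have E: "poly E t = yeval n (Suc d) c (g + t \<cdot>\<^sub>m v)" for t
  proof -
    have gs: "(g + t \<cdot>\<^sub>m v) $$ s = g $$ s + t"
      using s Gc[OF g] unfolding ab by (auto simp: v_def yix_def)
    have gr: "(g + t \<cdot>\<^sub>m v) $$ r = g $$ r" if "r \<in> yix n - {s}" for r
      using that Gc[OF g] unfolding ab by (auto simp: v_def yix_def split: if_splits)
    have "ymono n \<alpha> (g + t \<cdot>\<^sub>m v) = (g $$ s + t) ^ \<alpha> s * R \<alpha>" for \<alpha>
      unfolding ymono_split[OF s] gs R_def by (intro arg_cong2[of _ _ _ _ "(*)"] refl prod.cong) (simp only: gr)
    then show ?thesis
      unfolding E_def yeval_def by (simp add: poly_sum mult_ac add.commute)
  qed
  have g0: "g + 0 \<cdot>\<^sub>m v = g" using Gc[OF g] v by (intro eq_matI) auto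
  have "0 = coeff (Q * E) 1"
    using dirderiv_eqI[OF inf, of "Q * E" ?p g v] D0 Q E by simp
  also have "\<dots> = coeff Q 0 * coeff E 1 + coeff Q 1 * coeff E 0"
    by (simp add: coeff_mult)
  also have "coeff E 0 = 0" using E[of 0] ev0[OF g N] unfolding g0 by (simp add: poly_0_coeff_0)
  also have "coeff Q 0 = cofactor g 0 0" using Q[of 0] unfolding g0 by (simp add: poly_0_coeff_0)
  finally have "coeff E 1 = 0" using N by simp
  moreover have "coeff E 1 = (\<Sum>\<alpha>\<in>exponents n (Suc d). c \<alpha> * (of_nat (\<alpha> s) * g $$ s ^ (\<alpha> s - 1) * R \<alpha>))"
    unfolding E_def coeff_sum coeff_smult coeff_one_linear_power by (rule sum.cong) (auto simp: mult_ac)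
  ultimately show ?thesis
    using ev_derivative[OF s, where d = d and c = c and x = g] unfolding R_def by simp
qed

text \<open>The ideal of polynomials in the coordinates vanishing on \<open>G\<close> is stable under all partial
  derivatives and, being radical, under \<open>p\<close>-th roots in characteristic \<open>p\<close>; hence it contains no
  nonzero polynomial of least degree.\<close>

lemma ev_vanishing_imp_zero:
  assumes sl: "\<And>X. X \<in> carrier_mat n n \<Longrightarrow> (\<Sum>i<n. X $$ (i, i)) = 0 \<Longrightarrow> X \<in> lie"
    and ev0: "\<And>g. g \<in> G \<Longrightarrow> cofactor g 0 0 \<noteq> 0 \<Longrightarrow> yeval n d c g = 0"
    and \<alpha>: "\<alpha> \<in> exponents n d"
  shows "c \<alpha> = 0"
  using ev0 \<alpha>
proof (induction d arbitrary: c \<alpha> rule: less_induct)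
  case (less d)
  have mono0: "ymono n (\<lambda>_. 0) x = 1" for x :: "'a mat" by (simp add: ymono_def)
  show ?case
  proof (cases d)
    case 0
    have "yeval n 0 c (1\<^sub>m n) = 0" using less.prems(1)[OF one] cofactor_one 0 by simp
    then show ?thesis using less.prems(2) 0 by (simp add: yeval_def exponents_zero mono0)
  next
    case (Suc d')
    have der: "of_nat (\<alpha> s) * c \<alpha> = 0" if \<alpha>: "\<alpha> \<in> exponents n d" for \<alpha> s
    proof (cases "\<alpha> s = 0")
      case False
      then have s: "s \<in> yix n" using exponents_off[OF \<alpha>] by metis
      let ?c = "\<lambda>\<beta>. of_nat (Suc (\<beta> s)) * c (\<beta>(s := Suc (\<beta> s)))"
      let ?\<beta> = "\<alpha>(s := \<alpha> s - 1)"
      have "?\<beta> \<in> exponents n d'"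
      proof -
        have "(\<Sum>r\<in>yix n. \<alpha> r) = \<alpha> s + (\<Sum>r\<in>yix n - {s}. \<alpha> r)"
          "(\<Sum>r\<in>yix n. ?\<beta> r) = \<alpha> s - 1 + (\<Sum>r\<in>yix n - {s}. \<alpha> r)"
          using s finite_yix by (simp_all add: sum.remove[of _ s])
        then show ?thesis using \<alpha> False s unfolding exponents_def Suc by auto
      qed
      moreover have "yeval n d' ?c g = 0" if "g \<in> G" "cofactor g 0 0 \<noteq> 0" for g
        by (rule ev_derivative_vanishes[OF sl less.prems(1)[unfolded Suc] that s])
      ultimately have "?c ?\<beta> = 0" using less.IH[of d' ?c ?\<beta>] Suc by blast
      moreover have "?\<beta>(s := Suc (?\<beta> s)) = \<alpha>" "Suc (?\<beta> s) = \<alpha> s" using False by auto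
      ultimately show ?thesis by simp
    qed simp
    show ?thesis
    proof (cases "CHAR('a) = 0")
      case True
      have nz: "c \<beta> = 0" if "\<beta> \<in> exponents n d" "\<beta> \<noteq> (\<lambda>_. 0)" for \<beta>
      proof -
        obtain s where "\<beta> s \<noteq> 0" using \<open>\<beta> \<noteq> (\<lambda>_. 0)\<close> ext[of \<beta> "\<lambda>_. 0"] by metis
        then have "of_nat (\<beta> s) \<noteq> (0 :: 'a)" using True by (simp add: of_nat_eq_0_iff_char_dvd)
        then show ?thesis using der[OF that(1), of s] by simp
      qed
      have z: "(\<lambda>_. 0) \<in> exponents n d" by (simp add: exponents_def)
      have "0 = yeval n d c (1\<^sub>m n)" using less.prems(1)[OF one] cofactor_one by simp
      also have "\<dots> = (\<Sum>\<beta>\<in>exponents n d. if \<beta> = (\<lambda>_. 0) then c \<beta> else 0)"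
        unfolding yeval_def by (rule sum.cong) (use nz mono0 in auto)
      also have "\<dots> = c (\<lambda>_. 0)" using z finite_exponents by simp
      finally show ?thesis using nz[OF less.prems(2)] by (cases "\<alpha> = (\<lambda>_. 0)") auto
    next
      case False
      define p where "p = CHAR('a)"
      have p: "prime p" "CHAR('a) = p" using prime_CHAR_semidom False by (auto simp: p_def)
      have p2: "p \<ge> 2" using p(1) prime_ge_2_nat by blast
      have dvd: "p dvd \<beta> s" if "\<beta> \<in> exponents n d" "c \<beta> \<noteq> 0" for \<beta> s
        using der[OF that(1), of s] that(2) p(2) by (simp add: of_nat_eq_0_iff_char_dvd)
      have "\<exists>r. r ^ p = z" for z :: 'a
      proof -
        have "degree (monom 1 p + [:- z:]) > 0"
          using p2 by (subst degree_add_eq_left) (auto simp: degree_monom_eq)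
        then obtain r where "poly (monom 1 p + [:- z:]) r = 0" using ac unfolding alg_closed_def by blast
        then show ?thesis by (auto simp: poly_monom)
      qed
      then have "\<forall>\<beta>. \<exists>r. r ^ p = c (\<lambda>s. p * \<beta> s)" by blast
      from choice[OF this] obtain c' where c': "\<And>\<beta>. c' \<beta> ^ p = c (\<lambda>s. p * \<beta> s)" by auto
      let ?d = "d div p"
      have lt: "?d < d" using Suc p2 by simp
      have mem: "(\<lambda>s. p * \<beta> s) \<in> exponents n d \<longleftrightarrow> \<beta> \<in> exponents n ?d" for \<beta>
        using p2 by (auto simp: exponents_def sum_distrib_left[symmetric] less_eq_div_iff_mult_less_eq mult.commute)
      have "yeval n ?d c' g = 0" if g: "g \<in> G" "cofactor g 0 0 \<noteq> 0" for g
      proof -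
        have "yeval n ?d c' g ^ p = (\<Sum>\<beta>\<in>exponents n ?d. c (\<lambda>s. p * \<beta> s) * ymono n (\<lambda>s. p * \<beta> s) g)"
          unfolding yeval_def sum_power_char[OF p] power_mult_distrib c' ymono_def prod_power_distrib
          by (simp add: power_mult[symmetric] mult.commute[of _ p])
        also have "\<dots> = (\<Sum>\<beta>\<in>{\<beta>\<in>exponents n d. \<forall>s. p dvd \<beta> s}. c \<beta> * ymono n \<beta> g)"
        proof (rule sum.reindex_bij_witness[of _ "\<lambda>\<beta> s. \<beta> s div p" "\<lambda>\<beta> s. p * \<beta> s"])
          fix \<beta> assume b: "\<beta> \<in> exponents n ?d"
          show "(\<lambda>s. p * \<beta> s div p) = \<beta>" using p2 by (intro ext) simp
          show "(\<lambda>s. p * \<beta> s) \<in> {\<beta>\<in>exponents n d. \<forall>s. p dvd \<beta> s}" using b mem[of \<beta>] by simp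
          show "c (\<lambda>s. p * \<beta> s) * ymono n (\<lambda>s. p * \<beta> s) g = c (\<lambda>s. p * \<beta> s) * ymono n (\<lambda>s. p * \<beta> s) g" ..
        next
          fix \<beta> assume b: "\<beta> \<in> {\<beta>\<in>exponents n d. \<forall>s. p dvd \<beta> s}"
          then have "p dvd \<beta> s" for s by blast
          then show eq: "(\<lambda>s. p * (\<beta> s div p)) = \<beta>" by (intro ext dvd_mult_div_cancel)
          show "(\<lambda>s. \<beta> s div p) \<in> exponents n ?d" using mem[of "\<lambda>s. \<beta> s div p"] b unfolding eq by simp
        qed
        also have "\<dots> = yeval n d c g"
          unfolding yeval_def
          by (rule sum.mono_neutral_left[OF finite_exponents]) (use dvd in blast, use dvd mult_eq_0_iff in blast)
        also have "\<dots> = 0" by (rule less.prems(1)[OF g])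
        finally show ?thesis using p2 by simp
      qed
      then have c'0: "c' \<beta> = 0" if "\<beta> \<in> exponents n ?d" for \<beta>
        using less.IH[OF lt, of c' \<beta>] that by blast
      show ?thesis
      proof (rule ccontr)
        assume "c \<alpha> \<noteq> 0"
        then have eq: "(\<lambda>s. p * (\<alpha> s div p)) = \<alpha>" by (intro ext dvd_mult_div_cancel dvd[OF less.prems(2)])
        then have "(\<lambda>s. \<alpha> s div p) \<in> exponents n ?d" using mem[of "\<lambda>s. \<alpha> s div p"] less.prems(2) by simp
        from c'0[OF this] c'[of "\<lambda>s. \<alpha> s div p"] have "c \<alpha> = 0" unfolding eq using p2 by (simp add: power_0_left)
        then show False using \<open>c \<alpha> \<noteq> 0\<close> by simp
      qed
    qed
  qed
qed

text \<open>On the special linear group the upper left entry is a rational function of the other entries,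
  by expansion of the determinant along the first row.\<close>

lemma clear_denominators:
  assumes "polyfun n q"
  shows "\<exists>m f. ypoly n f \<and> (\<forall>x\<in>SL_set n. cofactor x 0 0 ^ m * q x = (f x :: 'a))"
proof -
  obtain r where r: "r \<in> mat_poly_fun n" "\<And>A. A \<in> carrier_mat n n \<Longrightarrow> q A = r A"
    using assms unfolding polyfun_def by blast
  note yN = ypoly_power[OF ypoly_cofactor[OF n_pos n_pos]]
  from r(1) have "\<exists>m f. ypoly n f \<and> (\<forall>x\<in>SL_set n. cofactor x 0 0 ^ m * r x = f x)"
  proof induction
    case (const c)
    show ?case by (intro exI[of _ 0] exI[of _ "\<lambda>_. c"]) (simp add: ypoly_const)
  next
    case (entry i j)
    show ?case
    proof (cases "(i, j) = (0, 0)")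
      case False
      then have "(i, j) \<in> yix n" using entry by (simp add: yix_def)
      then show ?thesis by (intro exI[of _ 0] exI[of _ "\<lambda>x. x $$ (i, j)"]) (simp add: ypoly_entry)
    next
      case True
      let ?f = "\<lambda>x. 1 + - (\<Sum>j\<in>{1..<n}. x $$ (0, j) * cofactor x 0 j :: 'a)"
      show ?thesis
      proof (intro exI[of _ 1] exI[of _ ?f] conjI ballI)
        show "ypoly n ?f"
          by (intro ypoly_add ypoly_const ypoly_uminus ypoly_sum ypoly_mult ypoly_entry ypoly_cofactor)
            (use n_pos in \<open>auto simp: yix_def\<close>)
        fix x :: "'a mat" assume "x \<in> SL_set n"
        then have x: "x \<in> carrier_mat n n" "det x = 1" by (auto simp: SL_set_def)
        have "{..<n} = insert 0 {1..<n}" using n_pos by auto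
        then have "1 = x $$ (0, 0) * cofactor x 0 0 + (\<Sum>j\<in>{1..<n}. x $$ (0, j) * cofactor x 0 j)"
          using laplace_expansion_row[OF x(1) n_pos] x(2) by simp
        then show "cofactor x 0 0 ^ 1 * x $$ (i, j) = ?f x" using True by (simp add: algebra_simps)
      qed
    qed
  next
    case (add p q)
    then obtain m1 f1 m2 f2 where f: "ypoly n f1" "ypoly n f2"
      "\<And>x. x \<in> SL_set n \<Longrightarrow> cofactor x 0 0 ^ m1 * p x = f1 x"
      "\<And>x. x \<in> SL_set n \<Longrightarrow> cofactor x 0 0 ^ m2 * q x = f2 x" by blast
    show ?case
    proof (intro exI[of _ "m1 + m2"] exI[of _ "\<lambda>x. cofactor x 0 0 ^ m2 * f1 x + cofactor x 0 0 ^ m1 * f2 x"] conjI ballI)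
      show "ypoly n (\<lambda>x. cofactor x 0 0 ^ m2 * f1 x + cofactor x 0 0 ^ m1 * f2 x)"
        by (intro ypoly_add ypoly_mult yN f)
      show "cofactor x 0 0 ^ (m1 + m2) * (p x + q x) = cofactor x 0 0 ^ m2 * f1 x + cofactor x 0 0 ^ m1 * f2 x"
        if "x \<in> SL_set n" for x
        unfolding f(3)[OF that, symmetric] f(4)[OF that, symmetric] by (simp add: power_add algebra_simps)
    qed
  next
    case (mult p q)
    then obtain m1 f1 m2 f2 where f: "ypoly n f1" "ypoly n f2"
      "\<And>x. x \<in> SL_set n \<Longrightarrow> cofactor x 0 0 ^ m1 * p x = f1 x"
      "\<And>x. x \<in> SL_set n \<Longrightarrow> cofactor x 0 0 ^ m2 * q x = f2 x" by blast
    show ?case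
    proof (intro exI[of _ "m1 + m2"] exI[of _ "\<lambda>x. f1 x * f2 x"] conjI ballI)
      show "ypoly n (\<lambda>x. f1 x * f2 x)" by (intro ypoly_mult f)
      show "cofactor x 0 0 ^ (m1 + m2) * (p x * q x) = f1 x * f2 x" if "x \<in> SL_set n" for x
        unfolding f(3)[OF that, symmetric] f(4)[OF that, symmetric] by (simp add: power_add algebra_simps)
    qed
  qed
  then obtain m f where mf: "ypoly n f" "\<And>x. x \<in> SL_set n \<Longrightarrow> cofactor x 0 0 ^ m * r x = f x" by blast
  have "cofactor x 0 0 ^ m * q x = f x" if "x \<in> SL_set n" for x
    using mf(2)[OF that] r(2)[of x] that by (simp add: SL_set_def)
  then show ?thesis using mf(1) by blast
qed

lemma big_cell_subset:
  assumes sl: "\<And>X. X \<in> carrier_mat n n \<Longrightarrow> (\<Sum>i<n. X $$ (i, i)) = 0 \<Longrightarrow> X \<in> lie"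
    and x: "x \<in> SL_set n" "cofactor x 0 0 \<noteq> 0"
  shows "x \<in> G"
proof (rule closed)
  show xc: "x \<in> carrier_mat n n" using x by (simp add: SL_set_def)
  fix q assume q: "polyfun n q" "\<And>g. g \<in> G \<Longrightarrow> q g = 0"
  obtain m f where f: "ypoly n f" "\<And>x. x \<in> SL_set n \<Longrightarrow> cofactor x 0 0 ^ m * q x = f x"
    using clear_denominators[OF q(1)] by blast
  obtain d c where dc: "\<And>x. x \<in> carrier_mat n n \<Longrightarrow> f x = yeval n d c x" using ypoly_ev[OF f(1)] by blast
  have "yeval n d c g = 0" if g: "g \<in> G" for g
    using f(2)[of g] dc[OF Gc[OF g]] q(2)[OF g] SL g by auto
  then have "c \<alpha> = 0" if "\<alpha> \<in> exponents n d" for \<alpha>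
    using ev_vanishing_imp_zero[OF sl, of d c \<alpha>] that by blast
  then have "yeval n d c x = 0" by (simp add: yeval_def)
  then show "q x = 0" using f(2)[OF x(1)] dc[OF xc] x(2) by simp
qed

lemma eq_SL_if_lie_contains_sl:
  assumes sl: "\<And>X. X \<in> carrier_mat n n \<Longrightarrow> (\<Sum>i<n. X $$ (i, i)) = 0 \<Longrightarrow> X \<in> lie"
  shows "G = SL_set n"
proof (rule equalityI[OF SL subsetI])
  fix x :: "'a mat" assume x: "x \<in> SL_set n"
  note c = adj_mat_SL[OF x]
  have xc: "x \<in> carrier_mat n n" using x by (simp add: SL_set_def)
  have cof: "adj_mat z $$ (0, 0) = cofactor z 0 0" if "z \<in> carrier_mat n n" for z :: "'a mat"
    using that n_pos by (simp add: adj_mat_def)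
  show "x \<in> G"
  proof (cases "cofactor x 0 0 = 0")
    case False
    then show ?thesis using big_cell_subset[OF sl x] by blast
  next
    case True
    then have x00: "adj_mat x $$ (0, 0) = 0" using cof[OF xc] by simp
    obtain j where j: "j < n" "adj_mat x $$ (0, j) \<noteq> 0"
    proof (rule ccontr)
      assume "\<not> thesis"
      then have 0: "adj_mat x $$ (0, j) = 0" if "j < n" for j using that \<open>\<And>j. j < n \<Longrightarrow> adj_mat x $$ (0, j) \<noteq> 0 \<Longrightarrow> thesis\<close> by blast
      have "(adj_mat x * x) $$ (0, 0) = (\<Sum>j\<in>{0..<n}. adj_mat x $$ (0, j) * x $$ (j, 0))"
        using c(3) xc n_pos by (simp add: scalar_prod_def)
      then show False unfolding c(2) using 0 n_pos by simp
    qed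
    then have j0: "j \<noteq> 0" using x00 by metis
    let ?y = "1\<^sub>m n + 1 \<cdot>\<^sub>m emat n j 0 :: 'a mat"
    have y: "?y \<in> SL_set n" using elementary_mat(1)[OF j(1) n_pos j0, of 1] by (simp add: SL_set_def)
    have yc: "?y \<in> carrier_mat n n" by auto
    have ayc: "adj_mat ?y = 1\<^sub>m n + (- 1) \<cdot>\<^sub>m emat n j 0" by (rule elementary_mat(2)[OF j(1) n_pos j0])
    have "cofactor ?y 0 0 = 1"
      using cof[OF yc] unfolding ayc using n_pos j0 by (simp add: emat_index)
    then have yG: "?y \<in> G" by (intro big_cell_subset[OF sl y]) auto
    note cy = adj_mat_SL[OF y]
    let ?z = "adj_mat ?y * x"
    have zc: "?z \<in> carrier_mat n n" using cy xc by auto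
    have "det (adj_mat ?y) = 1" using det1[OF adj[OF yG]] .
    then have detz: "det ?z = 1" using det_mult[OF cy(3) xc] x by (simp add: SL_set_def)
    have "adj_mat ?z = adj_mat x * ?y"
    proof (rule adj_mat_eqI[OF zc _ detz])
      have "?z * (adj_mat x * ?y) = adj_mat ?y * (x * (adj_mat x * ?y))"
        using cy c xc yc by (intro assoc_mult_mat) auto
      also have "x * (adj_mat x * ?y) = x * adj_mat x * ?y"
        using c xc yc by (intro assoc_mult_mat[symmetric]) auto
      finally show "?z * (adj_mat x * ?y) = 1\<^sub>m n" using c(1) cy(2) yc by simp
    qed (use c yc in auto)
    moreover have "(adj_mat x * ?y) $$ (0, 0) = adj_mat x $$ (0, j)"
    proof -
      have "adj_mat x * ?y = adj_mat x * 1\<^sub>m n + adj_mat x * (1 \<cdot>\<^sub>m emat n j 0)"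
        using c by (intro mult_add_distrib_mat) auto
      also have "\<dots> = adj_mat x + 1 \<cdot>\<^sub>m (adj_mat x * emat n j 0)"
        using c(3) by (simp add: mult_smult_distrib[OF c(3) emat_carrier])
      finally show ?thesis
        using add_smult_index[OF c(3) mult_carrier_mat[OF c(3) emat_carrier] n_pos n_pos, of 1 j 0]
          emat_mult_right[OF c(3) n_pos n_pos j(1), of 0] x00 by simp
    qed
    ultimately have "cofactor ?z 0 0 \<noteq> 0" using cof[OF zc] j(2) by simp
    then have "?z \<in> G" using zc detz by (intro big_cell_subset[OF sl]) (auto simp: SL_set_def)
    then have "?y * ?z \<in> G" by (rule mul[OF yG])
    also have "?y * ?z = ?y * adj_mat ?y * x" using cy yc xc by (intro assoc_mult_mat[symmetric]) auto
    also have "\<dots> = x" using cy(1) xc by simp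
    finally show ?thesis .
  qed
qed

end

section \<open>Reduction to a diagonal element\<close>

lemma alg_closed_splits:
  assumes ac: "alg_closed TYPE('a::field)"
  shows "degree (p :: 'a poly) = n \<Longrightarrow> lead_coeff p = 1 \<Longrightarrow> \<exists>a. p = (\<Prod>i<n. [:- a i, 1:])"
proof (induction n arbitrary: p)
  case 0
  then obtain c where "p = [:c:]" by (auto elim: degree_eq_zeroE)
  then show ?case using 0 by (simp add: one_pCons)
next
  case (Suc n)
  then obtain r where "poly p r = 0" using ac unfolding alg_closed_def by (metis zero_less_Suc)
  then obtain q where q: "p = [:- r, 1:] * q" by (auto simp: poly_eq_0_iff_dvd)
  have q0: "q \<noteq> 0" using q Suc.prems by auto
  have "degree p = Suc (degree q)" unfolding q using q0 by (subst degree_mult_eq) auto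
  moreover have "lead_coeff p = lead_coeff q" unfolding q by (simp add: lead_coeff_mult del: mult_pCons_left)
  ultimately obtain a where a: "q = (\<Prod>i<n. [:- a i, 1:])" 
    using Suc.IH[of q] Suc.prems by auto
  have "p = (\<Prod>i<Suc n. [:- (a(n := r)) i, 1:])"
    unfolding q a by (simp add: mult.commute del: mult_pCons_left mult_pCons_right)
  then show ?case by blast
qed

lemma f_mor_eigenvalues:
  assumes ac: "alg_closed TYPE('a::field)" and A: "(A :: 'a mat) \<in> carrier_mat n n"
  shows "\<exists>a. char_poly A = (\<Prod>i<n. [:- a i, 1:]) \<and> f_mor n A = f_expr n a"
proof -
  obtain a where "char_poly A = (\<Prod>i<n. [:- a i, 1:])"
    using alg_closed_splits[OF ac, of "char_poly A" n] degree_monic_char_poly[OF A] by auto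
  then have "\<exists>v. \<exists>a. char_poly A = (\<Prod>i<n. [:- a i, 1:]) \<and> v = f_expr n a" by blast
  from someI_ex[OF this] show ?thesis unfolding f_mor_def .
qed

lemma dtuples_list:
  assumes "distinct xs" "set xs \<subseteq> {..<n}" "length xs = k"
  shows "restrict ((!) xs) {..<k} \<in> dtuples k n"
proof -
  have "inj_on ((!) xs) {..<k}" using assms by (intro inj_on_nth) auto
  moreover have "xs ! i < n" if "i < k" for i
    using assms(2,3) that by (metis lessThan_iff nth_mem subsetD)
  ultimately show ?thesis unfolding dtuples_def by (auto simp: inj_on_restrict_eq)
qed

lemma finite_dtuples: "finite (dtuples k n)"
  unfolding dtuples_def
  by (rule finite_subset[of _ "{..<k} \<rightarrow>\<^sub>E {..<n}"]) (auto intro: finite_PiE)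

lemma f_expr_nonzero:
  assumes "f_expr n a \<noteq> (0 :: 'a::field)"
  shows "i < n \<Longrightarrow> j < n \<Longrightarrow> i \<noteq> j \<Longrightarrow> a i \<noteq> a j"
    and "i < n \<Longrightarrow> j < n \<Longrightarrow> l < n \<Longrightarrow> distinct [i, j, l] \<Longrightarrow> a i * a j \<noteq> a l * a l"
    and "i < n \<Longrightarrow> j < n \<Longrightarrow> l < n \<Longrightarrow> m < n \<Longrightarrow> distinct [i, j, l, m] \<Longrightarrow> a i * a j \<noteq> a l * a m"
proof -
  have p: "\<forall>t\<in>dtuples 2 n. a (t 0) - a (t 1) \<noteq> 0"
    "\<forall>t\<in>dtuples 3 n. a (t 0) * a (t 1) - a (t 2) ^ 2 \<noteq> 0"
    "\<forall>t\<in>dtuples 4 n. a (t 0) * a (t 1) - a (t 2) * a (t 3) \<noteq> 0"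
    using assms finite_dtuples unfolding f_expr_def by (auto simp: prod_zero_iff)
  show "a i \<noteq> a j" if "i < n" "j < n" "i \<noteq> j"
    using bspec[OF p(1) dtuples_list[of "[i, j]"]] that by (simp add: numeral_eq_Suc)
  show "a i * a j \<noteq> a l * a l" if "i < n" "j < n" "l < n" "distinct [i, j, l]"
    using bspec[OF p(2) dtuples_list[of "[i, j, l]"]] that by (simp add: numeral_eq_Suc)
  show "a i * a j \<noteq> a l * a m" if "i < n" "j < n" "l < n" "m < n" "distinct [i, j, l, m]"
    using bspec[OF p(3) dtuples_list[of "[i, j, l, m]"]] that by (simp add: numeral_eq_Suc)
qed

definition separated :: "nat \<Rightarrow> (nat \<Rightarrow> 'a::field) \<Rightarrow> nat \<Rightarrow> bool" where
  "separated n a k \<longleftrightarrow> k < n \<and> (\<forall>i<n. \<forall>j<n. \<forall>l<n. l \<noteq> k \<longrightarrow> a i * a l = a k * a j \<longrightarrow> i = k \<and> j = l)"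

text \<open>The relations excluded by \<open>f\<close> still allow \<open>a i = - a j\<close>, but for at most one pair of indices;
  any index outside that pair is separated.\<close>

lemma separated_exists:
  fixes a :: "nat \<Rightarrow> 'a::field"
  assumes n: "n \<ge> 3" and nz: "\<And>i. i < n \<Longrightarrow> a i \<noteq> 0"
    and d1: "\<And>i j. i < n \<Longrightarrow> j < n \<Longrightarrow> i \<noteq> j \<Longrightarrow> a i \<noteq> a j"
    and d3: "\<And>i j l. i < n \<Longrightarrow> j < n \<Longrightarrow> l < n \<Longrightarrow> distinct [i, j, l] \<Longrightarrow> a i * a j \<noteq> a l * a l"
    and d4: "\<And>i j l m. i < n \<Longrightarrow> j < n \<Longrightarrow> l < n \<Longrightarrow> m < n \<Longrightarrow> distinct [i, j, l, m] \<Longrightarrow> a i * a j \<noteq> a l * a m"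
  shows "\<exists>k. separated n a k"
proof -
  have opp: "a j = - a i" if "a i * a i = a j * a j" "i < n" "j < n" "i \<noteq> j" for i j
  proof -
    have "(a j - a i) * (a j + a i) = 0" using that(1) by (simp add: algebra_simps)
    then show ?thesis using d1[OF that(2-4)] by (auto simp: eq_neg_iff_add_eq_0)
  qed
  have "\<exists>k<n. \<forall>l<n. l \<noteq> k \<longrightarrow> a k * a k \<noteq> a l * a l"
  proof (rule ccontr)
    assume "\<not> ?thesis"
    then have bad: "\<exists>l<n. l \<noteq> k \<and> a k * a k = a l * a l" if "k < n" for k using that by blast
    obtain l where l: "l < n" "l \<noteq> 0" "a l = - a 0" using bad[of 0] opp[of 0] n by force
    obtain k where k: "k < n" "k \<noteq> 0" "k \<noteq> l"
    proof
      show "(if l = 1 then 2 else 1) < n" "(if l = 1 then 2 else 1) \<noteq> (0::nat)" "(if l = 1 then 2 else 1) \<noteq> l"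
        using n by auto
    qed
    obtain m where m: "m < n" "m \<noteq> k" "a m = - a k" using bad[OF k(1)] opp[of k] k(1) by force
    have "m \<noteq> 0"
    proof
      assume "m = 0"
      then have "a l = a k" using m(3) l(3) by simp
      then show False using d1[OF l(1) k(1)] k(3) by simp
    qed
    moreover have "m \<noteq> l"
    proof
      assume "m = l"
      then have "a 0 = a k" using m(3) l(3) by simp
      then show False using d1[of 0 k] k n by simp
    qed
    ultimately have "a 0 * a m \<noteq> a l * a k" using d4[of 0 m l k] k l m n by auto
    then show False using l m by simp
  qed
  then obtain k where k: "k < n" "\<And>l. l < n \<Longrightarrow> l \<noteq> k \<Longrightarrow> a k * a k \<noteq> a l * a l" by blast
  have "i = k \<and> j = l" if ijl: "i < n" "j < n" "l < n" "l \<noteq> k" "a i * a l = a k * a j" for i j l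
  proof -
    have "i = k"
    proof (rule ccontr)
      assume ik: "i \<noteq> k"
      have ij: "i \<noteq> j" using ijl nz[OF ijl(1)] d1[OF ijl(3) k(1) ijl(4)] by (auto simp: mult.commute)
      have jl: "j \<noteq> l" using ijl nz[OF ijl(3)] d1[OF ijl(1) k(1) ik] by auto
      show False
      proof (cases "i = l")
        case True
        then show False
          using ijl k(2)[OF ijl(3,4)] d3[OF k(1) ijl(2,3)] jl by (cases "j = k") (auto simp: mult.commute)
      next
        case False
        then show False
          using ijl d3[OF ijl(1,3) k(1)] d4[OF ijl(1,3) k(1) ijl(2)] ik ij jl
          by (cases "j = k") auto
      qed
    qed
    moreover from this have "j = l" using ijl(5) nz[OF k(1)] d1[OF ijl(3,2)] by auto
    ultimately show ?thesis by simp
  qed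
  then show ?thesis unfolding separated_def using k(1) by blast
qed

lemma char_poly_eval_det:
  fixes A :: "'a::field mat"
  assumes A: "A \<in> carrier_mat n n" and cp: "char_poly A = (\<Prod>i<n. [:- a i, 1:])"
  shows "(\<Prod>i<n. t - a i) = det (- (char_matrix A t))"
  using char_poly_matrix[OF A, of t] unfolding cp by (simp add: poly_prod)

lemma char_poly_det_zero:
  fixes A :: "'a::field mat"
  assumes A: "A \<in> carrier_mat n n" and cp: "char_poly A = (\<Prod>i<n. [:- a i, 1:])"
  shows "(\<Prod>i<n. a i) = det A"
proof -
  have "- (char_matrix A 0) = (-1) \<cdot>\<^sub>m A" using A by (intro eq_matI) (auto simp: char_matrix_def)
  then have "(\<Prod>i<n. - a i) = (-1) ^ n * det A" using char_poly_eval_det[OF A cp, of 0] A by simp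
  moreover have "(\<Prod>i<n. - a i) = (\<Prod>i<n. (-1) * a i)" by simp
  ultimately have "(-1) ^ n * (\<Prod>i<n. a i) = (-1) ^ n * det A"
    unfolding prod.distrib by simp
  then show ?thesis by simp
qed

lemma diagonalize:
  fixes A :: "'a::field mat"
  assumes A: "A \<in> carrier_mat n n" and cp: "char_poly A = (\<Prod>i<n. [:- a i, 1:])"
    and inj: "\<And>i j. i < n \<Longrightarrow> j < n \<Longrightarrow> i \<noteq> j \<Longrightarrow> a i \<noteq> a j"
  shows "\<exists>P Q. P \<in> carrier_mat n n \<and> Q \<in> carrier_mat n n \<and> P * Q = 1\<^sub>m n \<and> Q * P = 1\<^sub>m n \<and>
    (\<forall>i<n. \<forall>j<n. (Q * A * P) $$ (i, j) = (if i = j then a i else 0))"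
proof -
  have "\<exists>v. v \<in> carrier_vec n \<and> v \<noteq> 0\<^sub>v n \<and> A *\<^sub>v v = a i \<cdot>\<^sub>v v" if "i < n" for i
  proof -
    have "poly (char_poly A) (a i) = 0" unfolding cp poly_prod by (rule prod_zero) (use that in auto)
    then have "eigenvalue A (a i)" using eigenvalue_root_char_poly[OF A] by simp
    then show ?thesis using A unfolding eigenvalue_def eigenvector_def by auto
  qed
  then obtain v where v: "\<And>i. i < n \<Longrightarrow> v i \<in> carrier_vec n \<and> v i \<noteq> 0\<^sub>v n \<and> A *\<^sub>v v i = a i \<cdot>\<^sub>v v i"
    by metis
  have Av: "(\<Sum>r<n. A $$ (q, r) * v i $ r) = a i * v i $ q" if "i < n" "q < n" for i q
  proof -
    have "(A *\<^sub>v v i) $ q = (\<Sum>r<n. A $$ (q, r) * v i $ r)"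
      using A conjunct1[OF v[OF that(1)]] that by (auto simp: scalar_prod_def atLeast0LessThan)
    moreover have "(A *\<^sub>v v i) $ q = a i * v i $ q" using v[OF that(1)] that by auto
    ultimately show ?thesis by simp
  qed
  have indep: "\<forall>i\<in>S. z i = 0"
    if "finite S" "S \<subseteq> {..<n}" "\<And>r. r < n \<Longrightarrow> (\<Sum>i\<in>S. z i * v i $ r) = 0" for S z
    using that
  proof (induction S arbitrary: z rule: finite_induct)
    case (insert s S)
    have s: "s < n" using insert.prems by auto
    have "\<forall>i\<in>S. z i * (a i - a s) = 0"
    proof (rule insert.IH)
      fix q assume q: "q < n"
      have "(\<Sum>r<n. A $$ (q, r) * (\<Sum>i\<in>insert s S. z i * v i $ r)) = 0"
        by (rule sum.neutral) (use insert.prems(2) in simp)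
      also have "(\<Sum>r<n. A $$ (q, r) * (\<Sum>i\<in>insert s S. z i * v i $ r))
        = (\<Sum>i\<in>insert s S. z i * (\<Sum>r<n. A $$ (q, r) * v i $ r))"
        unfolding sum_distrib_left by (subst sum.swap) (simp add: mult.left_commute)
      also have "\<dots> = (\<Sum>i\<in>insert s S. z i * (a i * v i $ q))"
        by (rule sum.cong) (use Av q insert.prems(1) in auto)
      finally have 1: "(\<Sum>i\<in>insert s S. z i * (a i * v i $ q)) = 0" .
      have 2: "a s * (\<Sum>i\<in>insert s S. z i * v i $ q) = 0" using insert.prems(2)[OF q] by simp
      have "(\<Sum>i\<in>S. z i * (a i - a s) * v i $ q)
        = (\<Sum>i\<in>insert s S. z i * (a i - a s) * v i $ q)" using insert.hyps by simp
      also have "\<dots> = (\<Sum>i\<in>insert s S. z i * (a i * v i $ q)) - a s * (\<Sum>i\<in>insert s S. z i * v i $ q)"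
        unfolding sum_distrib_left sum_subtractf[symmetric] by (rule sum.cong) (auto simp: algebra_simps)
      finally show "(\<Sum>i\<in>S. z i * (a i - a s) * v i $ q) = 0" using 1 2 by simp
    qed (use insert.prems in auto)
    then have zS: "\<forall>i\<in>S. z i = 0" using inj insert.hyps insert.prems(1) by fastforce
    have "z s * v s $ r = 0" if r: "r < n" for r
      using insert.prems(2)[OF r] zS insert.hyps by (simp add: sum.neutral)
    moreover obtain r where "r < n" "v s $ r \<noteq> 0"
    proof (rule ccontr)
      assume "\<not> thesis"
      then have "v s = 0\<^sub>v n" using v[OF s] that by (intro eq_vecI) auto
      then show False using v[OF s] by simp
    qed
    ultimately show ?case using zS by auto
  qed simp
  define P where "P = mat n n (\<lambda>(r, i). v i $ r)"
  have P: "P \<in> carrier_mat n n" by (simp add: P_def)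
  have "det P \<noteq> 0"
  proof
    assume "det P = 0"
    then obtain z where z: "z \<in> carrier_vec n" "z \<noteq> 0\<^sub>v n" "P *\<^sub>v z = 0\<^sub>v n"
      using det_0_iff_vec_prod_zero_field[OF P] by blast
    have "(\<Sum>i<n. z $ i * v i $ r) = 0" if r: "r < n" for r
    proof -
      have "(P *\<^sub>v z) $ r = (\<Sum>i<n. v i $ r * z $ i)"
        using z(1) r by (auto simp: P_def scalar_prod_def atLeast0LessThan)
      then show ?thesis unfolding z(3) using r by (simp add: mult.commute)
    qed
    then have "\<forall>i\<in>{..<n}. z $ i = 0" by (intro indep) auto
    then have "z = 0\<^sub>v n" using z(1) by (intro eq_vecI) auto
    then show False using z(2) by simp
  qed
  define Q where "Q = inverse (det P) \<cdot>\<^sub>m adj_mat P"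
  have Q: "Q \<in> carrier_mat n n" using adj_mat[OF P] by (simp add: Q_def)
  have "P * Q = inverse (det P) \<cdot>\<^sub>m (P * adj_mat P)"
    unfolding Q_def using adj_mat[OF P] P by (intro mult_smult_distrib) auto
  then have PQ: "P * Q = 1\<^sub>m n"
    unfolding adj_mat(2)[OF P] using \<open>det P \<noteq> 0\<close> by (auto intro!: eq_matI)
  have "Q * P = inverse (det P) \<cdot>\<^sub>m (adj_mat P * P)"
    unfolding Q_def using adj_mat[OF P] P by (intro mult_smult_assoc_mat) auto
  then have QP: "Q * P = 1\<^sub>m n"
    unfolding adj_mat(3)[OF P] using \<open>det P \<noteq> 0\<close> by (auto intro!: eq_matI)
  define D where "D = mat n n (\<lambda>(i, j). if i = j then a i else 0)"
  have D: "D \<in> carrier_mat n n" by (simp add: D_def)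
  have "A * P = P * D"
  proof (rule eq_matI)
    fix q i assume "q < dim_row (P * D)" "i < dim_col (P * D)"
    then have qi: "q < n" "i < n" using P D by auto
    have "(A * P) $$ (q, i) = (\<Sum>r<n. A $$ (q, r) * v i $ r)"
      using A qi by (auto simp: P_def scalar_prod_def atLeast0LessThan)
    also have "\<dots> = a i * v i $ q" by (rule Av[OF qi(2,1)])
    also have "\<dots> = (\<Sum>r<n. if r = i then a i * v i $ q else 0)" using qi by simp
    also have "\<dots> = (\<Sum>r<n. P $$ (q, r) * D $$ (r, i))"
      by (rule sum.cong) (use qi in \<open>auto simp: P_def D_def\<close>)
    also have "\<dots> = (P * D) $$ (q, i)"
      using P D qi by (auto simp: scalar_prod_def atLeast0LessThan)
    finally show "(A * P) $$ (q, i) = (P * D) $$ (q, i)" .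
  qed (use A P D in auto)
  then have "Q * A * P = Q * (P * D)" using A P Q by (simp add: assoc_mult_mat[of _ n n _ n _ n])
  also have "\<dots> = Q * P * D" using P Q D by (intro assoc_mult_mat[symmetric]) auto
  also have "\<dots> = D" using QP D by simp
  finally have "(Q * A * P) $$ (i, j) = (if i = j then a i else 0)" if "i < n" "j < n" for i j
    using that by (simp add: D_def)
  then show ?thesis using P Q PQ QP by blast
qed

context irreducible_group
begin

lemma conjugate_group:
  assumes P: "P \<in> carrier_mat n n" and Q: "Q \<in> carrier_mat n n" and PQ: "P * Q = 1\<^sub>m n" "Q * P = 1\<^sub>m n"
  shows "irreducible_group n ((\<lambda>g. Q * g * P) ` G)"
proof -
  have cc: "Q * x * P \<in> carrier_mat n n" "P * x * Q \<in> carrier_mat n n" if "x \<in> carrier_mat n n" for x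
    using that P Q by auto
  have PQx: "P * (Q * x * P) * Q = x" "Q * (P * x * Q) * P = x" if x: "x \<in> carrier_mat n n" for x
  proof -
    have "P * (Q * x * P) * Q = P * Q * x * (P * Q)"
      using P Q x by (simp add: assoc_mult_mat[of _ n n _ n _ n])
    then show "P * (Q * x * P) * Q = x" using x PQ by simp
    have "Q * (P * x * Q) * P = Q * P * x * (Q * P)"
      using P Q x by (simp add: assoc_mult_mat[of _ n n _ n _ n])
    then show "Q * (P * x * Q) * P = x" using x PQ by simp
  qed
  have mult: "Q * x * P * (Q * y * P) = Q * (x * y) * P" if x: "x \<in> carrier_mat n n" and y: "y \<in> carrier_mat n n" for x y
  proof -
    have "Q * x * P * (Q * y * P) = Q * x * (P * Q) * y * P"
      using P Q x y by (simp add: assoc_mult_mat[of _ n n _ n _ n])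
    then show ?thesis using P Q x y unfolding PQ by (simp add: assoc_mult_mat[of _ n n _ n _ n])
  qed
  have "det P * det Q = 1" using det_mult[OF P Q] PQ(1) by simp
  then have dets: "det (Q * x * P) = det x" if "x \<in> carrier_mat n n" for x
    using that P Q by (simp add: det_mult[of _ n] mult_ac)
  have pfc: "polyfun n (\<lambda>x. p (Y * x * Z))" if "polyfun n p" "Y \<in> carrier_mat n n" "Z \<in> carrier_mat n n"
    for p :: "'a mat \<Rightarrow> 'a" and Y Z
  proof (rule polyfun_compose[OF that(1)])
    show "polyfun n (\<lambda>x. (Y * x * Z) $$ (i, j))" if ij: "i < n" "j < n" for i j
    proof (rule polyfun_mult_mat[where F = "\<lambda>x. Y * x" and H = "\<lambda>_. Z"])
      show "polyfun n (\<lambda>x. (Y * x) $$ (i, j))" if "i < n" "j < n" for i j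
        by (rule polyfun_mult_mat[where F = "\<lambda>_. Y" and H = "\<lambda>x. x"]) (use that \<open>Y \<in> carrier_mat n n\<close> in auto)
    qed (use that \<open>Y \<in> carrier_mat n n\<close> \<open>Z \<in> carrier_mat n n\<close> ij in auto)
  qed (use that in auto)
  let ?H = "(\<lambda>g. Q * g * P) ` G"
  show ?thesis
  proof
    show "n \<ge> 2" "alg_closed TYPE('a)" by (fact n2 ac)+
    show "?H \<subseteq> SL_set n"
      using cc dets Gc det1 by (auto simp: SL_set_def)
    show "1\<^sub>m n \<in> ?H"
      by (rule image_eqI[OF _ one]) (use P Q PQ in simp)
    show "g * h \<in> ?H" if "g \<in> ?H" "h \<in> ?H" for g h
      using that mult[OF Gc Gc] mul by auto
    show "adj_mat g \<in> ?H" if g: "g \<in> ?H" for g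
    proof -
      obtain h where h: "h \<in> G" "g = Q * h * P" using g by blast
      have "adj_mat g = Q * adj_mat h * P" unfolding h(2)
      proof (rule adj_mat_eqI)
        show "Q * h * P * (Q * adj_mat h * P) = 1\<^sub>m n"
          unfolding mult[OF Gc[OF h(1)] adj_inv(3)[OF h(1)]] adj_inv(1)[OF h(1)] using P Q PQ by simp
      qed (use cc dets Gc[OF h(1)] det1[OF h(1)] adj_inv(3)[OF h(1)] in auto)
      then show ?thesis using adj[OF h(1)] by blast
    qed
    show "A \<in> ?H"
      if A: "A \<in> carrier_mat n n"
        and v: "\<And>p. polyfun n p \<Longrightarrow> (\<And>g. g \<in> ?H \<Longrightarrow> p g = 0) \<Longrightarrow> p A = 0" for A
    proof -
      have "P * A * Q \<in> G"
      proof (rule closed[OF cc(2)[OF A]])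
        fix q assume q: "polyfun n q" "\<And>g. g \<in> G \<Longrightarrow> q g = 0"
        show "q (P * A * Q) = 0"
          by (rule v[OF pfc[OF q(1) P Q]]) (use q(2) PQx(1)[OF Gc] in auto)
      qed
      then show ?thesis using PQx(2)[OF A] by (metis image_eqI)
    qed
    show "(\<forall>g\<in>?H. p g = 0) \<or> (\<forall>g\<in>?H. q g = 0)"
      if "polyfun n p" "polyfun n q" "\<And>g. g \<in> ?H \<Longrightarrow> p g * q g = 0" for p q
      using dom[OF pfc[OF that(1) Q P] pfc[OF that(2) Q P]] that(3) by auto
    fix W assume W: "lin_subspace n W"
      and st: "\<And>g w. g \<in> ?H \<Longrightarrow> w \<in> W \<Longrightarrow> g *\<^sub>v w \<in> W"
    define V where "V = {v \<in> carrier_vec n. Q *\<^sub>v v \<in> W}"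
    have "V = {0\<^sub>v n} \<or> V = carrier_vec n"
    proof (rule irr)
      show "lin_subspace n V"
        using W Q mult_zero_vec[OF Q] unfolding lin_subspace_def V_def
        by (auto simp: mult_add_distrib_mat_vec[of _ n n] mult_mat_vec[of _ n n])
      show "g *\<^sub>v w \<in> V" if g: "g \<in> G" and w: "w \<in> V" for g w
      proof -
        have wc: "w \<in> carrier_vec n" "Q *\<^sub>v w \<in> W" using w by (auto simp: V_def)
        have "Q * g * P *\<^sub>v (Q *\<^sub>v w) = (Q * g * P * Q) *\<^sub>v w"
          using Gc[OF g] P Q wc by (intro assoc_mult_mat_vec[symmetric]) auto
        also have "Q * g * P * Q = Q * g" using Gc[OF g] P Q PQ by (simp add: assoc_mult_mat[of _ n n _ n _ n])
        also have "(Q * g) *\<^sub>v w = Q *\<^sub>v (g *\<^sub>v w)" using Gc[OF g] Q wc by (intro assoc_mult_mat_vec) auto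
        finally have "Q *\<^sub>v (g *\<^sub>v w) \<in> W" using st[of "Q * g * P" "Q *\<^sub>v w"] g wc(2) by auto
        then show ?thesis using Gc[OF g] wc by (auto simp: V_def)
      qed
    qed
    moreover have QP: "Q *\<^sub>v (P *\<^sub>v w) = w" "P *\<^sub>v w \<in> carrier_vec n" if "w \<in> carrier_vec n" for w
      using that P Q PQ by (auto simp: assoc_mult_mat_vec[symmetric, of _ n n _ n])
    moreover have Wc: "W \<subseteq> carrier_vec n" "0\<^sub>v n \<in> W" using W by (auto simp: lin_subspace_def)
    ultimately show "W = {0\<^sub>v n} \<or> W = carrier_vec n"
    proof (elim disjE)
      assume V0: "V = {0\<^sub>v n}"
      have "w = 0\<^sub>v n" if w: "w \<in> W" for w
      proof -
        have "P *\<^sub>v w \<in> V" using QP[of w] w Wc by (auto simp: V_def)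
        then show ?thesis using QP(1)[of w] w Wc mult_zero_vec[OF Q] unfolding V0 by auto
      qed
      then have "W = {0\<^sub>v n}" using Wc(2) by blast
      then show ?thesis ..
    next
      assume V1: "V = carrier_vec n"
      have "w \<in> W" if w: "w \<in> carrier_vec n" for w
      proof -
        have "P *\<^sub>v w \<in> V" using QP(2)[OF w] V1 by simp
        then show ?thesis using QP(1)[OF w] by (simp add: V_def)
      qed
      then have "W = carrier_vec n" using Wc(1) by blast
      then show ?thesis ..
    qed
  qed
qed

lemma eq_SL_if_separated:
  assumes g: "\<gamma> \<in> G" and cp: "char_poly \<gamma> = (\<Prod>i<n. [:- a i, 1:])"
    and inj: "\<And>i j. i < n \<Longrightarrow> j < n \<Longrightarrow> i \<noteq> j \<Longrightarrow> a i \<noteq> a j"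
    and sep: "separated n a k"
  shows "G = SL_set n"
proof -
  obtain P Q where P: "P \<in> carrier_mat n n" and Q: "Q \<in> carrier_mat n n"
    and PQ: "P * Q = 1\<^sub>m n" "Q * P = 1\<^sub>m n"
    and D: "\<forall>i<n. \<forall>j<n. (Q * \<gamma> * P) $$ (i, j) = (if i = j then a i else 0)"
    using diagonalize[OF Gc[OF g] cp inj] by blast
  let ?H = "(\<lambda>g. Q * g * P) ` G"
  interpret H: irreducible_group n ?H by (rule conjugate_group[OF P Q PQ])
  interpret H: diagonal_element n ?H "Q * \<gamma> * P" a k
  proof
    show "Q * \<gamma> * P \<in> ?H" using g by blast
    show "(Q * \<gamma> * P) $$ (i, j) = (if i = j then a i else 0)" if "i < n" "j < n" for i j
      using D that by blast
    show "k < n" using sep by (simp add: separated_def)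
    show "i = k \<and> j = l" if "i < n" "j < n" "l < n" "l \<noteq> k" "a i * a l = a k * a j" for i j l
      using sep that unfolding separated_def by blast
  qed
  have H: "?H = SL_set n" by (rule H.eq_SL_if_lie_contains_sl[OF H.lie_contains_sl])
  show ?thesis
  proof (rule equalityI[OF SL subsetI])
    fix x :: "'a mat" assume x: "x \<in> SL_set n"
    then have xc: "x \<in> carrier_mat n n" "det x = 1" by (auto simp: SL_set_def)
    have "det P * det Q = 1" using det_mult[OF P Q] PQ(1) by simp
    then have "Q * x * P \<in> SL_set n"
      using P Q xc by (simp add: SL_set_def det_mult[of _ n] mult.commute)
    then obtain y where y: "y \<in> G" "Q * x * P = Q * y * P" using H by blast
    have PQz: "P * (Q * z * P) * Q = z" if z: "z \<in> carrier_mat n n" for z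
    proof -
      have "P * (Q * z * P) * Q = P * Q * z * (P * Q)"
        using P Q z by (simp add: assoc_mult_mat[of _ n n _ n _ n])
      then show ?thesis using z PQ by simp
    qed
    have "x = P * (Q * x * P) * Q" by (rule PQz[OF xc(1), symmetric])
    also have "\<dots> = y" unfolding y(2) by (rule PQz[OF Gc[OF y(1)]])
    finally have "x = y" .
    then show "x \<in> G" using y(1) by simp
  qed
qed

text \<open>In dimension two the eigenvalues \<open>i\<close> and \<open>- i\<close> have to be avoided; this is possible by
  irreducibility of \<open>G\<close>, since the trace and the discriminant are not identically zero.\<close>

lemma eq_SL_dim_two:
  assumes n: "n = 2" and g: "\<gamma> \<in> G" and cp: "char_poly \<gamma> = (\<Prod>i<n. [:- a i, 1:])" and a: "a 0 \<noteq> a 1"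
  shows "G = SL_set n"
proof -
  define \<tau> where "\<tau> x = 2 - det (- (char_matrix x 1))" for x :: "'a mat"
  have lt2: "{..<n} = {0, 1}" using n by auto
  have polyfun_\<tau>: "polyfun n \<tau>"
    unfolding \<tau>_def
  proof (intro polyfun_diff polyfun_const polyfun_det[where m = n])
    show "- char_matrix A 1 \<in> carrier_mat n n" if "A \<in> carrier_mat n n" for A :: "'a mat"
      using that by (simp add: char_matrix_def)
    show "polyfun n (\<lambda>A. (- char_matrix A 1) $$ (i, j))" if "i < n" "j < n" for i j
      by (rule polyfun_cong[of n "\<lambda>A. - (A $$ (i, j) + (if i = j then -1 else 0))"])
        (use that in \<open>auto simp: char_matrix_def\<close>)
  qed
  have roots: "b 0 * b 1 = 1 \<and> b 0 + b 1 = \<tau> x"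
    if x: "x \<in> G" and cpx: "char_poly x = (\<Prod>i<n. [:- b i, 1:])" for x b
  proof -
    have "b 0 * b 1 = 1" using char_poly_det_zero[OF Gc[OF x] cpx] det1[OF x] unfolding lt2 by simp
    moreover have "(1 - b 0) * (1 - b 1) = 2 - \<tau> x"
      using char_poly_eval_det[OF Gc[OF x] cpx, of 1] unfolding lt2 \<tau>_def by simp
    ultimately show ?thesis by (simp add: algebra_simps)
  qed
  have fin: "G = SL_set n" if x: "x \<in> G" and cpx: "char_poly x = (\<Prod>i<n. [:- b i, 1:])"
    and b: "b 0 \<noteq> b 1" "b 0 * b 0 \<noteq> b 1 * b 1" for x b
  proof (rule eq_SL_if_separated[OF x cpx])
    show "b i \<noteq> b j" if "i < n" "j < n" "i \<noteq> j" for i j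
      using that b n by (auto simp: less_2_cases_iff)
    have nz: "b 0 \<noteq> 0" "b 1 \<noteq> 0" using roots[OF x cpx] by auto
    show "separated n b 0"
      unfolding separated_def using n b nz by (auto simp: less_2_cases_iff mult.commute)
  qed
  show ?thesis
  proof (cases "(2 :: 'a) = 0")
    case True
    have "(a 0 - a 1) * (a 0 - a 1) = a 0 * a 0 - a 1 * a 1 - 2 * (a 0 * a 1) + 2 * (a 1 * a 1)"
      by (simp add: algebra_simps)
    then have "a 0 * a 0 \<noteq> a 1 * a 1" using a True by auto
    then show ?thesis using fin[OF g cp a] by blast
  next
    case False
    have tr: "(b 0 - b 1) ^ 2 = \<tau> x ^ 2 - 4" if "x \<in> G" "char_poly x = (\<Prod>i<n. [:- b i, 1:])" for x b
    proof -
      have "(b 0 - b 1) ^ 2 = (b 0 + b 1) ^ 2 - 4 * (b 0 * b 1)" by (simp add: power2_eq_square algebra_simps)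
      then show ?thesis using roots[OF that] by simp
    qed
    have "\<tau> (1\<^sub>m n) = 2"
    proof -
      have "- char_matrix (1\<^sub>m n) 1 = (0\<^sub>m n n :: 'a mat)" by (rule eq_matI) (auto simp: char_matrix_def)
      then show ?thesis using n_pos by (simp add: \<tau>_def)
    qed
    then have t1: "\<tau> (1\<^sub>m n) \<noteq> 0" using False by simp
    have t2: "\<tau> \<gamma> ^ 2 - 4 \<noteq> 0" using tr[OF g cp] a by auto
    have "\<exists>x\<in>G. (\<tau> x ^ 2 - 4) * \<tau> x \<noteq> 0"
    proof (rule ccontr)
      assume "\<not> ?thesis"
      then have "(\<forall>x\<in>G. \<tau> x ^ 2 - 4 = 0) \<or> (\<forall>x\<in>G. \<tau> x = 0)"
        by (intro dom polyfun_diff polyfun_power polyfun_\<tau> polyfun_const) auto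
      then show False using t1 t2 g one by blast
    qed
    then obtain x where x: "x \<in> G" "\<tau> x ^ 2 - 4 \<noteq> 0" "\<tau> x \<noteq> 0" by auto
    obtain b where b: "char_poly x = (\<Prod>i<n. [:- b i, 1:])" using f_mor_eigenvalues[OF ac Gc[OF x(1)]] by blast
    have "b 0 \<noteq> b 1" using tr[OF x(1) b] x(2) by auto
    moreover have "b 0 * b 0 \<noteq> b 1 * b 1"
    proof
      assume "b 0 * b 0 = b 1 * b 1"
      then have "(b 0 - b 1) * (b 0 + b 1) = 0" by (simp add: algebra_simps)
      then show False using \<open>b 0 \<noteq> b 1\<close> roots[OF x(1) b] x(3) by auto
    qed
    ultimately show ?thesis by (rule fin[OF x(1) b])
  qed
qed

end

theorem mainTheorem5:
  fixes G :: "'a::field mat set" and n :: nat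
  assumes "n \<ge> 2"
    and "alg_closed TYPE('a)"
    and "algebraic_subgroup n G"
    and "G \<subseteq> SL_set n"
    and "zariski_connected n G"
    and "semisimple_alg n G"
    and "taut_irreducible n G"
    and "\<exists>\<gamma>\<in>G. f_mor n \<gamma> \<noteq> 0"
  shows "G = SL_set n"
proof -
  interpret GL: group "GL n :: 'a mat monoid" by (rule group_GL)
  have sub: "subgroup G (GL n)" and cl: "zariski_closed n G"
    using assms(3) by (auto simp: algebraic_subgroup_def)
  interpret irreducible_group n G
  proof
    show "n \<ge> 2" "alg_closed TYPE('a)" "G \<subseteq> SL_set n" by (fact assms)+
    show "1\<^sub>m n \<in> G" using subgroup.one_closed[OF sub] by (simp add: GL_def)
    show "g * h \<in> G" if "g \<in> G" "h \<in> G" for g h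
      using subgroup.m_closed[OF sub that] by (simp add: GL_def)
    show "adj_mat g \<in> G" if g: "g \<in> G" for g
    proof -
      let ?h = "inv\<^bsub>GL n\<^esub> g"
      have h: "?h \<in> G" by (rule subgroup.m_inv_closed[OF sub g])
      have c: "g \<in> carrier (GL n)" "?h \<in> carrier (GL n)" using subgroup.subset[OF sub] g h by auto
      have "g * ?h = 1\<^sub>m n" using GL.r_inv[OF c(1)] by (simp add: GL_def)
      moreover have "det g = 1" using assms(4) g by (auto simp: SL_set_def)
      ultimately have "adj_mat g = ?h" using c by (intro adj_mat_eqI[of _ n]) (auto simp: GL_def)
      then show ?thesis using h by simp
    qed
    obtain S where S: "\<And>p. p \<in> S \<Longrightarrow> polyfun n p" "G = {A \<in> carrier_mat n n. \<forall>p\<in>S. p A = 0}"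
      using cl by (elim zariski_closedE) blast
    show "A \<in> G" if "A \<in> carrier_mat n n"
      "\<And>p. polyfun n p \<Longrightarrow> (\<And>g. g \<in> G \<Longrightarrow> p g = 0) \<Longrightarrow> p A = 0" for A
      using that S by blast
    show "(\<forall>g\<in>G. p g = 0) \<or> (\<forall>g\<in>G. q g = 0)"
      if "polyfun n p" "polyfun n q" "\<And>g. g \<in> G \<Longrightarrow> p g * q g = 0" for p q
      by (rule connected_imp_domain[OF assms(3,5) that])
    show "W = {0\<^sub>v n} \<or> W = carrier_vec n"
      if "lin_subspace n W" "\<And>g w. g \<in> G \<Longrightarrow> w \<in> W \<Longrightarrow> g *\<^sub>v w \<in> W" for W
      using assms(7) that unfolding taut_irreducible_def by blast
  qed
  obtain \<gamma> where \<gamma>: "\<gamma> \<in> G" "f_mor n \<gamma> \<noteq> 0" using assms(8) by blast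
  obtain a where cp: "char_poly \<gamma> = (\<Prod>i<n. [:- a i, 1:])" and "f_mor n \<gamma> = f_expr n a"
    using f_mor_eigenvalues[OF assms(2) Gc[OF \<gamma>(1)]] by blast
  then have f: "f_expr n a \<noteq> 0" using \<gamma>(2) by simp
  note rel = f_expr_nonzero[OF f]
  show ?thesis
  proof (cases "n = 2")
    case True
    then show ?thesis using eq_SL_dim_two[OF True \<gamma>(1) cp] rel(1)[of 0 1] by simp
  next
    case False
    have "(\<Prod>i<n. a i) = 1" using char_poly_det_zero[OF Gc[OF \<gamma>(1)] cp] det1[OF \<gamma>(1)] by simp
    then have nz: "a i \<noteq> 0" if "i < n" for i using that by (metis finite_lessThan lessThan_iff prod_zero zero_neq_one)
    obtain k where "separated n a k"
      using separated_exists[of n a, OF _ nz rel] False assms(1) by auto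
    then show ?thesis using eq_SL_if_separated[OF \<gamma>(1) cp rel(1)] by blast
  qed
qed

end
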